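(* Let $K\subset\mathbb{R}^n$ be a convex body with the origin in its interior, and let $p,q$ be nonzero real numbers. (i) If either $-n<q<p$ or $q<p<-n$, then $$\left(\frac{\tilde G_q(K)}{n|K|}\right)^{\frac{n+q}{q}}\le\left(\frac{\tilde G_p(K)}{n|K|}\right)^{\frac{n+p}{p}}.$$ (ii) If $q<-n<p$, then $$\left(\frac{\tilde G_q(K)}{n|K|}\right)^{\frac{n+q}{q}}\ge\left(\frac{\tilde G_p(K)}{n|K|}\right)^{\frac{n+p}{p}}.$$
   Context: Fix an integer $n\ge1$. A convex body in $\mathbb{R}^n$ is a compact convex set with nonempty interior; $\mathcal{K}_0$ is the set of convex bodies containing the origin in their interior. For $K\in\mathcal{K}_0$, $K^\circ=\{y:\langle x,y\rangle\le1\ \forall x\in K\}$ is the polar body, $h_K(u)=\max_{x\in K}\langle x,u\rangle$ ($u\in S^{n-1}$) the support function, $|\cdot|$ is volume. $S(K,\cdot)$ is the surface area measure of $K$ on $S^{n-1}$: $S(K,A)$ is the $(n-1)$-dimensional Hausdorff measure of the set of $x\in\partial K$ at which $K$ has an outer unit normal in $A$. For $p\in\mathbb{R}$ and $K,Q\in\mathcal{K}_0$, $$V_p(K,Q)=\frac1n\int_{S^{n-1}}h_Q(u)^p\,h_K(u)^{1-p}\,dS(K,u).$$ The $L_p$ geominimal surface area of $K\in\mathcal{K}_0$ is $$\tilde G_p(K)=\inf_{Q\in\mathcal{K}_0}\Big\{n\,V_p(K,Q)^{\frac n{n+p}}|Q^\circ|^{\frac p{n+p}}\Big\}\ (p\ge0),\qquad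 \tilde G_p(K)=\sup_{Q\in\mathcal{K}_0}\Big\{n\,V_p(K,Q)^{\frac n{n+p}}|Q^\circ|^{\frac p{n+p}}\Big\}\ (-n\ne p<0),$$ the supremum being taken in $(0,+\infty]$, with the conventions $(+\infty)^a=+\infty$ for $a>0$ and $(+\infty)^a=0$ for $a<0$. *)

theory Defs
  imports "HOL-Analysis.Analysis"
begin

definition convex_body :: "(real^'n) set \<Rightarrow> bool" where
  "convex_body K \<longleftrightarrow> compact K \<and> convex K \<and> interior K \<noteq> {}"

definition convex_bodies0 :: "(real^'n) set set" where
  "convex_bodies0 = {K. convex_body K \<and> 0 \<in> interior K}"

definition polar_body :: "(real^'n) set \<Rightarrow> (real^'n) set" where
  "polar_body K = {y. \<forall>x\<in>K. x \<bullet> y \<le> 1}"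

definition support_fun :: "(real^'n) set \<Rightarrow> real^'n \<Rightarrow> real" where
  "support_fun K u = (SUP x\<in>K. x \<bullet> u)"

definition outer_unit_normal :: "(real^'n) set \<Rightarrow> real^'n \<Rightarrow> real^'n \<Rightarrow> bool" where
  "outer_unit_normal K x u \<longleftrightarrow> norm u = 1 \<and> (\<forall>y\<in>K. y \<bullet> u \<le> x \<bullet> u)"

text \<open>
  The \<open>s\<close>-dimensional Hausdorff outer measure, with the usual normalisation under which it
  agrees with Lebesgue measure in dimension \<open>s\<close>.  The empty set needs separate treatment
  because \<open>0 ^ 0 = 1\<close>: for \<open>s = 0\<close> only nonempty sets of a cover count, so that the result is
  counting measure.  Boundedness is required because \<^const>\<open>diameter\<close> is a real number and
  is meaningless for unbounded sets.
\<close>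

definition hausdorff_weight :: "nat \<Rightarrow> (real^'n) set \<Rightarrow> ennreal" where
  "hausdorff_weight s C =
     (if C = {} then 0 else ennreal (unit_ball_vol (real s) * (diameter C / 2) ^ s))"

definition hausdorff_premeasure :: "nat \<Rightarrow> real \<Rightarrow> (real^'n) set \<Rightarrow> ennreal" where
  "hausdorff_premeasure s \<delta> A =
     (INF C\<in>{C :: nat \<Rightarrow> (real^'n) set.
               (\<forall>i. bounded (C i) \<and> diameter (C i) \<le> \<delta>) \<and> A \<subseteq> (\<Union>i. C i)}.
        \<Sum>i. hausdorff_weight s (C i))"

definition hausdorff_measure :: "nat \<Rightarrow> (real^'n) set \<Rightarrow> ennreal" where
  "hausdorff_measure s A = (SUP \<delta>\<in>{0<..}. hausdorff_premeasure s \<delta> A)"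

text \<open>The surface area measure is a measure on the Borel subsets of the unit sphere.\<close>

definition surface_area_measure :: "(real^'n) set \<Rightarrow> (real^'n) measure" where
  "surface_area_measure K =
     measure_of (sphere 0 1) (sets (restrict_space borel (sphere 0 1)))
       (\<lambda>A. hausdorff_measure (CARD('n) - 1)
              {x \<in> frontier K. \<exists>u\<in>A. outer_unit_normal K x u})"

definition Lp_mixed_volume :: "real \<Rightarrow> (real^'n) set \<Rightarrow> (real^'n) set \<Rightarrow> real" where
  "Lp_mixed_volume p K Q =
     (1 / real CARD('n)) *
       (\<integral>u. support_fun Q u powr p * support_fun K u powr (1 - p) \<partial>surface_area_measure K)"

definition geominimal_functional :: "real \<Rightarrow> (real^'n) set \<Rightarrow> (real^'n) set \<Rightarrow> real" where
  "geominimal_functional p K Q =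
     real CARD('n) * Lp_mixed_volume p K Q powr (real CARD('n) / (real CARD('n) + p))
       * measure lebesgue (polar_body Q) powr (p / (real CARD('n) + p))"

text \<open>
  The supremum may be infinite, so the values are in \<^typ>\<open>ennreal\<close>.  The value for
  \<open>p = - n\<close>, where the mathematical notion is undefined, is meaningless.
\<close>

definition Lp_geominimal :: "real \<Rightarrow> (real^'n) set \<Rightarrow> ennreal" where
  "Lp_geominimal p K =
     (if 0 \<le> p then (INF Q\<in>convex_bodies0. ennreal (geominimal_functional p K Q))
      else (SUP Q\<in>convex_bodies0. ennreal (geominimal_functional p K Q)))"

text \<open>
  Real powers on \<open>[0, \<infinity>]\<close>.  As for \<^const>\<open>powr\<close>, the power of \<open>0\<close> with negative exponent is
  the conventional value \<open>0\<close>; it plays no role for the geominimal surface area, which is raised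
  to a negative power only for \<open>-n < p < 0\<close>, where it is a supremum of positive numbers.
\<close>

definition ennreal_powr :: "ennreal \<Rightarrow> real \<Rightarrow> ennreal" where
  "ennreal_powr x a =
     (if x = \<infinity> then (if 0 < a then \<infinity> else if a < 0 then 0 else 1)
      else ennreal (enn2real x powr a))"

end

theory Submission
  imports Defs
begin

text \<open>
  Dividing the defining functional by \<open>n|K|\<close> and raising it to the power \<open>(n+p)/p\<close> turns it into
  \<open>(V\<^sub>p(K,Q)/|K|)\<^bsup>n/p\<^esup> |Q\<degree>|/|K|\<close>, and the same operation turns the geominimal surface area into
  the infimum of these quantities over \<open>Q\<close> if \<open>p > -n\<close> and into their supremum if \<open>p < -n\<close>.  For fixed \<open>Q\<close> they
  increase with \<open>p\<close>, being power means of \<open>h\<^sub>Q/h\<^sub>K\<close>, and they do not depend on \<open>p\<close> when \<open>Q = K\<close>.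
  The means are taken with respect to the measure \<open>h\<^sub>K dS(K,\<cdot>)/n\<close>, so everything depends on its
  total mass being exactly \<open>|K|\<close>.

  That identity is obtained from the shell between \<open>(1-\<epsilon>)K\<close> and \<open>K\<close>.  Where the normals are within
  \<open>\<epsilon>\<close> of \<open>u\<close>, monotonicity of the normals makes the orthogonal projection along \<open>u\<close>
  almost isometric on the boundary, and the shell over such a piece of boundary
  is almost isometric to an oblique cylinder of height \<open>\<epsilon>h\<^sub>K(u)\<close>.  Almost isometries almost preserve
  Hausdorff measures, and these agree with Lebesgue measure on coordinate subspaces by the
  isodiametric inequality and a Vitali covering argument.  Boundary points with several normals
  are negligible, which also makes the surface area measure countably additive.
\<close>

section \<open>Hausdorff measure\<close>

text \<open>All errors are kept multiplicative: each comparison on a piece of boundary costs only a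
  fixed power of \<open>1 - distortion * \<epsilon>\<close>, and such a loss survives summation over
  a partition however many pieces it has. Relative errors are available because 0 is interior, so
  that \<open>x \<bullet> u\<close> is at least \<open>inradius\<close> for every boundary point
  \<open>x\<close> with normal \<open>u\<close>.

  Volume is treated as Hausdorff measure of full dimension, so that one Lipschitz comparison serves
  both the boundary pieces and the shells. The constant in \<open>hausdorff_weight\<close> must then
  be the sharp one in both dimensions, which is why the exact agreement with Lebesgue measure is
  established.

  The exact mass |K| matters twice. The power-mean comparison requires division by the total mass of
  the weight; and part (ii) compares an infimum with a supremum through \<open>Q = K\<close>, where
  V_p(K,K)/|K| has to be 1 for its powers n/p and n/q to agree.\<close>

lemma hausdorff_premeasure_le_weight:
  assumes "bounded C" "diameter C \<le> \<delta>" "0 \<le> \<delta>" "A \<subseteq> C"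
  shows "hausdorff_premeasure s \<delta> A \<le> hausdorff_weight s C"
proof -
  let ?C = "\<lambda>i::nat. if i = 0 then C else {}"
  have "hausdorff_premeasure s \<delta> A \<le> (\<Sum>i. hausdorff_weight s (?C i))"
    unfolding hausdorff_premeasure_def
    using assms by (intro INF_lower) (auto intro!: exI[of _ 0])
  also have "\<dots> = hausdorff_weight s C"
    by (subst suminf_finite[of "{0}"]) (auto simp: hausdorff_weight_def)
  finally show ?thesis .
qed

lemma hausdorff_premeasure_empty [simp]: "0 \<le> \<delta> \<Longrightarrow> hausdorff_premeasure s \<delta> {} = 0"
  using hausdorff_premeasure_le_weight[of "{}" \<delta> "{}" s] by (simp add: hausdorff_weight_def)

lemma hausdorff_premeasure_mono:
  "A \<subseteq> B \<Longrightarrow> hausdorff_premeasure s \<delta> A \<le> hausdorff_premeasure s \<delta> B"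
  unfolding hausdorff_premeasure_def by (intro INF_superset_mono) auto

lemma hausdorff_premeasure_antimono:
  "\<delta> \<le> \<delta>' \<Longrightarrow> hausdorff_premeasure s \<delta>' A \<le> hausdorff_premeasure s \<delta> A"
  unfolding hausdorff_premeasure_def by (intro INF_superset_mono) (auto intro: order_trans)

lemma hausdorff_premeasure_countably_subadditive:
  fixes A :: "nat \<Rightarrow> (real^'n) set"
  shows "hausdorff_premeasure s \<delta> (\<Union>i. A i) \<le> (\<Sum>i. hausdorff_premeasure s \<delta> (A i))"
proof (rule ennreal_le_epsilon)
  fix e :: real
  let ?O = "hausdorff_premeasure s \<delta>" and ?f = "hausdorff_weight s"
  let ?P = "\<lambda>A C. (\<forall>i. bounded (C i) \<and> diameter (C i) \<le> \<delta>) \<and> A \<subseteq> (\<Union>i::nat. C i)"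
  assume "0 < e" and fin: "(\<Sum>n. ?O (A n)) < top"
  then have lt: "?O (A n) < ?O (A n) + e * (1/2)^Suc n" for n
    by (auto simp add: less_top dest!: ennreal_suminf_lessD)
  have "\<exists>C. ?P (A n) C \<and> (\<Sum>i. ?f (C i)) \<le> ?O (A n) + e * (1/2)^Suc n" for n
  proof -
    have "(INF C\<in>{C. ?P (A n) C}. \<Sum>i. ?f (C i)) < ?O (A n) + e * (1/2)^Suc n"
      using lt[of n] unfolding hausdorff_premeasure_def[of s \<delta> "A n"] .
    then show ?thesis
      unfolding INF_less_iff by (auto intro: less_imp_le)
  qed
  then obtain B where P: "\<And>n. ?P (A n) (B n)"
    and Ble: "\<And>n. (\<Sum>i. ?f (B n i)) \<le> ?O (A n) + e * (1/2)^Suc n" by metis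
  define C where "C = case_prod B o prod_decode"
  have C: "?P (\<Union>i. A i) C"
  proof safe
    fix x n assume "x \<in> A n"
    then obtain i where "x \<in> B n i" using P by blast
    then have "x \<in> C (prod_encode (n, i))" by (simp add: C_def)
    then show "x \<in> (\<Union>i. C i)" by blast
  qed (use P in \<open>auto simp: C_def split_def\<close>)
  then have "?O (\<Union>i. A i) \<le> (\<Sum>i. ?f (C i))"
    unfolding hausdorff_premeasure_def by (intro INF_lower) auto
  also have "\<dots> = (\<Sum>n. \<Sum>i. ?f (B n i))"
    unfolding C_def comp_def by (intro suminf_ennreal_2dimen) auto
  also have "\<dots> \<le> (\<Sum>n. ?O (A n) + e * (1/2) ^ Suc n)"
    by (intro suminf_le suminf_nonneg allI Ble) auto
  also have "... = (\<Sum>n. ?O (A n)) + (\<Sum>n. ennreal e * ennreal ((1/2) ^ Suc n))"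
    using \<open>0 < e\<close> by (subst suminf_add[symmetric])
                     (auto simp del: ennreal_suminf_cmult simp add: ennreal_mult[symmetric])
  also have "\<dots> = (\<Sum>n. ?O (A n)) + e"
    unfolding ennreal_suminf_cmult
    by (subst suminf_ennreal_eq[OF zero_le_power power_half_series]) auto
  finally show "?O (\<Union>i. A i) \<le> (\<Sum>n. ?O (A n)) + e" .
qed

lemma hausdorff_premeasure_Un:
  assumes "0 \<le> \<delta>"
  shows "hausdorff_premeasure s \<delta> (A \<union> B) \<le> hausdorff_premeasure s \<delta> A + hausdorff_premeasure s \<delta> B"
proof -
  let ?A = "\<lambda>i::nat. if i = 0 then A else if i = 1 then B else {}"
  have "hausdorff_premeasure s \<delta> (\<Union>i. ?A i) \<le> (\<Sum>i. hausdorff_premeasure s \<delta> (?A i))"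
    by (rule hausdorff_premeasure_countably_subadditive)
  also have "\<dots> = hausdorff_premeasure s \<delta> A + hausdorff_premeasure s \<delta> B"
    using assms by (subst suminf_finite[of "{0, 1}"]) auto
  also have "(\<Union>i. ?A i) = A \<union> B"
  proof (intro equalityI subsetI)
    fix x assume "x \<in> A \<union> B"
    then have "x \<in> ?A 0 \<or> x \<in> ?A 1" by auto
    then show "x \<in> (\<Union>i. ?A i)" by blast
  qed (auto split: if_splits)
  finally show ?thesis .
qed

lemma hausdorff_measure_mono: "A \<subseteq> B \<Longrightarrow> hausdorff_measure s A \<le> hausdorff_measure s B"
  unfolding hausdorff_measure_def by (intro SUP_mono) (blast intro: hausdorff_premeasure_mono)

lemma hausdorff_premeasure_le_measure:
  "0 < \<delta> \<Longrightarrow> hausdorff_premeasure s \<delta> A \<le> hausdorff_measure s A"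
  unfolding hausdorff_measure_def by (intro SUP_upper) auto

lemma hausdorff_measure_leI:
  "(\<And>\<delta>. 0 < \<delta> \<Longrightarrow> hausdorff_premeasure s \<delta> A \<le> x) \<Longrightarrow> hausdorff_measure s A \<le> x"
  unfolding hausdorff_measure_def by (intro SUP_least) auto

lemma hausdorff_measure_empty [simp]: "hausdorff_measure s {} = 0"
  by (intro antisym hausdorff_measure_leI) auto

lemma hausdorff_measure_countably_subadditive:
  "hausdorff_measure s (\<Union>i::nat. A i) \<le> (\<Sum>i. hausdorff_measure s (A i))"
proof (rule hausdorff_measure_leI)
  fix \<delta> :: real assume "0 < \<delta>"
  have "hausdorff_premeasure s \<delta> (\<Union>i. A i) \<le> (\<Sum>i. hausdorff_premeasure s \<delta> (A i))"
    by (rule hausdorff_premeasure_countably_subadditive)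
  also have "\<dots> \<le> (\<Sum>i. hausdorff_measure s (A i))"
    using \<open>0 < \<delta>\<close> by (intro suminf_le allI hausdorff_premeasure_le_measure) auto
  finally show "hausdorff_premeasure s \<delta> (\<Union>i. A i) \<le> \<dots>" .
qed

lemma hausdorff_measure_Un: "hausdorff_measure s (A \<union> B) \<le> hausdorff_measure s A + hausdorff_measure s B"
  by (rule hausdorff_measure_leI)
     (meson add_mono hausdorff_premeasure_Un hausdorff_premeasure_le_measure less_imp_le order_trans)

lemma hausdorff_measure_null_UN:
  assumes "countable I" "\<And>i. i \<in> I \<Longrightarrow> hausdorff_measure s (A i) = 0"
  shows "hausdorff_measure s (\<Union>i\<in>I. A i) = 0"
proof (cases "I = {}")
  case False
  have "(\<Union>i\<in>I. A i) = (\<Union>k. A (from_nat_into I k))"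
    using range_from_nat_into[OF False assms(1)] by force
  moreover have "hausdorff_measure s (\<Union>k. A (from_nat_into I k)) \<le> (\<Sum>k. hausdorff_measure s (A (from_nat_into I k)))"
    by (rule hausdorff_measure_countably_subadditive)
  ultimately show ?thesis
    using assms(2) from_nat_into[OF False] by simp
qed simp

text \<open>No set of diameter below \<open>d\<close> meets both parts, so a fine cover of the union
  splits into covers of the two parts. This is the separation property behind the measurability of
  closed sets.\<close>

lemma hausdorff_measure_Un_separated:
  fixes A B :: "(real^'n) set"
  assumes "0 < d" and sep: "\<And>x y. x \<in> A \<Longrightarrow> y \<in> B \<Longrightarrow> d \<le> dist x y"
  shows "hausdorff_measure s A + hausdorff_measure s B \<le> hausdorff_measure s (A \<union> B)"
proof -
  have key: "hausdorff_premeasure s \<delta> A + hausdorff_premeasure s \<delta> B \<le> hausdorff_premeasure s \<delta> (A \<union> B)"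
    if "0 < \<delta>" "\<delta> < d" for \<delta>
    unfolding hausdorff_premeasure_def[of s \<delta> "A \<union> B"]
  proof (rule INF_greatest, clarsimp)
    fix C :: "nat \<Rightarrow> (real^'n) set"
    assume C: "\<forall>i. bounded (C i) \<and> diameter (C i) \<le> \<delta>" "A \<subseteq> (\<Union>i. C i)" "B \<subseteq> (\<Union>i. C i)"
    \<comment> \<open>Sets missing \<open>A\<close> are replaced by the empty set, whose weight is 0
      even when \<open>s\<close> is 0.\<close>
    let ?A = "\<lambda>i. if C i \<inter> A = {} then {} else C i"
    let ?B = "\<lambda>i. if C i \<inter> B = {} then {} else C i"
    have "hausdorff_premeasure s \<delta> A \<le> (\<Sum>i. hausdorff_weight s (?A i))"
      unfolding hausdorff_premeasure_def using C that by (intro INF_lower) fastforce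
    moreover have "hausdorff_premeasure s \<delta> B \<le> (\<Sum>i. hausdorff_weight s (?B i))"
      unfolding hausdorff_premeasure_def using C that by (intro INF_lower) fastforce
    moreover have "hausdorff_weight s (?A i) + hausdorff_weight s (?B i) \<le> hausdorff_weight s (C i)" for i
    proof -
      have "C i \<inter> A = {} \<or> C i \<inter> B = {}"
      proof (rule ccontr)
        assume "\<not> ?thesis"
        then obtain x y where "x \<in> C i" "x \<in> A" "y \<in> C i" "y \<in> B" by blast
        then have "d \<le> diameter (C i)"
          using sep diameter_bounded_bound C(1) by (meson order_trans)
        then show False using C(1) that by (meson not_less order_trans)
      qed
      then show ?thesis by (auto simp: hausdorff_weight_def)
    qed
    then have "(\<Sum>i. hausdorff_weight s (?A i)) + (\<Sum>i. hausdorff_weight s (?B i)) \<le> (\<Sum>i. hausdorff_weight s (C i))"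
      by (subst suminf_add) (auto intro!: suminf_le)
    ultimately show "hausdorff_premeasure s \<delta> A + hausdorff_premeasure s \<delta> B \<le> (\<Sum>i. hausdorff_weight s (C i))"
      by (meson add_mono order_trans)
  qed
  \<comment> \<open>The scales vary independently because the two suprema are taken one after the
    other; a smaller common scale dominates both.\<close>
  have le: "hausdorff_premeasure s \<delta> A + hausdorff_premeasure s \<delta>' B \<le> hausdorff_measure s (A \<union> B)"
    if "0 < \<delta>" "0 < \<delta>'" for \<delta> \<delta>'
  proof -
    define \<eta> where "\<eta> = min (d/2) (min \<delta> \<delta>')"
    have \<eta>: "0 < \<eta>" "\<eta> < d" "\<eta> \<le> \<delta>" "\<eta> \<le> \<delta>'" using that \<open>0 < d\<close> by (auto simp: \<eta>_def)
    have "hausdorff_premeasure s \<delta> A + hausdorff_premeasure s \<delta>' B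
        \<le> hausdorff_premeasure s \<eta> A + hausdorff_premeasure s \<eta> B"
      by (intro add_mono hausdorff_premeasure_antimono \<eta>)
    also have "\<dots> \<le> hausdorff_measure s (A \<union> B)"
      using key hausdorff_premeasure_le_measure \<eta> by (meson order_trans)
    finally show ?thesis .
  qed
  have "hausdorff_premeasure s \<delta> A + hausdorff_measure s B \<le> hausdorff_measure s (A \<union> B)" if "0 < \<delta>" for \<delta>
    using le[OF that] unfolding hausdorff_measure_def[of s B]
    by (subst ennreal_SUP_add_right) (auto intro!: SUP_least)
  then show ?thesis
    unfolding hausdorff_measure_def[of s A]
    by (subst ennreal_SUP_add_left[symmetric]) (auto intro!: SUP_least)
qed

text \<open>
  The shells at distance between \<open>1/(k+2)\<close> and \<open>1/(k+1)\<close> from a closed set are separated when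
  their indices differ by at least two, so their measures are summable.
\<close>

lemma hausdorff_measure_closed_caratheodory:
  fixes F E :: "(real^'n) set"
  assumes F: "closed F"
  shows "hausdorff_measure s (E \<inter> F) + hausdorff_measure s (E - F) = hausdorff_measure s E"
proof (rule antisym)
  let ?H = "hausdorff_measure s"
  show "?H E \<le> ?H (E \<inter> F) + ?H (E - F)"
    using hausdorff_measure_Un[of s "E \<inter> F" "E - F"] by (simp add: Int_Diff_Un)
  show "?H (E \<inter> F) + ?H (E - F) \<le> ?H E"
  proof (cases "F = {} \<or> ?H E = \<infinity>")
    case True then show ?thesis by auto
  next
    case False
    then have "F \<noteq> {}" and fin: "?H E < \<infinity>" by (auto simp: less_top)
    define r where "r x = infdist x F" for x
    have r_lip: "r x \<le> r y + dist x y" for x y unfolding r_def by (rule infdist_triangle)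
    have r_F: "r x \<le> dist x y" if "y \<in> F" for x y unfolding r_def by (rule infdist_le[OF that])
    have r_pos: "0 < r x" if "x \<notin> F" for x
      using that F \<open>F \<noteq> {}\<close> by (metis in_closed_iff_infdist_zero infdist_nonneg order_less_le r_def)
    \<comment> \<open>\<open>Ek k\<close> has positive distance from \<open>F\<close> and exhausts
      \<open>E - F\<close> up to the shells \<open>R i\<close> with
      \<open>i \<ge> k\<close>.\<close>
    define Ek where "Ek k = {x\<in>E. 1 / real (Suc k) \<le> r x}" for k
    define R where "R k = {x\<in>E. 1 / real (Suc (Suc k)) \<le> r x \<and> r x < 1 / real (Suc k)}" for k
    have Ek: "?H (E \<inter> F) + ?H (Ek k) \<le> ?H E" for k
    proof -
      have "?H (E \<inter> F) + ?H (Ek k) \<le> ?H ((E \<inter> F) \<union> Ek k)"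
        using r_F by (intro hausdorff_measure_Un_separated[of "1 / real (Suc k)"])
          (auto simp: Ek_def dist_commute intro: order_trans)
      also have "\<dots> \<le> ?H E" by (intro hausdorff_measure_mono) (auto simp: Ek_def)
      finally show ?thesis .
    qed
    \<comment> \<open>Only shells with indices of equal parity are added here, so that a gap lies
      between any two of them.\<close>
    have sub: "(\<Sum>k<N. ?H (R (2*k+j))) \<le> ?H (\<Union>k<N. R (2*k+j))" for N j
    proof (induction N)
      case (Suc N)
      have d: "1 / real (Suc (Suc (2*k+j))) - 1 / real (Suc (2*N+j)) \<ge> 1 / real (2*N+j) - 1 / real (Suc (2*N+j))" if "k < N" for k
        using that by (intro diff_right_mono frac_le) auto
      have "?H (\<Union>k<N. R (2*k+j)) + ?H (R (2*N+j)) \<le> ?H ((\<Union>k<N. R (2*k+j)) \<union> R (2*N+j))"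
      \<comment> \<open>For \<open>N = 0\<close> the union is empty; the gap used below would be
        negative there when \<open>j = 0\<close>, since \<open>1 / 0 = 0\<close>.\<close>
      proof (cases "N = 0")
        case False
        show ?thesis
        proof (rule hausdorff_measure_Un_separated)
          show "0 < 1 / real (2*N+j) - 1 / real (Suc (2*N+j))"
            using False by (intro diff_gt_0_iff_gt[THEN iffD2] divide_strict_left_mono) auto
          fix x y assume "x \<in> (\<Union>k<N. R (2*k+j))" "y \<in> R (2*N+j)"
          then obtain k where k: "k < N" "x \<in> R (2*k+j)" by auto
          then show "1 / real (2*N+j) - 1 / real (Suc (2*N+j)) \<le> dist x y"
            using d[OF k(1)] r_lip[of x y] \<open>y \<in> R (2*N+j)\<close> unfolding R_def by fastforce
        qed
      qed simp
      with Suc have "(\<Sum>k<Suc N. ?H (R (2*k+j))) \<le> ?H ((\<Union>k<N. R (2*k+j)) \<union> R (2*N+j))"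
        using order_trans[OF add_right_mono[of "\<Sum>k<N. ?H (R (2*k+j))" "?H (\<Union>k<N. R (2*k+j))" "?H (R (2*N+j))"]]
        by simp
      also have "(\<Union>k<N. R (2*k+j)) \<union> R (2*N+j) = (\<Union>k<Suc N. R (2*k+j))"
        by (auto simp: lessThan_Suc)
      finally show ?case .
    qed simp
    have sumR: "(\<Sum>k. ?H (R (2*k+j))) \<le> ?H E" for j
    proof (rule suminf_le_const)
      fix N show "(\<Sum>k<N. ?H (R (2*k+j))) \<le> ?H E"
        using sub[of j N] by (rule order_trans) (auto intro!: hausdorff_measure_mono simp: R_def)
    qed simp
    have "(\<Sum>k. ?H (R k)) \<le> 2 * ?H E"
    proof (rule suminf_le_const)
      fix N
      have "(\<Sum>k<N. ?H (R k)) \<le> (\<Sum>k<2*N. ?H (R k))" by (intro sum_mono2) auto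
      also have "\<dots> = (\<Sum>k<N. ?H (R (2*k+0))) + (\<Sum>k<N. ?H (R (2*k+1)))"
        by (induction N) (auto simp: algebra_simps)
      also have "\<dots> \<le> ?H E + ?H E"
        using sum_le_suminf[of "\<lambda>k. ?H (R (2*k+0))" "{..<N}"] sum_le_suminf[of "\<lambda>k. ?H (R (2*k+1))" "{..<N}"]
          sumR[of 0] sumR[of 1]
        by (intro add_mono) (auto intro: order_trans)
      finally show "(\<Sum>k<N. ?H (R k)) \<le> 2 * ?H E" by (simp add: mult_2)
    qed simp
    then have finR: "(\<Sum>k. ?H (R k)) \<noteq> \<infinity>"
      using fin by (auto simp: top_unique ennreal_mult_eq_top_iff)
    \<comment> \<open>A convergent sum of measures has vanishing tails, so the shells missing from
      \<open>Ek k\<close> become negligible.\<close>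
    have tail: "(\<lambda>k. \<Sum>i. ?H (R (i + k))) \<longlonglongrightarrow> 0"
    proof -
      have "(\<lambda>k. (\<Sum>i. ?H (R i)) - (\<Sum>i<k. ?H (R i))) \<longlonglongrightarrow> (\<Sum>i. ?H (R i)) - (\<Sum>i. ?H (R i))"
        using finR by (intro tendsto_diff_ennreal tendsto_const summable_LIMSEQ) auto
      moreover have "(\<Sum>i. ?H (R i)) - (\<Sum>i<k. ?H (R i)) = (\<Sum>i. ?H (R (i + k)))" for k
        using finR suminf_offset[of "\<lambda>i. ?H (R i)" k] by (simp add: top_unique ennreal_add_eq_top)
      ultimately show ?thesis using finR by simp
    qed
    have "?H (E \<inter> F) + ?H (E - F) \<le> ?H E + (\<Sum>i. ?H (R (i + k)))" for k
    proof -
      have "E - F \<subseteq> Ek k \<union> (\<Union>i. R (i + k))"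
      proof
        fix x assume x: "x \<in> E - F"
        show "x \<in> Ek k \<union> (\<Union>i. R (i + k))"
        proof (cases "x \<in> Ek k")
          case False
          then have lt: "r x < 1 / real (Suc k)" using x by (auto simp: Ek_def)
          define P where "P i \<longleftrightarrow> 1 / real (Suc i) \<le> r x" for i
          obtain i where "P i" using reals_Archimedean[OF r_pos[of x]] x
            by (auto simp: P_def inverse_eq_divide intro: less_imp_le)
          \<comment> \<open>The least index locates the shell: that its predecessor fails
            \<open>P\<close> is the upper bound in the definition of \<open>R\<close>.\<close>
          define m where "m = (LEAST i. P i)"
          have m: "P m" "\<And>i. i < m \<Longrightarrow> \<not> P i" using \<open>P i\<close> unfolding m_def by (auto intro: LeastI dest: not_less_Least)
          have "m > k"
          proof (rule ccontr)
            assume "\<not> m > k"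
            then have "1 / real (Suc k) \<le> 1 / real (Suc m)" by (intro frac_le) auto
            then show False using lt m(1) by (simp add: P_def)
          qed
          then obtain i where i: "m = Suc (i + k)" by (metis add.commute less_imp_Suc_add)
          have "x \<in> R (i + k)"
            using m(1) m(2)[of "i + k"] x by (auto simp: R_def P_def i not_le)
          then show ?thesis by blast
        qed simp
      qed
      then have "?H (E - F) \<le> ?H (Ek k) + ?H (\<Union>i. R (i + k))"
        by (meson hausdorff_measure_mono hausdorff_measure_Un order_trans)
      also have "?H (\<Union>i. R (i + k)) \<le> (\<Sum>i. ?H (R (i + k)))"
        by (rule hausdorff_measure_countably_subadditive)
      finally have "?H (E - F) \<le> ?H (Ek k) + (\<Sum>i. ?H (R (i + k)))" by (simp add: add_left_mono)
      then have "?H (E \<inter> F) + ?H (E - F) \<le> ?H (E \<inter> F) + (?H (Ek k) + (\<Sum>i. ?H (R (i + k))))"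
        by (rule add_left_mono)
      also have "\<dots> \<le> ?H E + (\<Sum>i. ?H (R (i + k)))"
        unfolding add.assoc[symmetric] by (rule add_right_mono[OF Ek])
      finally show ?thesis .
    qed
    moreover have "(\<lambda>k. ?H E + (\<Sum>i. ?H (R (i + k)))) \<longlonglongrightarrow> ?H E + 0"
      by (intro tendsto_add tendsto_const tail)
    ultimately show ?thesis by (intro LIMSEQ_le_const[of _ "?H E"]) auto
  qed
qed

definition hausdorff_borel :: "nat \<Rightarrow> (real^'n) measure" where
  "hausdorff_borel s = measure_of UNIV (sets borel) (hausdorff_measure s)"

lemma space_hausdorff_borel [simp]: "space (hausdorff_borel s) = UNIV"
  and sets_hausdorff_borel [simp, measurable_cong]: "sets (hausdorff_borel s) = sets borel"
  unfolding hausdorff_borel_def by (simp_all add: sets.sigma_sets_eq[of borel, simplified])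

text \<open>The sets satisfying the Caratheodory condition form a sigma-algebra on which the outer
  measure is countably additive; closed sets satisfy the condition and generate the Borel
  sets.\<close>

lemma emeasure_hausdorff_borel:
  fixes A :: "(real^'n) set"
  assumes "A \<in> sets borel"
  shows "emeasure (hausdorff_borel s) A = hausdorff_measure s A"
proof -
  let ?H = "hausdorff_measure s :: (real^'n) set \<Rightarrow> ennreal"
  define L where "L = lambda_system UNIV (Pow UNIV) ?H"
  interpret S: sigma_algebra "UNIV :: (real^'n) set" "Pow UNIV" by (rule sigma_algebra_Pow)
  have "outer_measure_space (Pow UNIV) ?H"
    by (auto simp: outer_measure_space_def positive_def increasing_def countably_subadditive_def
        intro: hausdorff_measure_mono hausdorff_measure_countably_subadditive)
  from S.caratheodory_lemma[OF this]
  have ms: "measure_space UNIV L ?H" unfolding L_def .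
  have "sigma_algebra UNIV L" using ms by (simp add: measure_space_def)
  moreover have "Collect closed \<subseteq> L"
    using S.lambda_system_eq[of ?H] by (auto simp: L_def hausdorff_measure_closed_caratheodory)
  ultimately have sub: "sets borel \<subseteq> L"
    unfolding borel_eq_closed by (simp add: sigma_algebra.sigma_sets_subset)
  have "countably_additive (sets borel) ?H"
    using ms sub unfolding measure_space_def countably_additive_def by blast
  then show ?thesis
    using assms unfolding hausdorff_borel_def
    by (intro emeasure_measure_of_sigma) (auto simp: positive_def sets.sigma_algebra_axioms[of borel, simplified])
qed

text \<open>A cover of \<open>A\<close> is pushed forward to a cover of the image. Each covering set
  is first cut down to \<open>A\<close>, where alone \<open>f\<close> is Lipschitz, and scale
  \<open>\<delta> / L\<close> becomes scale \<open>\<delta>\<close>.\<close>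

lemma hausdorff_measure_lipschitz_image:
  fixes f :: "real^'n \<Rightarrow> real^'n"
  assumes L: "0 < L" and lip: "\<And>x y. x \<in> A \<Longrightarrow> y \<in> A \<Longrightarrow> dist (f x) (f y) \<le> L * dist x y"
  shows "hausdorff_measure s (f ` A) \<le> ennreal (L ^ s) * hausdorff_measure s A"
proof (rule hausdorff_measure_leI)
  fix \<delta> :: real assume "0 < \<delta>"
  have diam: "bounded (f ` (A \<inter> C)) \<and> diameter (f ` (A \<inter> C)) \<le> L * diameter C" if "bounded C" for C
  proof
    have *: "dist u v \<le> L * diameter C" if "u \<in> f ` (A \<inter> C)" "v \<in> f ` (A \<inter> C)" for u v
      using that lip diameter_bounded_bound[OF \<open>bounded C\<close>] L
      by clarsimp (meson mult_left_mono less_imp_le order_trans)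
    show "bounded (f ` (A \<inter> C))"
      unfolding bounded_two_points using * by blast
    show "diameter (f ` (A \<inter> C)) \<le> L * diameter C"
      using * L diameter_ge_0[OF that] by (intro diameter_le) (auto simp: dist_norm)
  qed
  have w: "hausdorff_weight s (f ` (A \<inter> C)) \<le> ennreal (L ^ s) * hausdorff_weight s C" if "bounded C" for C
  proof (cases "A \<inter> C = {}")
    case False
    have "unit_ball_vol (real s) * (diameter (f ` (A \<inter> C)) / 2) ^ s
        \<le> unit_ball_vol (real s) * (L * diameter C / 2) ^ s"
      using diam[OF that]
      by (intro mult_left_mono power_mono divide_right_mono) (auto intro: diameter_ge_0)
    then show ?thesis
      using False L diameter_ge_0[OF that]
      by (auto simp: hausdorff_weight_def ennreal_mult[symmetric] power_mult_distrib power_divide mult_ac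
          intro!: ennreal_leI)
  qed (simp add: hausdorff_weight_def)
  \<comment> \<open>Division by \<open>L ^ s\<close> gives the estimate the form of a lower bound
    for an infimum over covers.\<close>
  have "hausdorff_premeasure s \<delta> (f ` A) / ennreal (L ^ s) \<le> hausdorff_premeasure s (\<delta> / L) A"
    unfolding hausdorff_premeasure_def[of s "\<delta> / L"]
    proof (rule INF_greatest, clarsimp)
      fix C :: "nat \<Rightarrow> (real^'n) set"
      assume C: "\<forall>i. bounded (C i) \<and> diameter (C i) \<le> \<delta> / L" "A \<subseteq> (\<Union>i. C i)"
      have "hausdorff_premeasure s \<delta> (f ` A) \<le> (\<Sum>i. hausdorff_weight s (f ` (A \<inter> C i)))"
        unfolding hausdorff_premeasure_def
      proof (rule INF_lower, safe)
        fix i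
        show "bounded (f ` (A \<inter> C i))" using diam C by blast
        have "diameter (f ` (A \<inter> C i)) \<le> L * diameter (C i)" using diam C by blast
        also have "\<dots> \<le> \<delta>" using C(1) L by (simp add: field_simps)
        finally show "diameter (f ` (A \<inter> C i)) \<le> \<delta>" .
      qed (use C in blast)
      also have "\<dots> \<le> (\<Sum>i. ennreal (L ^ s) * hausdorff_weight s (C i))"
        using C by (intro suminf_le w) auto
      finally show "hausdorff_premeasure s \<delta> (f ` A) / ennreal (L ^ s) \<le> (\<Sum>i. hausdorff_weight s (C i))"
        using L by (intro divide_le_posI_ennreal) (auto simp: mult.commute)
    qed
  then have "hausdorff_premeasure s \<delta> (f ` A) / ennreal (L ^ s) * ennreal (L ^ s)
      \<le> hausdorff_premeasure s (\<delta> / L) A * ennreal (L ^ s)"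
    by (rule mult_right_mono) simp
  then have "hausdorff_premeasure s \<delta> (f ` A) \<le> ennreal (L ^ s) * hausdorff_premeasure s (\<delta> / L) A"
    using L by (subst (asm) ennreal_divide_times) (simp add: mult.commute)
  also have "\<dots> \<le> ennreal (L ^ s) * hausdorff_measure s A"
    using L \<open>0 < \<delta>\<close> by (intro mult_left_mono hausdorff_premeasure_le_measure) auto
  finally show "hausdorff_premeasure s \<delta> (f ` A) \<le> \<dots>" .
qed

section \<open>The isodiametric inequality\<close>

text \<open>For \<open>J \<subseteq> Basis\<close> this is Lebesgue measure on the coordinate
  subspace \<open>span J\<close>, kept as a Borel measure on the whole space. Sets of all dimensions
  thus stay in one type, and enlarging \<open>J\<close> by one vector is Fubini's theorem.\<close>

definition coord_lborel :: "'a set \<Rightarrow> 'a::euclidean_space measure" where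
  "coord_lborel J = distr (\<Pi>\<^sub>M b\<in>J. lborel) borel (\<lambda>f. \<Sum>b\<in>J. f b *\<^sub>R b)"

lemma space_coord_lborel [simp]: "space (coord_lborel J) = UNIV"
  and sets_coord_lborel [simp, measurable_cong]: "sets (coord_lborel J) = sets borel"
  by (simp_all add: coord_lborel_def)

lemma coord_lborel_Basis: "coord_lborel Basis = lborel"
  unfolding coord_lborel_def by (rule lborel_eq[symmetric])

lemma measurable_coord_sum [measurable]:
  "(\<lambda>f. \<Sum>b\<in>J. f b *\<^sub>R b) \<in> (\<Pi>\<^sub>M b\<in>J. lborel) \<rightarrow>\<^sub>M (borel :: 'a::euclidean_space measure)"
  by measurable

context
  fixes J :: "'a::euclidean_space set" and b :: 'a and f :: "'a \<Rightarrow> ennreal"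
  assumes J: "finite J" "b \<notin> J" and f [measurable]: "f \<in> borel_measurable borel"
begin

interpretation product_sigma_finite "\<lambda>_::'a. lborel :: real measure" ..

lemma sum_coord_upd: "(\<Sum>c\<in>insert b J. (x(b := t)) c *\<^sub>R c) = (\<Sum>c\<in>J. x c *\<^sub>R c) + t *\<^sub>R b"
  using J by (subst sum.insert) (auto intro!: sum.cong simp: add.commute)

text \<open>Lines parallel to \<open>b\<close> are integrated first, as Steiner symmetrization
  requires.\<close>

lemma nn_integral_coord_lborel_insert:
  "(\<integral>\<^sup>+x. f x \<partial>coord_lborel (insert b J)) = (\<integral>\<^sup>+x. (\<integral>\<^sup>+t. f (x + t *\<^sub>R b) \<partial>lborel) \<partial>coord_lborel J)"
proof -
  have "(\<integral>\<^sup>+x. f x \<partial>coord_lborel (insert b J))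
      = (\<integral>\<^sup>+x. f (\<Sum>c\<in>insert b J. x c *\<^sub>R c) \<partial>(\<Pi>\<^sub>M c\<in>insert b J. lborel))"
    unfolding coord_lborel_def by (subst nn_integral_distr) measurable
  also have "\<dots> = (\<integral>\<^sup>+x. (\<integral>\<^sup>+t. f ((\<Sum>c\<in>J. x c *\<^sub>R c) + t *\<^sub>R b) \<partial>lborel) \<partial>(\<Pi>\<^sub>M c\<in>J. lborel))"
    using J by (subst product_nn_integral_insert) (simp_all only: sum_coord_upd, measurable)
  also have "\<dots> = (\<integral>\<^sup>+x. (\<integral>\<^sup>+t. f (x + t *\<^sub>R b) \<partial>lborel) \<partial>coord_lborel J)"
    unfolding coord_lborel_def by (subst nn_integral_distr) measurable
  finally show ?thesis .
qed

text \<open>The opposite order: slices at fixed height along \<open>b\<close> come first, which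
  suits solids whose slices are translates of one base.\<close>

lemma nn_integral_coord_lborel_insert_rev:
  "(\<integral>\<^sup>+x. f x \<partial>coord_lborel (insert b J)) = (\<integral>\<^sup>+t. (\<integral>\<^sup>+x. f (x + t *\<^sub>R b) \<partial>coord_lborel J) \<partial>lborel)"
proof -
  have "(\<integral>\<^sup>+x. f x \<partial>coord_lborel (insert b J))
      = (\<integral>\<^sup>+x. f (\<Sum>c\<in>insert b J. x c *\<^sub>R c) \<partial>(\<Pi>\<^sub>M c\<in>insert b J. lborel))"
    unfolding coord_lborel_def by (subst nn_integral_distr) measurable
  also have "\<dots> = (\<integral>\<^sup>+t. (\<integral>\<^sup>+x. f ((\<Sum>c\<in>J. x c *\<^sub>R c) + t *\<^sub>R b) \<partial>(\<Pi>\<^sub>M c\<in>J. lborel)) \<partial>lborel)"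
    using J by (subst product_nn_integral_insert_rev) (simp_all only: sum_coord_upd, measurable)
  also have "\<dots> = (\<integral>\<^sup>+t. (\<integral>\<^sup>+x. f (x + t *\<^sub>R b) \<partial>coord_lborel J) \<partial>lborel)"
    unfolding coord_lborel_def by (subst nn_integral_distr) measurable
  finally show ?thesis .
qed

end

lemma emeasure_coord_lborel_insert:
  assumes "finite J" "b \<notin> J" and [measurable]: "A \<in> sets borel"
  shows "emeasure (coord_lborel (insert b J)) A
    = (\<integral>\<^sup>+x. (\<integral>\<^sup>+t. indicator A (x + t *\<^sub>R b) \<partial>lborel) \<partial>coord_lborel J)"
proof -
  have "emeasure (coord_lborel (insert b J)) A = (\<integral>\<^sup>+x. indicator A x \<partial>coord_lborel (insert b J))" by simp
  also have "\<dots> = (\<integral>\<^sup>+x. (\<integral>\<^sup>+t. indicator A (x + t *\<^sub>R b) \<partial>lborel) \<partial>coord_lborel J)"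
    using assms(1,2) by (intro nn_integral_coord_lborel_insert) simp_all
  finally show ?thesis .
qed

lemma AE_coord_lborel_span: "AE x in coord_lborel J. x \<in> span J"
proof -
  have "(\<Sum>b\<in>J. f b *\<^sub>R b) \<in> span J" for f
    by (intro span_sum span_scale span_base)
  then show ?thesis
    unfolding coord_lborel_def by (subst AE_distr_iff) (simp_all add: closed_subspace)
qed

lemma emeasure_coord_lborel_span:
  assumes [measurable]: "A \<in> sets borel" "B \<in> sets borel" and "A \<inter> span J = B \<inter> span J"
  shows "emeasure (coord_lborel J) A = emeasure (coord_lborel J) B"
  using AE_coord_lborel_span[of J] assms(3) by (intro emeasure_eq_AE) auto

text \<open>Induction on \<open>J\<close>: the component of \<open>z\<close> along the new vector is
  absorbed by translation invariance on the line, the remainder by the induction hypothesis applied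
  to the inner integral.\<close>

lemma nn_integral_coord_lborel_translate:
  assumes "finite J" "z \<in> span J" "f \<in> borel_measurable borel"
  shows "(\<integral>\<^sup>+x. f (x + z) \<partial>coord_lborel J) = (\<integral>\<^sup>+x. f x \<partial>coord_lborel J)"
  using assms
proof (induction J arbitrary: z f rule: finite_induct)
  case (insert b J)
  note [measurable] = \<open>f \<in> borel_measurable borel\<close>
  obtain c where "z - c *\<^sub>R b \<in> span J" using insert.prems(1) by (auto simp: span_insert)
  then obtain z' where z: "z = z' + c *\<^sub>R b" and z': "z' \<in> span J" by (metis diff_add_cancel)
  have "(\<integral>\<^sup>+x. f (x + z) \<partial>coord_lborel (insert b J))
     = (\<integral>\<^sup>+x. (\<integral>\<^sup>+t. f (x + z' + (c + 1 * t) *\<^sub>R b) \<partial>lborel) \<partial>coord_lborel J)"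
    using insert.hyps by (subst nn_integral_coord_lborel_insert) (auto simp: z algebra_simps)
  also have "\<dots> = (\<integral>\<^sup>+x. (\<integral>\<^sup>+t. f (x + z' + t *\<^sub>R b) \<partial>lborel) \<partial>coord_lborel J)"
    using nn_integral_real_affine[of "\<lambda>t. f (x + z' + t *\<^sub>R b)" 1 c for x] by simp
  also have "\<dots> = (\<integral>\<^sup>+x. (\<integral>\<^sup>+t. f (x + t *\<^sub>R b) \<partial>lborel) \<partial>coord_lborel J)"
    by (rule insert.IH[OF z']) measurable
  also have "\<dots> = (\<integral>\<^sup>+x. f x \<partial>coord_lborel (insert b J))"
    using insert.hyps by (subst nn_integral_coord_lborel_insert) auto
  finally show ?case .
qed simp

lemma emeasure_coord_lborel_translate:
  assumes "finite J" "z \<in> span J" and [measurable]: "A \<in> sets borel"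
  shows "emeasure (coord_lborel J) ((\<lambda>x. z + x) ` A) = emeasure (coord_lborel J) A"
proof -
  have eq: "(\<lambda>x. z + x) ` A = (\<lambda>x. x - z) -` A" by force
  have [measurable]: "(\<lambda>x. z + x) ` A \<in> sets borel"
  proof -
    have "(\<lambda>x. x - z) \<in> borel \<rightarrow>\<^sub>M borel" by measurable
    from measurable_sets[OF this assms(3)] show ?thesis unfolding eq space_borel Int_UNIV_right .
  qed
  have "emeasure (coord_lborel J) ((\<lambda>x. z + x) ` A) = (\<integral>\<^sup>+x. indicator A (x + - z) \<partial>coord_lborel J)"
  proof (subst nn_integral_indicator[symmetric])
    show "(\<integral>\<^sup>+x. indicator ((\<lambda>x. z + x) ` A) x \<partial>coord_lborel J) = (\<integral>\<^sup>+x. indicator A (x + - z) \<partial>coord_lborel J)"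
      unfolding eq by (intro nn_integral_cong) (simp add: indicator_def)
  qed simp
  also have "\<dots> = (\<integral>\<^sup>+x. indicator A x \<partial>coord_lborel J)"
    using assms by (intro nn_integral_coord_lborel_translate span_neg) auto
  finally show ?thesis by simp
qed

lemma norm_coord_sum:
  assumes "J \<subseteq> Basis"
  shows "norm (\<Sum>b\<in>J. x b *\<^sub>R b :: 'a::euclidean_space) = sqrt (\<Sum>b\<in>J. (x b)\<^sup>2)"
proof -
  have fin: "finite J" using assms finite_subset finite_Basis by blast
  have "(\<Sum>b\<in>J. x b *\<^sub>R b) \<bullet> (\<Sum>b\<in>J. x b *\<^sub>R b) = (\<Sum>b\<in>J. \<Sum>c\<in>J. x c * (x b * (b \<bullet> c)))"
    by (simp add: inner_sum_left inner_sum_right sum_distrib_left inner_commute)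
  also have "\<dots> = (\<Sum>b\<in>J. \<Sum>c\<in>J. if c = b then (x b)\<^sup>2 else 0)"
    using assms by (intro sum.cong refl) (simp add: inner_Basis power2_eq_square subset_iff)
  also have "\<dots> = (\<Sum>b\<in>J. (x b)\<^sup>2)" using fin by simp
  finally show ?thesis by (simp add: norm_eq_sqrt_inner)
qed

lemma emeasure_coord_lborel_cball:
  assumes J: "J \<subseteq> (Basis :: 'a::euclidean_space set)" and "z \<in> span J" "0 < r"
  shows "emeasure (coord_lborel J) (cball z r) = ennreal (unit_ball_vol (real (card J)) * r ^ card J)"
proof -
  have fin: "finite J" using J finite_subset finite_Basis by blast
  have "emeasure (coord_lborel J) (cball z r) = emeasure (coord_lborel J) (cball 0 r)"
    using emeasure_coord_lborel_translate[OF fin \<open>z \<in> span J\<close>, of "cball 0 r"]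
    by (simp add: cball_translation[symmetric])
  also have "\<dots> = emeasure (\<Pi>\<^sub>M b\<in>J. lborel) ({f. sqrt (\<Sum>b\<in>J. (f b)\<^sup>2) \<le> r} \<inter> space (\<Pi>\<^sub>M b\<in>J. lborel))"
    unfolding coord_lborel_def
    by (subst emeasure_distr) (auto simp: norm_coord_sum[OF J] intro!: arg_cong2[where f = emeasure])
  also have "\<dots> = ennreal (unit_ball_vol (real (card J)) * r ^ card J)"
    by (rule emeasure_cball_aux[OF fin \<open>0 < r\<close>])
  finally show ?thesis .
qed

lemma emeasure_coord_lborel_bounded_finite:
  assumes "J \<subseteq> (Basis :: 'a::euclidean_space set)" "bounded A"
  shows "emeasure (coord_lborel J) A < \<infinity>"
proof -
  obtain r where r: "0 < r" "A \<subseteq> cball 0 r"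
    using bounded_subset_ballD[OF assms(2), of 0] ball_subset_cball by blast
  then have "emeasure (coord_lborel J) A \<le> emeasure (coord_lborel J) (cball 0 r)"
    by (intro emeasure_mono) auto
  also have "\<dots> < \<infinity>" using emeasure_coord_lborel_cball[OF assms(1) span_zero r(1)] by simp
  finally show ?thesis .
qed

section \<open>Steiner symmetrization in coordinate directions\<close>

definition line_length :: "'a::euclidean_space \<Rightarrow> 'a set \<Rightarrow> 'a \<Rightarrow> ennreal" where
  "line_length b A x = (\<integral>\<^sup>+t. indicator A (x - (x \<bullet> b) *\<^sub>R b + t *\<^sub>R b) \<partial>lborel)"

text \<open>The strict inequality leaves lines of zero length empty. With a weak one, their points
  in the hyperplane orthogonal to \<open>b\<close> would enter the set and could increase its
  diameter.\<close>

definition steiner :: "'a::euclidean_space \<Rightarrow> 'a set \<Rightarrow> 'a set" where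
  "steiner b A = {x. ennreal (2 * \<bar>x \<bullet> b\<bar>) < line_length b A x}"

definition reflect_along :: "'a::euclidean_space \<Rightarrow> 'a \<Rightarrow> 'a" where
  "reflect_along b x = x - (2 * (x \<bullet> b)) *\<^sub>R b"

lemma measurable_line_length [measurable]:
  assumes [measurable]: "A \<in> sets borel"
  shows "line_length b A \<in> borel_measurable borel"
  unfolding line_length_def by measurable

lemma steiner_borel [measurable]:
  assumes [measurable]: "A \<in> sets borel"
  shows "steiner b A \<in> sets borel"
  unfolding steiner_def by measurable

lemma line_length_eq_emeasure:
  assumes [measurable]: "A \<in> sets borel"
  shows "line_length b A x = emeasure lborel {t. x - (x \<bullet> b) *\<^sub>R b + t *\<^sub>R b \<in> A}"
    and "{t. x - (x \<bullet> b) *\<^sub>R b + t *\<^sub>R b \<in> A} \<in> sets borel"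
proof -
  show *: "{t. x - (x \<bullet> b) *\<^sub>R b + t *\<^sub>R b \<in> A} \<in> sets borel" by measurable
  show "line_length b A x = emeasure lborel {t. x - (x \<bullet> b) *\<^sub>R b + t *\<^sub>R b \<in> A}"
  proof -
    have "line_length b A x = (\<integral>\<^sup>+t. indicator {t. x - (x \<bullet> b) *\<^sub>R b + t *\<^sub>R b \<in> A} t \<partial>lborel)"
      unfolding line_length_def by (intro nn_integral_cong) (simp add: indicator_def)
    also have "\<dots> = emeasure lborel {t. x - (x \<bullet> b) *\<^sub>R b + t *\<^sub>R b \<in> A}"
      using * by (intro nn_integral_indicator) simp
    finally show ?thesis .
  qed
qed

lemma emeasure_centered_interval: "emeasure lborel {t. ennreal (2 * \<bar>t\<bar>) < l} = l"
proof (cases l)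
  case (real r)
  have "{t. ennreal (2 * \<bar>t\<bar>) < l} = {- (r / 2)<..<r / 2}"
    using real by (auto simp: ennreal_less_iff)
  then show ?thesis using real by simp
qed simp

text \<open>Fubini along \<open>b\<close>: the centred interval on each line has the length of the
  original section, also when that length is infinite.\<close>

lemma emeasure_steiner:
  assumes J: "insert b J \<subseteq> Basis" "b \<notin> J" and [measurable]: "A \<in> sets borel"
  shows "emeasure (coord_lborel (insert b J)) (steiner b A) = emeasure (coord_lborel (insert b J)) A"
proof -
  have fin: "finite J" using J(1) finite_subset[of J Basis] by simp
  have "span J = {x. \<forall>i\<in>Basis. i \<notin> J \<longrightarrow> x \<bullet> i = 0}"
    using J by (intro span_substd_basis) simp
  then have J0: "x \<bullet> b = 0" if "x \<in> span J" for x
    using that J by simp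
  have "emeasure (coord_lborel (insert b J)) (steiner b A)
      = (\<integral>\<^sup>+x. (\<integral>\<^sup>+t. indicator (steiner b A) (x + t *\<^sub>R b) \<partial>lborel) \<partial>coord_lborel J)"
    using fin J by (intro emeasure_coord_lborel_insert) simp_all
  also have "\<dots> = (\<integral>\<^sup>+x. (\<integral>\<^sup>+t. indicator A (x + t *\<^sub>R b) \<partial>lborel) \<partial>coord_lborel J)"
  proof (rule nn_integral_cong_AE, use AE_coord_lborel_span in eventually_elim)
    fix x assume "x \<in> span J"
    then have x: "x \<bullet> b = 0" by (rule J0)
    have "x + t *\<^sub>R b \<in> steiner b A \<longleftrightarrow> ennreal (2 * \<bar>t\<bar>) < line_length b A x" for t
      using x J by (auto simp: steiner_def line_length_def inner_add_left)
    then have "(\<integral>\<^sup>+t. indicator (steiner b A) (x + t *\<^sub>R b) \<partial>lborel)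
        = (\<integral>\<^sup>+t. indicator {t. ennreal (2 * \<bar>t\<bar>) < line_length b A x} t \<partial>lborel)"
      by (intro nn_integral_cong) (auto simp: indicator_def)
    also have "\<dots> = line_length b A x"
      by (subst nn_integral_indicator) (auto simp: emeasure_centered_interval)
    also have "\<dots> = (\<integral>\<^sup>+t. indicator A (x + t *\<^sub>R b) \<partial>lborel)"
      using x by (simp add: line_length_def)
    finally show "(\<integral>\<^sup>+t. indicator (steiner b A) (x + t *\<^sub>R b) \<partial>lborel)
        = (\<integral>\<^sup>+t. indicator A (x + t *\<^sub>R b) \<partial>lborel)" .
  qed
  also have "\<dots> = emeasure (coord_lborel (insert b J)) A"
    using fin J by (intro emeasure_coord_lborel_insert[symmetric]) simp_all
  finally show ?thesis .
qed

text \<open>On the lines through \<open>x\<close> and \<open>y\<close> there are points of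
  \<open>A\<close> at least as far apart along \<open>b\<close> as \<open>x\<close> and
  \<open>y\<close> are. The components orthogonal to \<open>b\<close> are unchanged, so Pythagoras'
  theorem gives the bound.\<close>

lemma steiner_dist_le:
  assumes b: "b \<in> Basis" and A [measurable]: "A \<in> sets borel" and bdd: "bounded A"
    and x: "x \<in> steiner b A" and y: "y \<in> steiner b A"
  shows "dist x y \<le> diameter A"
proof -
  define I where "I x = {t. x - (x \<bullet> b) *\<^sub>R b + t *\<^sub>R b \<in> A}" for x
  have bb: "b \<bullet> b = 1" using b by (simp add: inner_Basis)
  obtain B where B: "\<And>a. a \<in> A \<Longrightarrow> norm a \<le> B" using bdd unfolding bounded_iff by blast
  have Ib: "\<bar>t\<bar> \<le> B" if "t \<in> I x" for t x
  proof -
    have "(x - (x \<bullet> b) *\<^sub>R b + t *\<^sub>R b) \<bullet> b = t" by (simp add: inner_simps bb)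
    then show ?thesis
      using Basis_le_norm[OF b, of "x - (x \<bullet> b) *\<^sub>R b + t *\<^sub>R b"] B that unfolding I_def by fastforce
  qed
  have bd: "bdd_above (I x)" "bdd_below (I x)" for x
    using Ib by (auto intro!: bdd_aboveI[of _ B] bdd_belowI[of _ "-B"] simp: abs_le_iff) (meson abs_le_iff Ib minus_le_iff)
  have len: "I x \<noteq> {} \<and> 2 * \<bar>x \<bullet> b\<bar> < Sup (I x) - Inf (I x)" if "x \<in> steiner b A" for x
  proof
    have lt: "ennreal (2 * \<bar>x \<bullet> b\<bar>) < emeasure lborel (I x)"
      using that unfolding steiner_def by (simp add: line_length_eq_emeasure I_def)
    then show ne: "I x \<noteq> {}" by auto
    have sub: "I x \<subseteq> {Inf (I x)..Sup (I x)}"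
      using cInf_lower[OF _ bd(2)] cSup_upper[OF _ bd(1)] by force
    then have le: "Inf (I x) \<le> Sup (I x)" using ne by auto
    have "emeasure lborel (I x) \<le> emeasure lborel {Inf (I x)..Sup (I x)}"
      using sub by (intro emeasure_mono) auto
    then show "2 * \<bar>x \<bullet> b\<bar> < Sup (I x) - Inf (I x)"
      using lt le by (auto simp: ennreal_less_iff dest: less_le_trans)
  qed
  \<comment> \<open>Otherwise \<open>Sup (I x) - Inf (I y)\<close> and
    \<open>Sup (I y) - Inf (I x)\<close> are at most
    \<open>\<bar>x \<bullet> b - y \<bullet> b\<bar>\<close>. But they add up to the total length of
    the two hulls, which by \<open>len\<close> exceeds \<open>2 * \<bar>x \<bullet> b\<bar> + 2 *
    \<bar>y \<bullet> b\<bar>\<close>.\<close>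
  have "\<exists>t\<in>I x. \<exists>t'\<in>I y. \<bar>x \<bullet> b - y \<bullet> b\<bar> \<le> \<bar>t - t'\<bar>"
  proof (rule ccontr)
    assume neg: "\<not> ?thesis"
    define c where "c = \<bar>x \<bullet> b - y \<bullet> b\<bar>"
    have c: "\<bar>t - t'\<bar> \<le> c" if "t \<in> I x" "t' \<in> I y" for t t'
      using neg that unfolding c_def by force
    have ne: "I x \<noteq> {}" "I y \<noteq> {}" using len x y by auto
    have "Sup (I x) \<le> c + t'" if "t' \<in> I y" for t'
      using c that ne by (intro cSup_least) fastforce+
    then have "Sup (I x) - c \<le> Inf (I y)"
      using ne by (intro cInf_greatest) (auto simp: algebra_simps)
    moreover have "Sup (I y) \<le> c + t" if "t \<in> I x" for t
      using c that ne by (intro cSup_least) fastforce+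
    then have "Sup (I y) - c \<le> Inf (I x)"
      using ne by (intro cInf_greatest) (auto simp: algebra_simps)
    moreover have "c \<le> \<bar>x \<bullet> b\<bar> + \<bar>y \<bullet> b\<bar>" unfolding c_def by (rule abs_triangle_ineq4)
    ultimately show False using len[OF x] len[OF y] by linarith
  qed
  then obtain t t' where t: "t \<in> I x" "t' \<in> I y" and tt: "\<bar>x \<bullet> b - y \<bullet> b\<bar> \<le> \<bar>t - t'\<bar>" by blast
  let ?p = "x - (x \<bullet> b) *\<^sub>R b" and ?q = "y - (y \<bullet> b) *\<^sub>R b"
  have orth: "(?p - ?q) \<bullet> b = 0" by (simp add: inner_simps bb)
  have nrm: "(norm (?p - ?q + c *\<^sub>R b))\<^sup>2 = (norm (?p - ?q))\<^sup>2 + c\<^sup>2" for c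
    using orth by (subst norm_add_Pythagorean) (auto simp: orthogonal_def norm_Basis[OF b])
  have "(dist x y)\<^sup>2 = (norm (?p - ?q + (x \<bullet> b - y \<bullet> b) *\<^sub>R b))\<^sup>2"
    by (simp add: dist_norm algebra_simps)
  also have "\<dots> \<le> (norm (?p - ?q + (t - t') *\<^sub>R b))\<^sup>2"
    unfolding nrm using tt by (simp add: abs_le_square_iff)
  also have "\<dots> = (dist (?p + t *\<^sub>R b) (?q + t' *\<^sub>R b))\<^sup>2"
    by (simp add: dist_norm algebra_simps)
  finally have "dist x y \<le> dist (?p + t *\<^sub>R b) (?q + t' *\<^sub>R b)" by (simp add: power_mono_iff)
  also have "\<dots> \<le> diameter A"
    using t bdd by (intro diameter_bounded_bound) (auto simp: I_def)
  finally show ?thesis .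
qed

lemma steiner_bounded:
  assumes "b \<in> Basis" "A \<in> sets borel" "bounded A"
  shows "bounded (steiner b A)" "diameter (steiner b A) \<le> diameter A"
proof -
  show "bounded (steiner b A)"
    unfolding bounded_two_points using steiner_dist_le[OF assms] by blast
  show "diameter (steiner b A) \<le> diameter A"
    using steiner_dist_le[OF assms] diameter_ge_0[OF assms(3)] by (intro diameter_le) (auto simp: dist_norm)
qed

lemma reflect_steiner_same:
  assumes "b \<in> Basis" "x \<in> steiner b A"
  shows "reflect_along b x \<in> steiner b A"
proof -
  have "reflect_along b x \<bullet> b = - (x \<bullet> b)"
    using assms(1) by (simp add: reflect_along_def inner_simps inner_Basis)
  moreover from this have "reflect_along b x - (reflect_along b x \<bullet> b) *\<^sub>R b = x - (x \<bullet> b) *\<^sub>R b"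
    by (simp add: reflect_along_def algebra_simps flip: scaleR_2)
  ultimately show ?thesis using assms(2) by (simp add: steiner_def line_length_def)
qed

text \<open>Reflection along \<open>c\<close> maps lines parallel to \<open>b\<close> to such lines
  and keeps positions on them, so symmetries already gained survive symmetrization along
  \<open>b\<close>.\<close>

lemma reflect_steiner_other:
  assumes bc: "b \<in> Basis" "c \<in> Basis" "b \<noteq> c" and inv: "\<And>x. x \<in> A \<Longrightarrow> reflect_along c x \<in> A"
    and x: "x \<in> steiner b A"
  shows "reflect_along c x \<in> steiner b A"
proof -
  have b: "reflect_along c x \<bullet> b = x \<bullet> b"
    using bc by (simp add: reflect_along_def inner_simps inner_Basis)
  have refl2: "reflect_along c (reflect_along c y) = y" for y
    using bc by (simp add: reflect_along_def inner_simps inner_Basis)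
  have "reflect_along c x - (reflect_along c x \<bullet> b) *\<^sub>R b + t *\<^sub>R b
      = reflect_along c (x - (x \<bullet> b) *\<^sub>R b + t *\<^sub>R b)" for t
    unfolding b using bc by (simp add: reflect_along_def inner_simps inner_Basis algebra_simps)
  moreover have "reflect_along c y \<in> A \<longleftrightarrow> y \<in> A" for y
    using inv refl2 by metis
  ultimately have "line_length b A (reflect_along c x) = line_length b A x"
    by (simp add: line_length_def indicator_def)
  with x b show ?thesis by (simp add: steiner_def)
qed

lemma steiner_symmetrization:
  fixes A :: "'a::euclidean_space set"
  assumes J: "J \<subseteq> Basis" and "finite I" "I \<subseteq> J" and A: "A \<in> sets borel" "bounded A"
  shows "\<exists>A'. A' \<in> sets borel \<and> bounded A' \<and> diameter A' \<le> diameter A \<and>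
     emeasure (coord_lborel J) A' = emeasure (coord_lborel J) A \<and> (\<forall>b\<in>I. \<forall>x\<in>A'. reflect_along b x \<in> A')"
  using \<open>finite I\<close> \<open>I \<subseteq> J\<close>
proof (induction I rule: finite_induct)
  case empty then show ?case using A by blast
next
  case (insert b I)
  then obtain A' where A': "A' \<in> sets borel" "bounded A'" "diameter A' \<le> diameter A"
    "emeasure (coord_lborel J) A' = emeasure (coord_lborel J) A" "\<forall>b\<in>I. \<forall>x\<in>A'. reflect_along b x \<in> A'"
    by auto
  have b: "b \<in> Basis" "insert b (J - {b}) = J" using insert.prems J by auto
  have "emeasure (coord_lborel J) (steiner b A') = emeasure (coord_lborel J) A'"
    using emeasure_steiner[of b "J - {b}" A'] A' b J by auto
  moreover have "reflect_along c x \<in> steiner b A'" if "c \<in> insert b I" "x \<in> steiner b A'" for c x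
  proof (cases "c = b")
    case True then show ?thesis using that b reflect_steiner_same by blast
  next
    case False
    then show ?thesis using that b insert.prems J A' by (intro reflect_steiner_other) auto
  qed
  ultimately show ?case
    using steiner_bounded[OF b(1) A'(1,2)] A' steiner_borel[OF A'(1)] by (intro exI[of _ "steiner b A'"]) auto
qed

text \<open>After symmetrization along all of \<open>J\<close> the set is invariant under
  \<open>x \<mapsto> - x\<close> on \<open>span J\<close>. Then \<open>2 * norm x\<close> is a
  distance between two of its points, so within \<open>span J\<close> it lies in a centred ball of
  half the diameter.\<close>

lemma isodiametric:
  fixes A :: "'a::euclidean_space set"
  assumes J: "J \<subseteq> Basis" and A: "A \<in> sets borel" "bounded A"
  shows "emeasure (coord_lborel J) A \<le> ennreal (unit_ball_vol (real (card J)) * (diameter A / 2) ^ card J)"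
proof -
  have fin: "finite J" using J finite_subset finite_Basis by blast
  obtain B where B [measurable]: "B \<in> sets borel" and Bb: "bounded B" "diameter B \<le> diameter A"
    "emeasure (coord_lborel J) B = emeasure (coord_lborel J) A"
    and refl: "\<And>b x. b \<in> J \<Longrightarrow> x \<in> B \<Longrightarrow> reflect_along b x \<in> B"
    using steiner_symmetrization[OF J fin subset_refl A] by blast
  \<comment> \<open>The composite of the reflections along \<open>I\<close>; for
    \<open>I = J\<close> it is \<open>- x\<close> on \<open>span J\<close>.\<close>
  have flip: "x - 2 *\<^sub>R (\<Sum>b\<in>I. (x \<bullet> b) *\<^sub>R b) \<in> B" if "x \<in> B" "finite I" "I \<subseteq> J" for x I
    using that(2,3)
  proof (induction I rule: finite_induct)
    case (insert b I)
    let ?y = "x - 2 *\<^sub>R (\<Sum>b\<in>I. (x \<bullet> b) *\<^sub>R b)"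
    have "(\<Sum>c\<in>I. (x \<bullet> c) *\<^sub>R c) \<bullet> b = 0"
      unfolding inner_sum_left using insert J by (intro sum.neutral ballI) (simp add: inner_Basis subset_iff, metis)
    then have "?y \<bullet> b = x \<bullet> b" by (simp add: inner_diff_left)
    then have "reflect_along b ?y = x - 2 *\<^sub>R (\<Sum>b\<in>insert b I. (x \<bullet> b) *\<^sub>R b)"
      using insert by (simp add: reflect_along_def algebra_simps)
    moreover have "?y \<in> B" using insert by simp
    ultimately show ?case using refl[of b ?y] insert.prems by simp
  qed (use that in simp)
  have "norm x \<le> diameter A / 2" if "x \<in> B" "x \<in> span J" for x
  proof -
    have "x = (\<Sum>b\<in>Basis. (x \<bullet> b) *\<^sub>R b)" by (simp add: euclidean_representation)
    also have "\<dots> = (\<Sum>b\<in>J. (x \<bullet> b) *\<^sub>R b)"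
      using that(2) J span_substd_basis[OF J] by (intro sum.mono_neutral_right) auto
    finally have "x - 2 *\<^sub>R x \<in> B" using flip[OF that(1) fin subset_refl] by simp
    then have "dist x (- x) \<le> diameter B"
      using that Bb by (intro diameter_bounded_bound) (auto simp: scaleR_2)
    then show ?thesis using Bb(2) by (simp add: dist_norm flip: scaleR_2)
  qed
  then have sub: "B \<inter> span J \<subseteq> cball 0 (diameter A / 2)" by auto
  \<comment> \<open>The volume formula for balls asks for a positive radius, but the diameter may be
    0; hence larger radii and a limit.\<close>
  have le: "emeasure (coord_lborel J) A \<le> ennreal (unit_ball_vol (real (card J)) * r ^ card J)"
    if "r > diameter A / 2" for r
  proof -
    have "0 < r" using that diameter_ge_0[OF A(2)] by simp
    have "emeasure (coord_lborel J) A = emeasure (coord_lborel J) (B \<inter> span J)"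
      unfolding Bb(3)[symmetric] by (intro emeasure_coord_lborel_span) (auto simp: closed_subspace)
    also have "\<dots> \<le> emeasure (coord_lborel J) (cball 0 r)"
      using sub that by (intro emeasure_mono) (auto simp: closed_subspace)
    finally show ?thesis using emeasure_coord_lborel_cball[OF J span_zero \<open>0 < r\<close>] by simp
  qed
  show ?thesis
  proof (rule tendsto_lowerbound)
    show "((\<lambda>r. ennreal (unit_ball_vol (real (card J)) * r ^ card J)) \<longlongrightarrow>
       ennreal (unit_ball_vol (real (card J)) * (diameter A / 2) ^ card J)) (at_right (diameter A / 2))"
      by (intro tendsto_intros)
    show "\<forall>\<^sub>F r in at_right (diameter A / 2).
       emeasure (coord_lborel J) A \<le> ennreal (unit_ball_vol (real (card J)) * r ^ card J)"
      using le by (auto simp: eventually_at_filter)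
  qed simp
qed

section \<open>Hausdorff measure and Lebesgue measure\<close>

text \<open>Covering sets are arbitrary, so they are replaced by their closures, which are Borel and
  of the same diameter; the isodiametric inequality bounds the measure of each by its weight. Scale
  1 is an arbitrary choice.\<close>

lemma coord_lborel_le_hausdorff_measure:
  fixes B :: "(real^'n) set"
  assumes J: "J \<subseteq> Basis" and [measurable]: "B \<in> sets borel"
  shows "emeasure (coord_lborel J) B \<le> hausdorff_measure (card J) B"
proof -
  have "emeasure (coord_lborel J) B \<le> hausdorff_premeasure (card J) 1 B"
    unfolding hausdorff_premeasure_def
  proof (rule INF_greatest, clarsimp)
    fix C :: "nat \<Rightarrow> (real^'n) set"
    assume C: "\<forall>i. bounded (C i) \<and> diameter (C i) \<le> 1" "B \<subseteq> (\<Union>i. C i)"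
    have "emeasure (coord_lborel J) B \<le> emeasure (coord_lborel J) (\<Union>i. closure (C i))"
    proof (rule emeasure_mono)
      show "B \<subseteq> (\<Union>i. closure (C i))"
        using C(2) by (rule order_trans) (intro UN_mono closure_subset subset_refl)
    qed simp
    also have "\<dots> \<le> (\<Sum>i. emeasure (coord_lborel J) (closure (C i)))"
      by (intro emeasure_subadditive_countably) auto
    also have "\<dots> \<le> (\<Sum>i. hausdorff_weight (card J) (C i))"
    proof (intro suminf_le allI)
      fix i
      have "emeasure (coord_lborel J) (closure (C i))
          \<le> ennreal (unit_ball_vol (real (card J)) * (diameter (closure (C i)) / 2) ^ card J)"
        using C(1) by (intro isodiametric[OF J]) auto
      then show "emeasure (coord_lborel J) (closure (C i)) \<le> hausdorff_weight (card J) (C i)"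
        using C(1) by (auto simp: hausdorff_weight_def diameter_closure)
    qed auto
    finally show "emeasure (coord_lborel J) B \<le> (\<Sum>i. hausdorff_weight (card J) (C i))" .
  qed
  also have "\<dots> \<le> hausdorff_measure (card J) B"
    by (rule hausdorff_premeasure_le_measure) simp
  finally show ?thesis .
qed

text \<open>The full-dimensional ball is its own cover. As its centre lies in \<open>span J\<close>,
  its weight in dimension \<open>card J\<close> is exactly the measure of the disc that it cuts from
  \<open>span J\<close>.\<close>

lemma hausdorff_premeasure_cball_le:
  fixes z :: "real^'n"
  assumes J: "J \<subseteq> Basis" and z: "z \<in> span J" and r: "0 < r" "2 * r \<le> \<delta>"
  shows "hausdorff_premeasure (card J) \<delta> (cball z r) \<le> emeasure (coord_lborel J) (cball z r)"
  using hausdorff_premeasure_le_weight[of "cball z r" \<delta> "cball z r" "card J"] r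
  by (simp add: emeasure_coord_lborel_cball[OF J z] hausdorff_weight_def)

text \<open>Vitali's covering lemma, with \<open>B k\<close> the five-fold enlargement of
  \<open>A k\<close>. The balls are full-dimensional but centred in \<open>span J\<close>, so that
  enlargement multiplies their measure by \<open>5 ^ card J\<close>.\<close>

lemma vitali_coord_discs:
  fixes U :: "(real^'n) set"
  assumes J: "J \<subseteq> Basis" and U: "open U" and \<delta>: "0 < \<delta>"
  shows "\<exists>A B :: nat \<Rightarrow> (real^'n) set. disjoint_family A \<and> U \<inter> span J \<subseteq> (\<Union>k. B k) \<and>
    (\<forall>k. closed (A k) \<and> closed (B k) \<and> A k \<subseteq> U \<and>
      emeasure (coord_lborel J) (B k) = 5 ^ card J * emeasure (coord_lborel J) (A k) \<and>
      hausdorff_premeasure (card J) \<delta> (A k) \<le> emeasure (coord_lborel J) (A k) \<and>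
      hausdorff_premeasure (card J) \<delta> (B k) \<le> emeasure (coord_lborel J) (B k))"
proof -
  \<comment> \<open>The cap \<open>\<delta> / 10\<close> keeps the diameter of even the five-fold
    enlargement at most \<open>\<delta>\<close>.\<close>
  define K where "K = {(x, r). x \<in> U \<inter> span J \<and> 0 < r \<and> r \<le> \<delta> / 10 \<and> cball x r \<subseteq> U}"
  have cover: "U \<inter> span J \<subseteq> (\<Union>i\<in>K. cball (fst i) (snd i))"
  proof
    fix x assume x: "x \<in> U \<inter> span J"
    then obtain e where e: "0 < e" "cball x e \<subseteq> U" using U[unfolded open_contains_cball] by auto
    then have "(x, min e (\<delta> / 10)) \<in> K" using x \<delta> by (auto simp: K_def)
    then show "x \<in> (\<Union>i\<in>K. cball (fst i) (snd i))"
      by (rule UN_I) (use e \<delta> in auto)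
  qed
  have bound: "0 < snd i \<and> snd i \<le> \<delta> / 10" if "i \<in> K" for i using that by (auto simp: K_def)
  obtain C where C: "countable C" "C \<subseteq> K"
    and dis: "pairwise (\<lambda>i j. disjnt (cball (fst i) (snd i)) (cball (fst j) (snd j))) C"
    and cov: "U \<inter> span J \<subseteq> (\<Union>i\<in>C. cball (fst i) (5 * snd i))"
    by (rule Vitali_covering_lemma_cballs[OF cover bound], assumption, rule that)
  define g where "g = from_nat_into C"
  \<comment> \<open>The countable family may be finite or empty; indices that encode no member
    receive the empty set below.\<close>
  define P where "P k \<longleftrightarrow> k \<in> to_nat_on C ` C" for k
  have g: "g (to_nat_on C i) = i" if "i \<in> C" for i using that C by (simp add: g_def)
  have gC: "g k \<in> C" if "P k" for k using that g by (auto simp: P_def)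
  have gK: "fst (g k) \<in> span J \<and> 0 < snd (g k) \<and> snd (g k) \<le> \<delta> / 10 \<and> cball (fst (g k)) (snd (g k)) \<subseteq> U"
    if "P k" for k
    using subsetD[OF C(2) gC[OF that]] by (auto simp: K_def case_prod_beta)
  define A where "A k = (if P k then cball (fst (g k)) (snd (g k)) else {})" for k
  define B where "B k = (if P k then cball (fst (g k)) (5 * snd (g k)) else {})" for k
  show ?thesis
  proof (intro exI conjI allI)
    show "disjoint_family A"
      unfolding disjoint_family_on_def
    proof (intro ballI impI)
      fix k l :: nat assume "k \<noteq> l"
      show "A k \<inter> A l = {}"
      proof (cases "P k \<and> P l")
        case True
        then have "g k \<noteq> g l" using \<open>k \<noteq> l\<close> g by (auto simp: P_def)
        then show ?thesis
          using True gC pairwiseD[OF dis] by (auto simp: A_def disjnt_def)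
      qed (auto simp: A_def)
    qed
    show "U \<inter> span J \<subseteq> (\<Union>k. B k)"
    proof
      fix x assume "x \<in> U \<inter> span J"
      then obtain i where i: "i \<in> C" "x \<in> cball (fst i) (5 * snd i)" using cov by blast
      then have "x \<in> B (to_nat_on C i)" by (simp add: B_def P_def g)
      then show "x \<in> (\<Union>k. B k)" by blast
    qed
    show "emeasure (coord_lborel J) (B k) = 5 ^ card J * emeasure (coord_lborel J) (A k)" for k
    proof (cases "P k")
      case True
      have "ennreal (unit_ball_vol (real (card J)) * (5 * snd (g k)) ^ card J)
          = ennreal (5 ^ card J * (unit_ball_vol (real (card J)) * snd (g k) ^ card J))"
        by (simp add: power_mult_distrib mult_ac)
      also have "\<dots> = ennreal (5 ^ card J) * ennreal (unit_ball_vol (real (card J)) * snd (g k) ^ card J)"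
        by (rule ennreal_mult') simp
      also have "ennreal (5 ^ card J) = 5 ^ card J" by (simp add: ennreal_power[symmetric])
      finally show ?thesis
        using True gK[of k] by (simp add: A_def B_def emeasure_coord_lborel_cball[OF J])
    qed (simp add: A_def B_def)
    show "hausdorff_premeasure (card J) \<delta> (A k) \<le> emeasure (coord_lborel J) (A k)" for k
      using gK[of k] \<delta> by (auto simp: A_def intro!: hausdorff_premeasure_cball_le[OF J])
    show "hausdorff_premeasure (card J) \<delta> (B k) \<le> emeasure (coord_lborel J) (B k)" for k
      using gK[of k] \<delta> by (auto simp: B_def intro!: hausdorff_premeasure_cball_le[OF J])
    show "closed (A k)" "closed (B k)" "A k \<subseteq> U" for k
      using gK[of k] by (auto simp: A_def B_def)
  qed
qed

text \<open>
  The excess factor over Lebesgue measure shrinks geometrically: disjoint balls, on which there is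
  no excess, exhaust a fixed proportion of \<open>U\<close>, and the rest of \<open>U\<close> is again open.
\<close>

lemma hausdorff_premeasure_open_le_aux:
  fixes U :: "(real^'n) set"
  assumes J: "J \<subseteq> Basis" and \<delta>: "0 < \<delta>" and U: "open U" "bounded U"
  shows "hausdorff_premeasure (card J) \<delta> (U \<inter> span J)
    \<le> ennreal (1 + 5 ^ card J * (1 - 1 / (2 * 5 ^ card J)) ^ j) * emeasure (coord_lborel J) U"
  using U
proof (induction j arbitrary: U)
  case 0
  let ?l = "emeasure (coord_lborel J)" and ?h = "hausdorff_premeasure (card J) \<delta>"
  obtain A B :: "nat \<Rightarrow> (real^'n) set" where "disjoint_family A \<and> U \<inter> span J \<subseteq> (\<Union>k. B k) \<and>
    (\<forall>k. closed (A k) \<and> closed (B k) \<and> A k \<subseteq> U \<and> ?l (B k) = 5 ^ card J * ?l (A k) \<and>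
      ?h (A k) \<le> ?l (A k) \<and> ?h (B k) \<le> ?l (B k))"
    using vitali_coord_discs[OF J 0(1) \<delta>] by (elim exE) (rule that)
  then have AB: "disjoint_family A" "\<And>k. closed (A k)" "\<And>k. closed (B k)" "\<And>k. A k \<subseteq> U"
    "U \<inter> span J \<subseteq> (\<Union>k. B k)" "\<And>k. ?l (B k) = 5 ^ card J * ?l (A k)"
    "\<And>k. ?h (A k) \<le> ?l (A k)" "\<And>k. ?h (B k) \<le> ?l (B k)"
    by blast+
  \<comment> \<open>The enlargements alone give the factor \<open>5 ^ card J\<close>, weakened to
    \<open>1 + 5 ^ card J\<close> to start the recursion for the excess.\<close>
  have "?h (U \<inter> span J) \<le> ?h (\<Union>k. B k)" by (rule hausdorff_premeasure_mono[OF AB(5)])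
  also have "\<dots> \<le> (\<Sum>k. ?h (B k))" by (rule hausdorff_premeasure_countably_subadditive)
  also have "\<dots> \<le> (\<Sum>k. ?l (B k))" by (intro suminf_le AB(8)) auto
  also have "\<dots> = 5 ^ card J * (\<Sum>k. ?l (A k))" by (simp add: AB(6))
  also have "(\<Sum>k. ?l (A k)) = ?l (\<Union>k. A k)"
    using AB(1,2) by (intro suminf_emeasure) auto
  also have "\<dots> \<le> ?l U" using AB(4) 0 by (intro emeasure_mono) auto
  also have "5 ^ card J * ?l U \<le> ennreal (1 + 5 ^ card J) * ?l U"
    by (intro mult_right_mono) (auto simp: ennreal_power[symmetric] ennreal_plus)
  finally show ?case by (simp add: mult_left_mono)
next
  case (Suc j)
  let ?l = "emeasure (coord_lborel J)" and ?h = "hausdorff_premeasure (card J) \<delta>"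
  define m where "m = card J"
  define c where "c = (5 ^ m * (1 - 1 / (2 * 5 ^ m)) ^ j :: real)"
  have th: "0 \<le> 1 - 1 / (2 * 5 ^ m :: real)"
  proof -
    have "1 \<le> (5::real) ^ m" by simp
    then have "1 \<le> 2 * (5::real) ^ m" by linarith
    then show ?thesis by simp
  qed
  then have c: "0 \<le> c" by (simp add: c_def)
  obtain A B :: "nat \<Rightarrow> (real^'n) set" where "disjoint_family A \<and> U \<inter> span J \<subseteq> (\<Union>k. B k) \<and>
    (\<forall>k. closed (A k) \<and> closed (B k) \<and> A k \<subseteq> U \<and> ?l (B k) = 5 ^ card J * ?l (A k) \<and>
      ?h (A k) \<le> ?l (A k) \<and> ?h (B k) \<le> ?l (B k))"
    using vitali_coord_discs[OF J Suc(2) \<delta>] by (elim exE) (rule that)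
  then have AB': "disjoint_family A" "\<And>k. closed (A k)" "\<And>k. closed (B k)" "\<And>k. A k \<subseteq> U"
    "U \<inter> span J \<subseteq> (\<Union>k. B k)" "\<And>k. ?l (B k) = 5 ^ card J * ?l (A k)"
    "\<And>k. ?h (A k) \<le> ?l (A k)" "\<And>k. ?h (B k) \<le> ?l (B k)"
    by blast+
  note AB = AB'[folded m_def]
  have lU: "?l U < \<infinity>" by (rule emeasure_coord_lborel_bounded_finite[OF J Suc.prems(2)])
  define u where "u = measure (coord_lborel J) U"
  have u: "?l U = ennreal u" unfolding u_def using lU by (intro emeasure_eq_ennreal_measure) auto
  \<comment> \<open>Since the enlargements cover, the disjoint balls carry at least the share
    \<open>1 / 5 ^ m\<close> of \<open>U\<close>.\<close>
  have big: "ennreal u \<le> 5 ^ m * (\<Sum>k. ?l (A k))"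
  proof -
    have "?l U = ?l (U \<inter> span J)"
      using Suc.prems by (intro emeasure_coord_lborel_span) (auto simp: closed_subspace)
    also have "\<dots> \<le> ?l (\<Union>k. B k)" using AB(3,5) by (intro emeasure_mono) auto
    also have "\<dots> \<le> (\<Sum>k. ?l (B k))" using AB(3) by (intro emeasure_subadditive_countably) auto
    also have "\<dots> = 5 ^ m * (\<Sum>k. ?l (A k))" by (simp add: AB(6))
    finally show ?thesis by (simp add: u)
  qed
  \<comment> \<open>Half of that share, the origin of the 2 in the ratio, is reached by finitely
    many balls. Their union is closed, so the rest of \<open>U\<close> is open and the induction
    hypothesis applies to it.\<close>
  have "\<exists>N. ennreal (u / (2 * 5 ^ m)) \<le> (\<Sum>k<N. ?l (A k))"
  proof (cases "u = 0")
    case False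
    then have "u > 0" by (simp add: u_def measure_nonneg order_less_le)
    have "ennreal (u / (2 * 5 ^ m)) < (\<Sum>k. ?l (A k))"
    proof (rule ccontr)
      assume "\<not> ?thesis"
      then have "5 ^ m * (\<Sum>k. ?l (A k)) \<le> 5 ^ m * ennreal (u / (2 * 5 ^ m))"
        by (intro mult_left_mono) (auto simp: not_less)
      also have "\<dots> = ennreal (5 ^ m * (u / (2 * 5 ^ m)))"
        by (subst ennreal_mult') (simp_all add: ennreal_power[symmetric])
      also have "\<dots> = ennreal (u / 2)" by simp
      finally have "ennreal u \<le> ennreal (u / 2)" using big by (rule order_trans[rotated])
      then show False using \<open>u > 0\<close> by simp
    qed
    then have "\<exists>N. ennreal (u / (2 * 5 ^ m)) < (\<Sum>k<N. ?l (A k))"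
      unfolding suminf_eq_SUP less_SUP_iff by auto
    then show ?thesis by (auto intro: less_imp_le)
  qed auto
  then obtain N where N: "ennreal (u / (2 * 5 ^ m)) \<le> (\<Sum>k<N. ?l (A k))" by blast
  define D where "D = (\<Union>k<N. A k)"
  have Dcl: "closed D" unfolding D_def using AB(2) by (intro closed_UN) auto
  have DU: "D \<subseteq> U" using AB(4) by (auto simp: D_def)
  have lD: "(\<Sum>k<N. ?l (A k)) = ?l D"
    unfolding D_def using AB(1,2)
    by (intro sum_emeasure) (auto simp: disjoint_family_on_def)
  define s where "s = measure (coord_lborel J) D"
  have fD: "?l D < \<infinity>" using le_less_trans[OF emeasure_mono[OF DU] lU] Suc.prems by simp
  have s: "?l D = ennreal s" unfolding s_def using fD by (intro emeasure_eq_ennreal_measure) auto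
  have s0: "0 \<le> s" "0 \<le> u" by (simp_all add: s_def u_def)
  have us: "u / (2 * 5 ^ m) \<le> s" using N s0 unfolding lD s by (simp add: ennreal_le_iff)
  have lV: "?l (U - D) = ennreal (u - s)"
    using fD Dcl Suc.prems DU s0 by (subst emeasure_Diff) (auto simp: u s ennreal_minus)
  have su: "s \<le> u" using emeasure_mono[OF DU, of "coord_lborel J"] Suc.prems s0 by (simp add: u s)
  have hD: "?h D \<le> ?l D"
  proof -
    have "?h (\<Union>k<M. A k) \<le> (\<Sum>k<M. ?h (A k))" for M
    proof (induction M)
      case (Suc M)
      have "?h (\<Union>k<Suc M. A k) \<le> ?h (\<Union>k<M. A k) + ?h (A M)"
        using hausdorff_premeasure_Un[of \<delta> "card J" "\<Union>k<M. A k" "A M"] \<delta>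
        by (simp add: lessThan_Suc Un_commute)
      also have "\<dots> \<le> (\<Sum>k<Suc M. ?h (A k))" using Suc by (simp add: add_right_mono)
      finally show ?case .
    qed (use \<delta> in simp)
    then have "?h D \<le> (\<Sum>k<N. ?h (A k))" unfolding D_def .
    also have "\<dots> \<le> (\<Sum>k<N. ?l (A k))" by (rule sum_mono) (rule AB'(7))
    finally show ?thesis by (simp add: lD)
  qed
  \<comment> \<open>The balls have no excess; \<open>c\<close> is paid only on \<open>U - D\<close>,
    whose measure is at most \<open>1 - 1 / (2 * 5 ^ m)\<close> times that of
    \<open>U\<close>.\<close>
  have "?h (U \<inter> span J) \<le> ?h (D \<union> (U - D) \<inter> span J)"
    by (rule hausdorff_premeasure_mono) auto
  also have "\<dots> \<le> ?h D + ?h ((U - D) \<inter> span J)"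
    using \<delta> by (intro hausdorff_premeasure_Un) simp
  also have "\<dots> \<le> ?l D + ennreal (1 + c) * ?l (U - D)"
    unfolding c_def m_def using Suc.prems Dcl
    by (intro add_mono hD Suc.IH) (auto intro: bounded_subset)
  also have "\<dots> = ennreal (s + (1 + c) * (u - s))"
    using su s0 c unfolding s lV by (simp add: ennreal_mult ennreal_plus)
  also have "\<dots> \<le> ennreal ((1 + c * (1 - 1 / (2 * 5 ^ m))) * u)"
  proof (rule ennreal_leI)
    have "c * (u / (2 * 5 ^ m)) \<le> c * s" by (rule mult_left_mono[OF us c])
    then show "s + (1 + c) * (u - s) \<le> (1 + c * (1 - 1 / (2 * 5 ^ m))) * u"
      by (simp add: algebra_simps)
  qed
  also have "\<dots> = ennreal (1 + c * (1 - 1 / (2 * 5 ^ m))) * ?l U"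
    using c th s0 by (simp add: ennreal_mult u)
  finally show ?case unfolding c_def m_def by (simp add: mult_ac)
qed

lemma hausdorff_measure_open_le:
  fixes U :: "(real^'n) set"
  assumes J: "J \<subseteq> Basis" and U: "open U" "bounded U"
  shows "hausdorff_measure (card J) (U \<inter> span J) \<le> emeasure (coord_lborel J) U"
proof (rule hausdorff_measure_leI)
  fix \<delta> :: real assume \<delta>: "0 < \<delta>"
  let ?q = "1 - 1 / (2 * 5 ^ card J) :: real"
  define u where "u = measure (coord_lborel J) U"
  have u: "emeasure (coord_lborel J) U = ennreal u"
    unfolding u_def using emeasure_coord_lborel_bounded_finite[OF J U(2)]
    by (intro emeasure_eq_ennreal_measure) auto
  have u0: "0 \<le> u" by (simp add: u_def)
  have "1 \<le> (5::real) ^ card J" by simp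
  then have "1 \<le> 2 * (5::real) ^ card J" by linarith
  then have q: "0 \<le> ?q" "?q < 1" by simp_all
  have "(\<lambda>j. ennreal ((1 + 5 ^ card J * ?q ^ j) * u)) \<longlonglongrightarrow> ennreal ((1 + 5 ^ card J * 0) * u)"
    using q by (intro tendsto_intros LIMSEQ_realpow_zero) auto
  moreover have "hausdorff_premeasure (card J) \<delta> (U \<inter> span J) \<le> ennreal ((1 + 5 ^ card J * ?q ^ j) * u)" for j
    using hausdorff_premeasure_open_le_aux[OF J \<delta> U, of j] q u0 by (simp add: u ennreal_mult)
  ultimately show "hausdorff_premeasure (card J) \<delta> (U \<inter> span J) \<le> emeasure (coord_lborel J) U"
    unfolding u by (intro LIMSEQ_le_const) auto
qed

theorem hausdorff_measure_eq_coord_lborel: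
  fixes B :: "(real^'n) set"
  assumes J: "J \<subseteq> Basis" and [measurable]: "B \<in> sets borel" and B: "bounded B" "B \<subseteq> span J"
  shows "hausdorff_measure (card J) B = emeasure (coord_lborel J) B"
proof (rule antisym)
  obtain r where r: "B \<subseteq> ball 0 r" using bounded_subset_ballD[OF B(1)] by blast
  \<comment> \<open>Outer regularity is applied to a finite measure, hence the restriction to a ball
    containing \<open>B\<close>; open supersets of \<open>B\<close> are cut with that ball.\<close>
  define M where "M = density (coord_lborel J) (indicator (ball 0 r))"
  have M: "emeasure M A = emeasure (coord_lborel J) (A \<inter> ball 0 r)" if [measurable]: "A \<in> sets borel" for A
    unfolding M_def by (subst emeasure_density[OF borel_measurable_indicator]) (auto simp: indicator_inter_arith[symmetric] Int_commute nn_integral_indicator)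
  have sM: "sets M = sets borel" by (simp add: M_def)
  have "emeasure M (space M) \<noteq> \<infinity>"
    using emeasure_coord_lborel_bounded_finite[OF J, of "ball 0 r"] M[of UNIV] by (simp add: M_def)
  then have "emeasure M B = (INF U\<in>{U. B \<subseteq> U \<and> open U}. emeasure M U)"
    using sM by (intro outer_regular) auto
  moreover have "hausdorff_measure (card J) B \<le> emeasure M U" if "B \<subseteq> U" "open U" for U
  proof -
    have "hausdorff_measure (card J) B \<le> hausdorff_measure (card J) (U \<inter> ball 0 r \<inter> span J)"
      using that r B by (intro hausdorff_measure_mono) auto
    also have "\<dots> \<le> emeasure (coord_lborel J) (U \<inter> ball 0 r)"
      using that by (intro hausdorff_measure_open_le[OF J]) (auto intro: bounded_subset)
    finally show ?thesis using that by (simp add: M)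
  qed
  ultimately have "hausdorff_measure (card J) B \<le> emeasure M B" by (auto intro: INF_greatest)
  also have "\<dots> = emeasure (coord_lborel J) B" using r by (simp add: M Int_absorb2)
  finally show "hausdorff_measure (card J) B \<le> emeasure (coord_lborel J) B" .
  show "emeasure (coord_lborel J) B \<le> hausdorff_measure (card J) B"
    by (rule coord_lborel_le_hausdorff_measure[OF J]) simp
qed

corollary hausdorff_measure_eq_lborel:
  fixes B :: "(real^'n) set"
  assumes "B \<in> sets borel" "bounded B"
  shows "hausdorff_measure CARD('n) B = emeasure lborel B"
  using hausdorff_measure_eq_coord_lborel[OF subset_refl assms] by (simp add: coord_lborel_Basis)

section \<open>Outer normals and the surface area measure\<close>

text \<open>On a compact set an injective continuous map has a continuous inverse, and the image of
  \<open>T\<close> is the preimage of \<open>T\<close> under that inverse.\<close>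

lemma borel_injective_continuous_image:
  fixes f :: "'a::metric_space \<Rightarrow> 'b::metric_space"
  assumes C: "compact C" "continuous_on C f" "inj_on f C" and T: "T \<in> sets borel" "T \<subseteq> C"
  shows "f ` T \<in> sets borel"
proof -
  obtain g where g: "homeomorphism C (f ` C) f g"
    using homeomorphism_compact[OF C(1,2) refl C(3)] by blast
  have fC: "f ` C \<in> sets borel"
    using compact_continuous_image[OF C(2,1)] by (intro borel_closed compact_imp_closed)
  have "g \<in> borel_measurable (restrict_space borel (f ` C))"
    using g by (intro borel_measurable_continuous_on_restrict) (simp add: homeomorphism_def)
  from measurable_sets[OF this T(1)] have "g -` T \<inter> f ` C \<in> sets (restrict_space borel (f ` C))"
    by (simp add: space_restrict_space)
  then have "g -` T \<inter> f ` C \<in> sets borel"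
    using fC by (subst (asm) sets_restrict_space_iff) auto
  also have "g -` T \<inter> f ` C = f ` T"
    using g T(2) by (force simp: homeomorphism_def)
  finally show ?thesis .
qed

lemma emeasure_coord_lborel_hyperplane:
  assumes J: "J \<subseteq> Basis" "j \<in> J"
  shows "emeasure (coord_lborel J) {z. z \<bullet> j = c} = 0"
proof -
  have fin: "finite (J - {j})" using J(1) by (meson finite_Basis finite_Diff finite_subset)
  have j: "j \<bullet> j = 1" using J by (auto simp: inner_Basis)
  have "emeasure (coord_lborel (insert j (J - {j}))) {z. z \<bullet> j = c}
      = (\<integral>\<^sup>+x. (\<integral>\<^sup>+t. indicator {z. z \<bullet> j = c} (x + t *\<^sub>R j) \<partial>lborel) \<partial>coord_lborel (J - {j}))"
    using fin by (intro emeasure_coord_lborel_insert) auto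
  also have "\<dots> = (\<integral>\<^sup>+x. (\<integral>\<^sup>+t. indicator {c - x \<bullet> j} t \<partial>(lborel :: real measure)) \<partial>coord_lborel (J - {j}))"
    by (intro nn_integral_cong) (auto simp: indicator_def inner_add_left j algebra_simps)
  also have "\<dots> = 0" by simp
  finally show ?thesis using J by (simp add: insert_absorb)
qed

text \<open>Translated along \<open>i\<close>, the plane becomes a hyperplane of
  \<open>span (Basis - {i})\<close>, hence null there. It is exhausted by balls because the
  comparison with Lebesgue measure is for bounded sets.\<close>

lemma hausdorff_measure_codim2_plane:
  fixes i j :: "real^'n"
  assumes ij: "i \<in> Basis" "j \<in> Basis" "i \<noteq> j"
  shows "hausdorff_measure (CARD('n) - 1) {y. y \<bullet> i = a \<and> y \<bullet> j = b} = 0"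
proof -
  let ?J = "Basis - {i}" and ?P = "\<lambda>k. {y. y \<bullet> i = a \<and> y \<bullet> j = b} \<inter> cball 0 (real k)"
  \<comment> \<open>The centre is chosen so that translation by \<open>a *\<^sub>R i\<close> carries
    \<open>?Q k\<close> onto \<open>?P k\<close>.\<close>
  let ?Q = "\<lambda>k. {y. y \<bullet> i = 0 \<and> y \<bullet> j = b} \<inter> cball (- a *\<^sub>R i) (real k)"
  have cJ: "card ?J = CARD('n) - 1" using ij by simp
  have sp: "span ?J = {x. \<forall>k\<in>Basis. k \<notin> ?J \<longrightarrow> x \<bullet> k = 0}" by (intro span_substd_basis) auto
  have ii: "i \<bullet> i = 1" "i \<bullet> j = 0" using ij by (auto simp: inner_Basis)
  have "hausdorff_measure (CARD('n) - 1) (?P k) = 0" for k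
  proof -
    have cl: "closed {y. y \<bullet> i = 0 \<and> y \<bullet> j = b}"
      by (intro closed_Collect_conj closed_Collect_eq continuous_intros)
    have "hausdorff_measure (CARD('n) - 1) (?Q k) = emeasure (coord_lborel ?J) (?Q k)"
      unfolding cJ[symmetric] using cl
      by (intro hausdorff_measure_eq_coord_lborel) (auto simp: sp intro: borel_closed)
    also have "\<dots> \<le> emeasure (coord_lborel ?J) {z. z \<bullet> j = b}"
      by (intro emeasure_mono) auto
    also have "\<dots> = 0" using ij by (intro emeasure_coord_lborel_hyperplane) auto
    finally have Q: "hausdorff_measure (CARD('n) - 1) (?Q k) = 0" by simp
    have "?P k \<subseteq> (\<lambda>y. y + a *\<^sub>R i) ` ?Q k"
    proof
      fix y assume "y \<in> ?P k"
      then have "y - a *\<^sub>R i \<in> ?Q k"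
        by (auto simp: inner_diff_left ii dist_norm norm_minus_commute)
      then show "y \<in> (\<lambda>y. y + a *\<^sub>R i) ` ?Q k" by (rule rev_image_eqI) simp
    qed
    then have "hausdorff_measure (CARD('n) - 1) (?P k) \<le> hausdorff_measure (CARD('n) - 1) ((\<lambda>y. y + a *\<^sub>R i) ` ?Q k)"
      by (rule hausdorff_measure_mono)
    also have "\<dots> \<le> ennreal (1 ^ (CARD('n) - 1)) * hausdorff_measure (CARD('n) - 1) (?Q k)"
      by (rule hausdorff_measure_lipschitz_image) (auto simp: dist_norm)
    finally show ?thesis using Q by simp
  qed
  then have "hausdorff_measure (CARD('n) - 1) (\<Union>k. ?P k) = 0"
    by (intro hausdorff_measure_null_UN) auto
  also have "(\<Union>k. ?P k) = {y. y \<bullet> i = a \<and> y \<bullet> j = b}"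
    by (auto simp: real_arch_simple)
  finally show ?thesis .
qed

section \<open>Convex bodies around the origin: radii, normals and rays\<close>

locale convex_body_zero =
  fixes K :: "(real^'n) set"
  assumes compact: "compact K" and convex: "convex K" and zero_interior: "0 \<in> interior K"
begin

lemma closed: "closed K" and bounded: "bounded K"
  using compact by (simp_all add: compact_imp_closed compact_imp_bounded)

lemma frontier_subset: "frontier K \<subseteq> K"
  using closed by (simp add: frontier_subset_closed)

lemma zero_in: "0 \<in> K"
  using zero_interior interior_subset by blast

text \<open>Some radius of a ball about 0 inside \<open>K\<close>, not the extremal one of convex
  geometry; likewise for \<open>outradius\<close>.\<close>

definition inradius :: real where
  "inradius = (SOME r. 0 < r \<and> cball 0 r \<subseteq> K)"

definition outradius :: real where
  "outradius = (SOME R. 0 < R \<and> K \<subseteq> cball 0 R)"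

lemma inradius: "0 < inradius" "cball 0 inradius \<subseteq> K"
proof -
  obtain r where "0 < r" "cball 0 r \<subseteq> K"
    using zero_interior by (auto simp: mem_interior_cball)
  then have "\<exists>r. 0 < r \<and> cball 0 r \<subseteq> K" by blast
  from someI_ex[OF this] show "0 < inradius" "cball 0 inradius \<subseteq> K"
    unfolding inradius_def by auto
qed

lemma outradius: "0 < outradius" "x \<in> K \<Longrightarrow> norm x \<le> outradius"
proof -
  obtain R where "0 < R" "\<forall>x\<in>K. norm x \<le> R" using bounded bounded_pos by blast
  then have "\<exists>R. 0 < R \<and> K \<subseteq> cball 0 R" by (auto intro!: exI[of _ R])
  from someI_ex[OF this] show "0 < outradius" "x \<in> K \<Longrightarrow> norm x \<le> outradius"
    unfolding outradius_def by auto
qed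

lemma normal_exists:
  assumes "x \<in> frontier K"
  shows "\<exists>u. outer_unit_normal K x u"
proof -
  have "interior K \<noteq> {}" using zero_interior by blast
  then have "rel_interior K = interior K" by (rule rel_interior_nonempty_interior)
  then have "x \<in> closure K" "x \<notin> rel_interior K"
    using assms by (auto simp: frontier_def)
  then obtain a where a: "a \<noteq> 0" "\<And>y. y \<in> K \<Longrightarrow> a \<bullet> x \<le> a \<bullet> y"
    using supporting_hyperplane_relative_frontier[OF convex, of x] closure_subset by (metis subsetD)
  have "y \<bullet> (- (a /\<^sub>R norm a)) \<le> x \<bullet> (- (a /\<^sub>R norm a))" if "y \<in> K" for y
    using a(2)[OF that] a(1) by (simp add: inner_commute mult_left_mono)
  then show ?thesis
    using a(1) by (intro exI[of _ "- (a /\<^sub>R norm a)"]) (simp add: outer_unit_normal_def)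
qed

text \<open>The point \<open>inradius *\<^sub>R u\<close> lies in \<open>K\<close>. This bound away
  from 0 is what later turns absolute errors into relative ones.\<close>

lemma normal_inner_ge:
  assumes "outer_unit_normal K x u"
  shows "inradius \<le> x \<bullet> u"
proof -
  have u: "norm u = 1" "\<And>y. y \<in> K \<Longrightarrow> y \<bullet> u \<le> x \<bullet> u"
    using assms by (auto simp: outer_unit_normal_def)
  have "inradius *\<^sub>R u \<in> K" using inradius u(1) by (intro subsetD[OF inradius(2)]) auto
  from u(2)[OF this] show ?thesis using u(1) by (simp add: dot_square_norm)
qed

lemma support_fun_normal:
  assumes "x \<in> frontier K" "outer_unit_normal K x u"
  shows "support_fun K u = x \<bullet> u"
  unfolding support_fun_def using assms frontier_subset
  by (intro cSup_eq_maximum) (auto simp: outer_unit_normal_def)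

text \<open>Testing against a normal at \<open>x\<close> gives \<open>s \<le> t\<close>, and
  symmetrically. Each ray from 0 meets the frontier at most once, so a boundary point and a factor
  serve as polar coordinates on the shells.\<close>

lemma normal_frontier_unique_ray:
  assumes x: "x \<in> frontier K" and y: "y \<in> frontier K" and eq: "s *\<^sub>R x = t *\<^sub>R y" and st: "0 < s" "0 < t"
  shows "x = y \<and> s = t"
proof -
  have le: "s \<le> t" if xy: "x \<in> frontier K" "y \<in> frontier K" "s *\<^sub>R x = t *\<^sub>R y" "0 < s" "0 < t"
    for x y :: "real^'n" and s t :: real
  proof -
    obtain v where v: "outer_unit_normal K x v" using normal_exists xy by blast
    have "y \<bullet> v \<le> x \<bullet> v" using v xy(2) frontier_subset by (auto simp: outer_unit_normal_def)
    then have "t * (y \<bullet> v) \<le> t * (x \<bullet> v)" using xy(5) by simp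
    moreover have "s * (x \<bullet> v) = t * (y \<bullet> v)" using arg_cong[OF xy(3), of "\<lambda>z. z \<bullet> v"] by simp
    ultimately have "s * (x \<bullet> v) \<le> t * (x \<bullet> v)" by simp
    moreover have "0 < x \<bullet> v" using normal_inner_ge[OF v] inradius by simp
    ultimately show ?thesis by simp
  qed
  have "s = t" using le[OF x y eq st] le[OF y x eq[symmetric] st(2,1)] by simp
  then show ?thesis using eq st by simp
qed

text \<open>Its compactness is the source of measurability, through projections of compact sets, and
  of the finite covers by small pieces.\<close>

definition normal_graph :: "((real^'n) \<times> (real^'n)) set" where
  "normal_graph = {(x, u). x \<in> frontier K \<and> outer_unit_normal K x u}"

lemma compact_normal_graph: "compact normal_graph"
proof -
  have "normal_graph = (frontier K \<times> sphere 0 1) \<inter> (\<Inter>y\<in>K. {z. y \<bullet> snd z \<le> fst z \<bullet> snd z})"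
    by (auto simp: normal_graph_def outer_unit_normal_def)
  moreover have "closed (\<Inter>y\<in>K. {z. y \<bullet> snd z \<le> fst z \<bullet> snd z})"
    by (intro closed_INT ballI closed_Collect_le continuous_intros)
  moreover have "compact (frontier K \<times> sphere (0::real^'n) 1)"
    using compact by (intro compact_Times compact_frontier) auto
  ultimately show ?thesis by (simp add: compact_Int_closed)
qed

section \<open>Boundary points with several normals\<close>

definition singular_points :: "(real^'n) set" where
  "singular_points = {x\<in>frontier K. \<exists>u v. outer_unit_normal K x u \<and> outer_unit_normal K x v \<and> u \<noteq> v}"

text \<open>Pairs of normals at one point whose distance is at least \<open>1 / (k + 1)\<close> form
  a compact set, so the singular points are a countable union of compact projections.\<close>

lemma singular_points_borel [measurable]: "singular_points \<in> sets borel"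
proof -
  let ?G = "\<lambda>k::nat. {z\<in>normal_graph \<times> normal_graph. fst (fst z) = fst (snd z)
      \<and> inverse (real (Suc k)) \<le> dist (snd (fst z)) (snd (snd z))}"
  have "compact (?G k)" for k
  proof -
    have "?G k = (normal_graph \<times> normal_graph) \<inter> {z. fst (fst z) = fst (snd z)}
       \<inter> {z. inverse (real (Suc k)) \<le> dist (snd (fst z)) (snd (snd z))}" by auto
    also have "compact \<dots>"
      by (intro compact_Int_closed compact_Times compact_normal_graph closed_Collect_eq closed_Collect_le
          continuous_intros)
    finally show ?thesis .
  qed
  then have "compact ((fst \<circ> fst) ` ?G k)" for k
    by (intro compact_continuous_image continuous_intros) auto
  then have "(\<Union>k. (fst \<circ> fst) ` ?G k) \<in> sets borel"
    by (intro sets.countable_UN) (auto intro: borel_closed compact_imp_closed)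
  also have "(\<Union>k. (fst \<circ> fst) ` ?G k) = singular_points"
  proof (intro equalityI subsetI)
    fix x assume "x \<in> singular_points"
    then obtain u v where uv: "x \<in> frontier K" "outer_unit_normal K x u" "outer_unit_normal K x v" "u \<noteq> v"
      by (auto simp: singular_points_def)
    obtain k where "inverse (real (Suc k)) < dist u v" using uv(4) reals_Archimedean[of "dist u v"] by auto
    then have "((x, u), (x, v)) \<in> ?G k" using uv by (auto simp: normal_graph_def)
    then have "x \<in> (fst \<circ> fst) ` ?G k" by (rule rev_image_eqI) simp
    then show "x \<in> (\<Union>k. (fst \<circ> fst) ` ?G k)" by blast
  next
    fix x assume "x \<in> (\<Union>k. (fst \<circ> fst) ` ?G k)"
    then obtain k u v where "(x, u) \<in> normal_graph" "(x, v) \<in> normal_graph" "inverse (real (Suc k)) \<le> dist u v"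
      by force
    moreover have "0 < inverse (real (Suc k))" by simp
    ultimately have "u \<noteq> v" by (metis dist_self not_le)
    then show "x \<in> singular_points"
      using \<open>(x, u) \<in> _\<close> \<open>(x, v) \<in> _\<close> by (auto simp: singular_points_def normal_graph_def)
  qed
  finally show ?thesis .
qed

text \<open>If all minors vanished, \<open>v\<close> would be \<open>u\<close> or
  \<open>- u\<close>; the latter is excluded because \<open>x \<bullet> u\<close> and
  \<open>x \<bullet> v\<close> are both positive. A nonzero minor lets combinations of the two
  normals reach prescribed values of two coordinates.\<close>

lemma normals_minor:
  assumes u: "outer_unit_normal K x u" and v: "outer_unit_normal K x v" and "u \<noteq> v"
  obtains i j where "i \<in> Basis" "j \<in> Basis" "(u \<bullet> i) * (v \<bullet> j) - (u \<bullet> j) * (v \<bullet> i) \<noteq> 0"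
proof (rule ccontr)
  note wit = that
  assume neg: "\<not> thesis"
  have par: "(u \<bullet> i) * (v \<bullet> j) = (u \<bullet> j) * (v \<bullet> i)" if ij: "i \<in> Basis" "j \<in> Basis" for i j
  proof (rule ccontr)
    assume "(u \<bullet> i) * (v \<bullet> j) \<noteq> (u \<bullet> j) * (v \<bullet> i)"
    then show False using neg wit[OF ij] by simp
  qed
  have n: "norm u = 1" "norm v = 1" using u v by (auto simp: outer_unit_normal_def)
  have "v \<bullet> i = ((u \<bullet> v) *\<^sub>R u) \<bullet> i" if i: "i \<in> Basis" for i
  proof -
    have "(u \<bullet> v) * (u \<bullet> i) = (\<Sum>j\<in>Basis. (u \<bullet> j) * (v \<bullet> j) * (u \<bullet> i))"
      by (subst euclidean_inner[of u v]) (rule sum_distrib_right)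
    also have "\<dots> = (\<Sum>j\<in>Basis. (u \<bullet> j) * (u \<bullet> j) * (v \<bullet> i))"
    proof (rule sum.cong[OF refl])
      fix j :: "real^'n" assume "j \<in> Basis"
      from par[OF i this] show "(u \<bullet> j) * (v \<bullet> j) * (u \<bullet> i) = (u \<bullet> j) * (u \<bullet> j) * (v \<bullet> i)"
        by (simp add: mult.assoc mult.commute)
    qed
    also have "\<dots> = (u \<bullet> u) * (v \<bullet> i)"
      by (subst euclidean_inner[of u u]) (rule sum_distrib_right[symmetric])
    finally show ?thesis using n by (simp add: dot_square_norm)
  qed
  then have v_eq: "v = (u \<bullet> v) *\<^sub>R u" by (rule euclidean_eqI)
  then have "norm v = \<bar>u \<bullet> v\<bar> * norm u" by (metis norm_scaleR)
  then have "u \<bullet> v = 1 \<or> u \<bullet> v = - 1" using n by auto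
  then show False
  proof
    assume "u \<bullet> v = 1" then show False using v_eq \<open>u \<noteq> v\<close> by simp
  next
    assume "u \<bullet> v = - 1"
    then have "v = - u" using v_eq by simp
    then have "x \<bullet> v = - (x \<bullet> u)" by simp
    then show False using normal_inner_ge[OF u] normal_inner_ge[OF v] inradius by simp
  qed
qed

text \<open>
  The outer normal cone at a singular point contains a two-dimensional cone, which meets some
  rational coordinate plane of codimension two; the nearest-point map is 1-Lipschitz and sends the
  meeting point back to the singular point.
\<close>

lemma hausdorff_measure_singular_points: "hausdorff_measure (CARD('n) - 1) singular_points = 0"
proof -
  let ?P = "\<lambda>i j a b. closest_point K ` {y::real^'n. y \<bullet> i = a \<and> y \<bullet> j = b}"
  let ?I = "{(i, j). i \<in> Basis \<and> j \<in> Basis \<and> i \<noteq> (j::real^'n)} \<times> (\<rat> :: real set) \<times> (\<rat> :: real set)"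
  have "singular_points \<subseteq> (\<Union>((i, j), a, b)\<in>?I. ?P i j a b)"
  proof
    fix x assume "x \<in> singular_points"
    then obtain u v where x: "x \<in> frontier K" and uv: "outer_unit_normal K x u" "outer_unit_normal K x v" "u \<noteq> v"
      by (auto simp: singular_points_def)
    obtain i j where ij: "i \<in> Basis" "j \<in> Basis" and D0: "(u \<bullet> i) * (v \<bullet> j) - (u \<bullet> j) * (v \<bullet> i) \<noteq> 0"
      using normals_minor[OF uv] .
    define D where "D = (u \<bullet> i) * (v \<bullet> j) - (u \<bullet> j) * (v \<bullet> i)"
    have D: "D \<noteq> 0" using D0 by (simp add: D_def)
    have "i \<noteq> j" using D0 by auto
    have nu: "\<bar>u \<bullet> k\<bar> \<le> 1" "\<bar>v \<bullet> k\<bar> \<le> 1" if "k \<in> Basis" for k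
      using Basis_le_norm[OF that, of u] Basis_le_norm[OF that, of v] uv by (auto simp: outer_unit_normal_def)
    \<comment> \<open>Changing each of the two coordinates by at most
      \<open>\<bar>D\<bar> / 4\<close> moves each coefficient by at most 1/2.\<close>
    define e where "e = \<bar>D\<bar> / 4"
    have e: "0 < e" using D by (simp add: e_def)
    obtain a where a: "a \<in> \<rat>" "(x + u + v) \<bullet> i < a" "a < (x + u + v) \<bullet> i + e"
      using Rats_dense_in_real[of "(x + u + v) \<bullet> i" "(x + u + v) \<bullet> i + e"] e by auto
    obtain b where b: "b \<in> \<rat>" "(x + u + v) \<bullet> j < b" "b < (x + u + v) \<bullet> j + e"
      using Rats_dense_in_real[of "(x + u + v) \<bullet> j" "(x + u + v) \<bullet> j + e"] e by auto
    define p where "p = a - (x + u + v) \<bullet> i"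
    define q where "q = b - (x + u + v) \<bullet> j"
    have pq: "\<bar>p\<bar> \<le> e" "\<bar>q\<bar> \<le> e" using a b by (auto simp: p_def q_def)
    \<comment> \<open>Cramer's rule: these coefficients give
      \<open>x + s *\<^sub>R u + t *\<^sub>R v\<close> the rational coordinates \<open>a\<close> and
      \<open>b\<close>. The starting point \<open>x + u + v\<close> has coefficients 1, so they stay
      positive.\<close>
    define s where "s = 1 + (p * (v \<bullet> j) - q * (v \<bullet> i)) / D"
    define t where "t = 1 + (q * (u \<bullet> i) - p * (u \<bullet> j)) / D"
    have small: "\<bar>(c * y - d * z) / D\<bar> \<le> 1 / 2" if "\<bar>c\<bar> \<le> e" "\<bar>d\<bar> \<le> e" "\<bar>y\<bar> \<le> 1" "\<bar>z\<bar> \<le> 1" for c d y z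
    proof -
      have "\<bar>c * y - d * z\<bar> \<le> \<bar>c\<bar> * \<bar>y\<bar> + \<bar>d\<bar> * \<bar>z\<bar>"
        using abs_triangle_ineq4[of "c * y" "d * z"] by (simp add: abs_mult)
      also have "\<dots> \<le> e * 1 + e * 1" using that e by (intro add_mono mult_mono) auto
      finally show ?thesis using D by (simp add: e_def abs_divide field_simps)
    qed
    have st: "0 < s" "0 < t"
      using abs_le_D2[OF small[OF pq nu(2)[OF ij(2)] nu(2)[OF ij(1)]]]
        abs_le_D2[OF small[OF pq(2,1) nu(1)[OF ij(1)] nu(1)[OF ij(2)]]]
      unfolding s_def t_def by linarith+
    let ?y = "x + s *\<^sub>R u + t *\<^sub>R v"
    have "D * (?y \<bullet> i) = D * a"
    proof -
      have "D * s = D + (p * (v \<bullet> j) - q * (v \<bullet> i))" "D * t = D + (q * (u \<bullet> i) - p * (u \<bullet> j))"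
        using D by (simp_all add: s_def t_def distrib_left)
      moreover have "D * (?y \<bullet> i) = D * (x \<bullet> i) + (D * s) * (u \<bullet> i) + (D * t) * (v \<bullet> i)"
        by (simp add: inner_add_left algebra_simps)
      ultimately have "D * (?y \<bullet> i) = D * (x \<bullet> i) + (D + (p * (v \<bullet> j) - q * (v \<bullet> i))) * (u \<bullet> i)
          + (D + (q * (u \<bullet> i) - p * (u \<bullet> j))) * (v \<bullet> i)" by (simp only:)
      also have "\<dots> = D * ((x + u + v) \<bullet> i) + p * D"
        unfolding D_def by (simp add: inner_add_left algebra_simps)
      finally have "D * (?y \<bullet> i) = D * ((x + u + v) \<bullet> i) + p * D" .
      then show ?thesis by (simp add: p_def algebra_simps)
    qed
    then have yi: "?y \<bullet> i = a" using D by simp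
    have "D * (?y \<bullet> j) = D * b"
    proof -
      have "D * s = D + (p * (v \<bullet> j) - q * (v \<bullet> i))" "D * t = D + (q * (u \<bullet> i) - p * (u \<bullet> j))"
        using D by (simp_all add: s_def t_def distrib_left)
      moreover have "D * (?y \<bullet> j) = D * (x \<bullet> j) + (D * s) * (u \<bullet> j) + (D * t) * (v \<bullet> j)"
        by (simp add: inner_add_left algebra_simps)
      ultimately have "D * (?y \<bullet> j) = D * (x \<bullet> j) + (D + (p * (v \<bullet> j) - q * (v \<bullet> i))) * (u \<bullet> j)
          + (D + (q * (u \<bullet> i) - p * (u \<bullet> j))) * (v \<bullet> j)" by (simp only:)
      also have "\<dots> = D * ((x + u + v) \<bullet> j) + q * D"
        unfolding D_def by (simp add: inner_add_left algebra_simps)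
      finally have "D * (?y \<bullet> j) = D * ((x + u + v) \<bullet> j) + q * D" .
      then show ?thesis by (simp add: q_def algebra_simps)
    qed
    then have yj: "?y \<bullet> j = b" using D by simp
    \<comment> \<open>The vector added to \<open>x\<close> is a positive combination of normals at
      \<open>x\<close>, so its inner product with \<open>z - x\<close> is not positive for any
      \<open>z\<close> in \<open>K\<close>.\<close>
    have "x = closest_point K ?y"
    proof (rule closest_point_unique[OF convex closed])
      show "x \<in> K" using x frontier_subset by blast
      show "\<forall>z\<in>K. dist ?y x \<le> dist ?y z"
      proof
        fix z assume z: "z \<in> K"
        let ?w = "s *\<^sub>R u + t *\<^sub>R v"
        have "(z - x) \<bullet> u \<le> 0" "(z - x) \<bullet> v \<le> 0"
          using uv z by (auto simp: outer_unit_normal_def inner_diff_left)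
        then have "(z - x) \<bullet> ?w \<le> 0"
          using st by (simp add: inner_add_right mult_nonneg_nonpos add_nonpos_nonpos)
        moreover have "(norm (?w - (z - x)))\<^sup>2 = (norm ?w)\<^sup>2 - 2 * ((z - x) \<bullet> ?w) + (norm (z - x))\<^sup>2"
          by (simp add: power2_norm_eq_inner inner_diff_left inner_diff_right inner_commute algebra_simps)
        ultimately have "(norm ?w)\<^sup>2 \<le> (norm (?w - (z - x)))\<^sup>2"
          using zero_le_power2[of "norm (z - x)"] by linarith
        then have "norm ?w \<le> norm (?w - (z - x))" by (rule power2_le_imp_le) simp
        then show "dist ?y x \<le> dist ?y z" by (simp add: dist_norm algebra_simps)
      qed
    qed
    then have "x \<in> ?P i j a b" using yi yj by (intro image_eqI) auto
    then show "x \<in> (\<Union>((i, j), a, b)\<in>?I. ?P i j a b)"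
      using ij \<open>i \<noteq> j\<close> a(1) b(1) by (intro UN_I[of "((i, j), a, b)"]) auto
  qed
  then have "hausdorff_measure (CARD('n) - 1) singular_points
      \<le> hausdorff_measure (CARD('n) - 1) (\<Union>((i, j), a, b)\<in>?I. ?P i j a b)"
    by (rule hausdorff_measure_mono)
  also have "\<dots> = 0"
  proof (rule hausdorff_measure_null_UN)
    have "finite {(i, j). i \<in> Basis \<and> j \<in> Basis \<and> i \<noteq> (j::real^'n)}"
      by (rule finite_subset[of _ "Basis \<times> Basis"]) auto
    then show "countable ?I" by (intro countable_SIGMA countable_finite countable_rat) auto
    fix k assume "k \<in> ?I"
    then obtain i j a b where k: "k = ((i, j), a, b)" and ij: "i \<in> Basis" "j \<in> Basis" "i \<noteq> j" by auto
    have "hausdorff_measure (CARD('n) - 1) (?P i j a b)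
        \<le> ennreal (1 ^ (CARD('n) - 1)) * hausdorff_measure (CARD('n) - 1) {y. y \<bullet> i = a \<and> y \<bullet> j = b}"
      using closest_point_lipschitz[OF convex closed] zero_in
      by (intro hausdorff_measure_lipschitz_image) auto
    then show "hausdorff_measure (CARD('n) - 1) ((\<lambda>((i, j), a, b). ?P i j a b) k) = 0"
      using hausdorff_measure_codim2_plane[OF ij, of a b] by (simp add: k)
  qed
  finally show ?thesis by simp
qed

section \<open>The Gauss map and the surface area measure\<close>

definition regular_points :: "(real^'n) set" where
  "regular_points = frontier K - singular_points"

definition gauss_map :: "real^'n \<Rightarrow> real^'n" where
  "gauss_map x = (SOME u. outer_unit_normal K x u)"

lemma regular_points_borel [measurable]: "regular_points \<in> sets borel"
  unfolding regular_points_def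
  by (intro sets.Diff singular_points_borel) (simp add: borel_closed)

lemma gauss_map_normal: "x \<in> frontier K \<Longrightarrow> outer_unit_normal K x (gauss_map x)"
  unfolding gauss_map_def using normal_exists by (rule someI_ex)

lemma gauss_map_unique: "x \<in> regular_points \<Longrightarrow> outer_unit_normal K x u \<Longrightarrow> gauss_map x = u"
  using gauss_map_normal by (auto simp: regular_points_def singular_points_def)

text \<open>By uniqueness of the normal, a regular point is mapped outside an open \<open>S\<close>
  exactly when it is the first component of a pair in the compact set
  \<open>normal_graph \<inter> (UNIV \<times> - S)\<close>.\<close>

lemma measurable_gauss_map: "gauss_map \<in> restrict_space borel regular_points \<rightarrow>\<^sub>M restrict_space borel (sphere 0 1)"
proof (rule measurable_restrict_space2)
  show "gauss_map \<in> space (restrict_space borel regular_points) \<rightarrow> sphere 0 1"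
    using gauss_map_normal by (auto simp: space_restrict_space regular_points_def outer_unit_normal_def)
  show "gauss_map \<in> borel_measurable (restrict_space borel regular_points)"
  proof (rule borel_measurableI)
    fix S :: "(real^'n) set" assume "open S"
    have "compact (fst ` (normal_graph \<inter> (UNIV \<times> - S)))"
      using \<open>open S\<close> by (intro compact_continuous_image continuous_intros compact_Int_closed compact_normal_graph closed_Times) auto
    then have "fst ` (normal_graph \<inter> (UNIV \<times> - S)) \<in> sets borel"
      by (intro borel_closed compact_imp_closed)
    then have "regular_points - fst ` (normal_graph \<inter> (UNIV \<times> - S)) \<in> sets borel" by simp
    also have "regular_points - fst ` (normal_graph \<inter> (UNIV \<times> - S)) = gauss_map -` S \<inter> regular_points"
    proof (intro equalityI subsetI)
      fix x assume x: "x \<in> regular_points - fst ` (normal_graph \<inter> (UNIV \<times> - S))"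
      then have "(x, gauss_map x) \<in> normal_graph"
        using gauss_map_normal by (auto simp: normal_graph_def regular_points_def)
      then show "x \<in> gauss_map -` S \<inter> regular_points" using x by force
    next
      fix x assume "x \<in> gauss_map -` S \<inter> regular_points"
      then show "x \<in> regular_points - fst ` (normal_graph \<inter> (UNIV \<times> - S))"
        using gauss_map_unique by (auto simp: normal_graph_def)
    qed
    finally show "gauss_map -` S \<inter> space (restrict_space borel regular_points) \<in> sets (restrict_space borel regular_points)"
      by (subst sets_restrict_space_iff) (auto simp: space_restrict_space)
  qed
qed

lemma measurable_gauss_map_hausdorff:
  "gauss_map \<in> restrict_space (hausdorff_borel s) regular_points \<rightarrow>\<^sub>M restrict_space borel (sphere 0 1)"
  using measurable_gauss_map
  by (subst measurable_cong_sets[OF sets_restrict_space_cong[OF sets_hausdorff_borel] refl])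

text \<open>The points with a normal in \<open>A\<close> and the regular points mapped into
  \<open>A\<close> differ by singular points only, a null set. Countable additivity is inherited
  from the push-forward; without it \<open>measure_of\<close> would be the zero measure.\<close>

lemma surface_area_measure_eq_distr:
  "surface_area_measure K =
     distr (restrict_space (hausdorff_borel (CARD('n) - 1)) regular_points) (restrict_space borel (sphere 0 1)) gauss_map"
  (is "_ = ?N")
proof -
  let ?H = "hausdorff_measure (CARD('n) - 1)"
  let ?\<tau> = "\<lambda>A. {x \<in> frontier K. \<exists>u\<in>A. outer_unit_normal K x u}"
  have eq: "?H (?\<tau> A) = emeasure ?N A" if A: "A \<in> sets (restrict_space borel (sphere 0 1))" for A
  proof -
    let ?R = "gauss_map -` A \<inter> regular_points"
    have "?R \<in> sets (restrict_space borel regular_points)"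
      using measurable_sets[OF measurable_gauss_map A] by (simp add: space_restrict_space)
    then have R: "?R \<in> sets borel" by (subst (asm) sets_restrict_space_iff) auto
    have "emeasure ?N A = emeasure (hausdorff_borel (CARD('n) - 1)) ?R"
      using A by (subst emeasure_distr[OF measurable_gauss_map_hausdorff]) (auto simp: space_restrict_space emeasure_restrict_space)
    also have "\<dots> = ?H ?R" by (rule emeasure_hausdorff_borel[OF R])
    finally have N: "emeasure ?N A = ?H ?R" .
    have "?R \<subseteq> ?\<tau> A" using gauss_map_normal by (auto simp: regular_points_def)
    moreover have "?\<tau> A \<subseteq> ?R \<union> singular_points"
      using gauss_map_unique by (auto simp: regular_points_def)
    ultimately have "?H ?R \<le> ?H (?\<tau> A)" "?H (?\<tau> A) \<le> ?H ?R + ?H singular_points"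
      by (auto intro: hausdorff_measure_mono order_trans[OF hausdorff_measure_mono hausdorff_measure_Un])
    then show ?thesis using N hausdorff_measure_singular_points by simp
  qed
  have sp: "space (restrict_space borel (sphere (0::real^'n) 1)) = sphere 0 1"
    by (simp add: space_restrict_space)
  have "surface_area_measure K = measure_of (space ?N) (sets ?N) (emeasure ?N)"
    unfolding surface_area_measure_def
  proof (subst measure_of_eq[where \<mu>' = "emeasure ?N"])
    show "sets (restrict_space borel (sphere (0::real^'n) 1)) \<subseteq> Pow (sphere 0 1)"
      using sets.space_closed[of "restrict_space borel (sphere (0::real^'n) 1)"] sp by simp
    fix A assume "A \<in> sigma_sets (sphere 0 1) (sets (restrict_space borel (sphere (0::real^'n) 1)))"
    then show "?H (?\<tau> A) = emeasure ?N A"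
      using sets.sigma_sets_eq[of "restrict_space borel (sphere (0::real^'n) 1)"] sp eq by auto
  qed (simp add: sp)
  also have "\<dots> = ?N" by (rule measure_of_of_measure)
  finally show ?thesis .
qed

end

section \<open>Volumes of thin shells\<close>

text \<open>The inequality makes \<open>f\<close> constant on the fibres of \<open>g\<close>, so
  \<open>g a \<mapsto> f a\<close> is a well-defined map, Lipschitz with constant
  \<open>1 / q\<close>. The free parameter type admits pairs of a point and a factor.\<close>

lemma hausdorff_measure_compare:
  fixes f g :: "'a \<Rightarrow> real^'n"
  assumes q: "0 < q" and le: "\<And>a b. a \<in> P \<Longrightarrow> b \<in> P \<Longrightarrow> q * dist (f a) (f b) \<le> dist (g a) (g b)"
  shows "ennreal (q ^ s) * hausdorff_measure s (f ` P) \<le> hausdorff_measure s (g ` P)"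
proof -
  define h where "h = f \<circ> inv_into P g"
  have h: "h (g a) = f a" if "a \<in> P" for a
  proof -
    have "inv_into P g (g a) \<in> P" "g (inv_into P g (g a)) = g a"
      using that by (auto intro: inv_into_into f_inv_into_f)
    then have "q * dist (h (g a)) (f a) \<le> 0"
      using le[of "inv_into P g (g a)" a] that by (simp add: h_def)
    then show ?thesis using q by (simp add: mult_le_0_iff)
  qed
  have "hausdorff_measure s (h ` (g ` P)) \<le> ennreal ((1 / q) ^ s) * hausdorff_measure s (g ` P)"
  proof (rule hausdorff_measure_lipschitz_image)
    fix y z assume "y \<in> g ` P" "z \<in> g ` P"
    then show "dist (h y) (h z) \<le> 1 / q * dist y z"
      using le q by (auto simp: h field_simps)
  qed (use q in simp)
  also have "h ` (g ` P) = f ` P" using h by (auto simp: image_image)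
  finally have "ennreal (q ^ s) * hausdorff_measure s (f ` P)
      \<le> ennreal (q ^ s) * (ennreal ((1 / q) ^ s) * hausdorff_measure s (g ` P))"
    by (rule mult_left_mono) simp
  also have "\<dots> = ennreal (q ^ s * (1 / q) ^ s) * hausdorff_measure s (g ` P)"
    using q by (simp add: ennreal_mult mult.assoc)
  also have "q ^ s * (1 / q) ^ s = 1" using q by (simp flip: power_mult_distrib)
  finally show ?thesis by simp
qed

text \<open>
  The translates of the base along the axis are sheared back by translation invariance.
\<close>

lemma emeasure_oblique_cylinder:
  fixes B :: "(real^'n) set" and w e :: "real^'n"
  assumes e: "e \<in> Basis" and B [measurable]: "B \<in> sets borel" and Bs: "B \<subseteq> span (Basis - {e})"
    and h: "0 < w \<bullet> e" and ab: "a \<le> b"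
    and W: "(\<lambda>(z, s). z + s *\<^sub>R w) ` (B \<times> {a<..b}) \<in> sets borel"
  shows "emeasure lborel ((\<lambda>(z, s). z + s *\<^sub>R w) ` (B \<times> {a<..b}))
     = ennreal ((b - a) * (w \<bullet> e)) * emeasure (coord_lborel (Basis - {e})) B"
proof -
  let ?J = "Basis - {e}" and ?W = "(\<lambda>(z, s). z + s *\<^sub>R w) ` (B \<times> {a<..b})"
  note W [measurable]
  define h where "h = w \<bullet> e"
  have h0: "0 < h" using h by (simp add: h_def)
  have ee: "e \<bullet> e = 1" using e by (simp add: inner_Basis)
  have "?J \<subseteq> Basis" by auto
  from span_substd_basis[OF this] have "span ?J = {x. \<forall>i\<in>Basis. i \<notin> ?J \<longrightarrow> x \<bullet> i = 0}" .
  then have sp: "x \<in> span ?J \<longleftrightarrow> x \<bullet> e = 0" for x using e by auto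
  \<comment> \<open>The horizontal part of \<open>w\<close>: the slice at height \<open>t\<close> is
    \<open>B\<close> moved by \<open>(t / h) *\<^sub>R w'\<close>.\<close>
  define w' where "w' = w - h *\<^sub>R e"
  have w': "w' \<in> span ?J" by (simp add: sp w'_def h_def inner_diff_left ee)
  have mem: "x + t *\<^sub>R e \<in> ?W \<longleftrightarrow> t \<in> {a * h<..b * h} \<and> x + - ((t / h) *\<^sub>R w') \<in> B"
    if x: "x \<in> span ?J" for x t
  proof
    assume "x + t *\<^sub>R e \<in> ?W"
    then obtain z s where z: "z \<in> B" and s: "a < s" "s \<le> b" and eq: "x + t *\<^sub>R e = z + s *\<^sub>R w" by auto
    have "t = s * h"
      using arg_cong[OF eq, of "\<lambda>v. v \<bullet> e"] x z Bs by (auto simp: inner_add_left sp ee h_def)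
    moreover from this have "x + - ((t / h) *\<^sub>R w') = z"
      using eq h0 by (simp add: w'_def algebra_simps)
    ultimately show "t \<in> {a * h<..b * h} \<and> x + - ((t / h) *\<^sub>R w') \<in> B" using s z h0 by simp
  next
    assume *: "t \<in> {a * h<..b * h} \<and> x + - ((t / h) *\<^sub>R w') \<in> B"
    have "x + t *\<^sub>R e = (\<lambda>(z, s). z + s *\<^sub>R w) (x + - ((t / h) *\<^sub>R w'), t / h)"
      using h0 by (simp add: w'_def algebra_simps)
    moreover have "(x + - ((t / h) *\<^sub>R w'), t / h) \<in> B \<times> {a<..b}"
      using * h0 by (simp add: field_simps)
    ultimately show "x + t *\<^sub>R e \<in> ?W" by (rule image_eqI)
  qed
  have "emeasure lborel ?W = (\<integral>\<^sup>+x. indicator ?W x \<partial>coord_lborel (insert e ?J))"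
    using e by (simp add: insert_absorb coord_lborel_Basis)
  also have "\<dots> = (\<integral>\<^sup>+t. (\<integral>\<^sup>+x. indicator ?W (x + t *\<^sub>R e) \<partial>coord_lborel ?J) \<partial>lborel)"
    by (intro nn_integral_coord_lborel_insert_rev) auto
  also have "\<dots> = (\<integral>\<^sup>+t. emeasure (coord_lborel ?J) B * indicator {a * h<..b * h} t \<partial>lborel)"
  proof (intro nn_integral_cong)
    fix t :: real
    have "(\<integral>\<^sup>+x. indicator ?W (x + t *\<^sub>R e) \<partial>coord_lborel ?J)
        = (\<integral>\<^sup>+x. indicator {a * h<..b * h} t * indicator B (x + - ((t / h) *\<^sub>R w')) \<partial>coord_lborel ?J)"
    proof (rule nn_integral_cong_AE, use AE_coord_lborel_span in eventually_elim)
      fix x assume "x \<in> span ?J"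
      from mem[OF this] show "indicator ?W (x + t *\<^sub>R e)
          = (indicator {a * h<..b * h} t * indicator B (x + - ((t / h) *\<^sub>R w')) :: ennreal)"
        by (simp only: indicator_def) simp
    qed
    also have "\<dots> = indicator {a * h<..b * h} t * (\<integral>\<^sup>+x. indicator B (x + - ((t / h) *\<^sub>R w')) \<partial>coord_lborel ?J)"
      by (intro nn_integral_cmult) measurable
    also have "(\<integral>\<^sup>+x. indicator B (x + - ((t / h) *\<^sub>R w')) \<partial>coord_lborel ?J) = (\<integral>\<^sup>+x. indicator B x \<partial>coord_lborel ?J)"
      by (intro nn_integral_coord_lborel_translate span_neg span_scale w') auto
    finally show "(\<integral>\<^sup>+x. indicator ?W (x + t *\<^sub>R e) \<partial>coord_lborel ?J)
        = emeasure (coord_lborel ?J) B * indicator {a * h<..b * h} t"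
      by (simp add: mult.commute)
  qed
  also have "\<dots> = emeasure (coord_lborel ?J) B * emeasure lborel {a * h<..b * h}"
    by (rule nn_integral_cmult_indicator) simp
  also have "emeasure lborel {a * h<..b * h} = ennreal ((b - a) * h)"
    using ab h0 by (simp add: mult_right_mono algebra_simps)
  finally show ?thesis by (simp add: h_def mult.commute)
qed

text \<open>Half-open, so that for \<open>0 < \<epsilon> < 1\<close> the shell over the whole
  frontier is exactly \<open>K\<close> minus its dilate by \<open>1 - \<epsilon>\<close>.\<close>

definition shell :: "real \<Rightarrow> 'a::real_vector set \<Rightarrow> 'a set" where
  "shell \<epsilon> T = (\<lambda>(x, t). t *\<^sub>R x) ` (T \<times> {1 - \<epsilon><..1})"

lemma shellE:
  assumes "y \<in> shell \<epsilon> T"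
  obtains x t where "x \<in> T" "y = t *\<^sub>R x" "1 - \<epsilon> < t" "t \<le> 1"
proof -
  from assms obtain z where z: "z \<in> T \<times> {1 - \<epsilon><..1}" "y = snd z *\<^sub>R fst z"
    unfolding shell_def case_prod_beta by blast
  show thesis by (rule that[of "fst z" "snd z"]) (use z in auto)
qed

section \<open>Small boundary pieces and the shells over them\<close>

context convex_body_zero
begin

text \<open>The first two terms bound the error between shell and cylinder in
  \<open>shell_estimate\<close>, the last one the relative variation of \<open>x \<bullet> u\<close>
  over a piece in \<open>support_integral_piece\<close>.\<close>

definition distortion :: real where
  "distortion = 4 * (1 + outradius / inradius) + 1 / inradius + (1 + outradius) / inradius"

lemma distortion_ge: "4 \<le> distortion"
  using inradius outradius by (simp add: distortion_def)

text \<open>Cutting the graph of normals, not the boundary itself, controls position and normal at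
  once.\<close>

definition piece :: "real \<Rightarrow> (real^'n) \<times> (real^'n) \<Rightarrow> (real^'n) set" where
  "piece \<epsilon> g = fst ` (normal_graph \<inter> cball g \<epsilon>)"

lemma compact_piece: "compact (piece \<epsilon> g)"
  unfolding piece_def
  by (intro compact_continuous_image continuous_intros compact_Int compact_normal_graph compact_cball)

lemma pieceE:
  assumes "x \<in> piece \<epsilon> (x0, u0)"
  obtains u where "x \<in> frontier K" "outer_unit_normal K x u" "norm (x - x0) \<le> \<epsilon>" "norm (u - u0) \<le> \<epsilon>"
proof -
  obtain u where u: "(x, u) \<in> normal_graph" "dist (x0, u0) (x, u) \<le> \<epsilon>"
    using assms by (auto simp: piece_def)
  then have "dist x0 x \<le> \<epsilon>" "dist u0 u \<le> \<epsilon>"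
    using dist_fst_le[of "(x0, u0)" "(x, u)"] dist_snd_le[of "(x0, u0)" "(x, u)"] by auto
  then show thesis using u(1) that by (auto simp: normal_graph_def dist_norm norm_minus_commute)
qed

lemma shell_subset: "0 \<le> \<epsilon> \<Longrightarrow> \<epsilon> \<le> 1 \<Longrightarrow> T \<subseteq> K \<Longrightarrow> shell \<epsilon> T \<subseteq> K"
proof
  fix y assume *: "0 \<le> \<epsilon>" "\<epsilon> \<le> 1" "T \<subseteq> K" "y \<in> shell \<epsilon> T"
  from *(4) obtain x t where "x \<in> T" "y = t *\<^sub>R x" "1 - \<epsilon> < t" "t \<le> 1" by (rule shellE)
  then have "x \<in> K" "y = t *\<^sub>R x" "0 \<le> t" "t \<le> 1" using * by auto
  then show "y \<in> K" using convexD[OF convex zero_in, of x "1 - t" t] by simp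
qed

lemma shell_borel:
  assumes \<epsilon>: "0 \<le> \<epsilon>" "\<epsilon> < 1" and T: "T \<in> sets borel" "T \<subseteq> frontier K"
  shows "shell \<epsilon> T \<in> sets borel"
  unfolding shell_def
proof (rule borel_injective_continuous_image)
  show "compact (frontier K \<times> {1 - \<epsilon>..1})" using compact by (intro compact_Times compact_frontier) auto
  show "continuous_on (frontier K \<times> {1 - \<epsilon>..1}) (\<lambda>(x, t). t *\<^sub>R x)"
    unfolding case_prod_beta by (intro continuous_intros)
  show "inj_on (\<lambda>(x, t). t *\<^sub>R x) (frontier K \<times> {1 - \<epsilon>..1})"
  proof (rule inj_onI, clarify)
    fix x s y t assume "x \<in> frontier K" "y \<in> frontier K" "s \<in> {1 - \<epsilon>..1}" "t \<in> {1 - \<epsilon>..1}" "s *\<^sub>R x = t *\<^sub>R y"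
    then show "x = y \<and> s = t" using \<epsilon> by (intro normal_frontier_unique_ray) auto
  qed
  show "T \<times> {1 - \<epsilon><..1} \<in> sets borel" using T by (intro borel_Times) auto
  show "T \<times> {1 - \<epsilon><..1} \<subseteq> frontier K \<times> {1 - \<epsilon>..1}" using T by auto
qed

text \<open>
  On a small piece of the boundary, projection along one of its normals is almost isometric, by
  monotonicity of the normals; so is the comparison of the shell with an oblique cylinder.
\<close>

lemma shell_estimate:
  assumes g: "(x0, u0) \<in> normal_graph" and \<epsilon>: "0 < \<epsilon>" "distortion * \<epsilon> \<le> 1 / 2"
    and T: "T \<in> sets borel" "T \<subseteq> piece \<epsilon> (x0, u0)"
  shows "ennreal ((1 - distortion * \<epsilon>) ^ (2 * CARD('n)))
        * (ennreal (\<epsilon> * (x0 \<bullet> u0)) * hausdorff_measure (CARD('n) - 1) T) \<le> emeasure lborel (shell \<epsilon> T)"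
    and "ennreal ((1 - distortion * \<epsilon>) ^ (2 * CARD('n))) * emeasure lborel (shell \<epsilon> T)
        \<le> ennreal (\<epsilon> * (x0 \<bullet> u0)) * hausdorff_measure (CARD('n) - 1) T"
proof -
  let ?n = "CARD('n)" and ?H = "hausdorff_measure (CARD('n) - 1)"
  define \<eta> where "\<eta> = distortion * \<epsilon>"
  define q where "q = 1 - \<eta>"
  define h where "h = x0 \<bullet> u0"
  have x0: "x0 \<in> frontier K" and u0: "outer_unit_normal K x0 u0" using g by (auto simp: normal_graph_def)
  have hr: "inradius \<le> h" unfolding h_def by (rule normal_inner_ge[OF u0])
  have h: "0 < h" using hr inradius by simp
  have "4 * \<epsilon> \<le> \<eta>" unfolding \<eta>_def using \<epsilon> by (intro mult_right_mono distortion_ge) simp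
  then have \<epsilon>8: "\<epsilon> \<le> 1 / 8" "\<epsilon> \<le> \<eta>" using \<epsilon> by (simp_all add: \<eta>_def[symmetric])
  have \<eta>: "0 < \<eta>" "\<eta> \<le> 1 / 2" using \<epsilon> \<epsilon>8 by (simp_all add: \<eta>_def)
  have q: "0 < q" "q \<le> 1" using \<eta> by (simp_all add: q_def)
  have TF: "T \<subseteq> frontier K" using T(2) by (auto elim: pieceE)
  have nu0: "norm u0 = 1" using u0 by (simp add: outer_unit_normal_def)
  obtain e :: "real^'n" where e: "e \<in> Basis" using nonempty_Basis by blast
  then have ne: "norm e = 1" and ee: "e \<bullet> e = 1" by (simp_all add: inner_Basis)
  \<comment> \<open>Rotating \<open>u0\<close> to a basis vector puts the projection into a
    coordinate hyperplane, where Hausdorff and Lebesgue measure agree.\<close>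
  obtain f where f: "orthogonal_transformation f" and fu: "f u0 = e"
    using orthogonal_transformation_exists_1[OF nu0 ne] by metis
  interpret f: linear f using f by (rule orthogonal_transformation_linear)
  have fin: "f x \<bullet> f y = x \<bullet> y" for x y using f by (simp add: orthogonal_transformation_def)
  have fn: "norm (f x) = norm x" for x using f by (rule orthogonal_transformation_norm)
  define \<pi> where "\<pi> x = f x - (x \<bullet> u0) *\<^sub>R e" for x
  have fe: "f x \<bullet> e = x \<bullet> u0" for x using fin[of x u0] by (simp add: fu)
  have \<pi>e: "\<pi> x \<bullet> e = 0" for x by (simp add: \<pi>_def inner_diff_left fe ee)
  have \<pi>diff: "\<pi> x - \<pi> y = \<pi> (x - y)" for x y by (simp add: \<pi>_def f.diff algebra_simps inner_diff_left)
  have \<pi>norm: "(norm (\<pi> x))\<^sup>2 + (x \<bullet> u0)\<^sup>2 = (norm x)\<^sup>2" for x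
  proof -
    have "orthogonal (\<pi> x) ((x \<bullet> u0) *\<^sub>R e)" by (simp add: orthogonal_def \<pi>e)
    then have "(norm (\<pi> x + (x \<bullet> u0) *\<^sub>R e))\<^sup>2 = (norm (\<pi> x))\<^sup>2 + (norm ((x \<bullet> u0) *\<^sub>R e))\<^sup>2"
      by (rule norm_add_Pythagorean)
    then show ?thesis by (simp add: \<pi>_def fn ne)
  qed
  \<comment> \<open>A normal \<open>v\<close> at \<open>y\<close> within \<open>\<epsilon>\<close>
    of \<open>u0\<close> has \<open>(x - y) \<bullet> v \<le> 0\<close>, and replacing
    \<open>v\<close> by \<open>u0\<close> costs at most \<open>\<epsilon> * norm (x - y)\<close>;
    exchanging \<open>x\<close> and \<open>y\<close> gives the other sign.\<close>
  have flat: "\<bar>(x - y) \<bullet> u0\<bar> \<le> \<epsilon> * norm (x - y)" if x: "x \<in> piece \<epsilon> (x0, u0)" and y: "y \<in> piece \<epsilon> (x0, u0)" for x y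
  proof -
    have half: "(x - y) \<bullet> u0 \<le> \<epsilon> * norm (x - y)" if x: "x \<in> piece \<epsilon> (x0, u0)" and y: "y \<in> piece \<epsilon> (x0, u0)" for x y
    proof -
      obtain v where v: "outer_unit_normal K y v" "norm (v - u0) \<le> \<epsilon>" using y by (rule pieceE)
      have "x \<in> K" using x frontier_subset by (auto elim: pieceE)
      then have "(x - y) \<bullet> v \<le> 0" using v(1) by (auto simp: outer_unit_normal_def inner_diff_left)
      moreover have "(x - y) \<bullet> (u0 - v) \<le> norm (x - y) * norm (u0 - v)" by (rule norm_cauchy_schwarz)
      moreover have "norm (x - y) * norm (u0 - v) \<le> norm (x - y) * \<epsilon>"
        using v(2) by (intro mult_left_mono) (auto simp: norm_minus_commute)
      ultimately show ?thesis by (simp add: inner_diff_right mult.commute)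
    qed
    have "- ((x - y) \<bullet> u0) = (y - x) \<bullet> u0" by (simp add: inner_diff_left)
    then show ?thesis using half[OF x y] half[OF y x] by (simp add: abs_le_iff norm_minus_commute)
  qed
  have \<pi>le: "dist (\<pi> x) (\<pi> y) \<le> dist x y" for x y
  proof (rule power2_le_imp_le)
    show "(dist (\<pi> x) (\<pi> y))\<^sup>2 \<le> (dist x y)\<^sup>2"
      unfolding dist_norm \<pi>diff using \<pi>norm[of "x - y"] zero_le_power2[of "(x - y) \<bullet> u0"] by linarith
  qed simp
  have \<pi>ge: "q * dist x y \<le> dist (\<pi> x) (\<pi> y)" "dist x y \<le> 2 * dist (\<pi> x) (\<pi> y)"
    if x: "x \<in> piece \<epsilon> (x0, u0)" and y: "y \<in> piece \<epsilon> (x0, u0)" for x y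
  proof -
    have "((x - y) \<bullet> u0)\<^sup>2 \<le> (\<epsilon> * norm (x - y))\<^sup>2"
      using flat[OF x y] \<epsilon> by (subst abs_le_square_iff[symmetric]) simp
    then have "(1 - \<epsilon>\<^sup>2) * (norm (x - y))\<^sup>2 \<le> (norm (\<pi> (x - y)))\<^sup>2"
      using \<pi>norm[of "x - y"] by (simp add: power_mult_distrib algebra_simps)
    moreover have "(1 - \<epsilon>)\<^sup>2 \<le> 1 - \<epsilon>\<^sup>2"
      using \<epsilon> \<epsilon>8 by (simp add: power2_eq_square algebra_simps)
    then have "(1 - \<epsilon>)\<^sup>2 * (norm (x - y))\<^sup>2 \<le> (1 - \<epsilon>\<^sup>2) * (norm (x - y))\<^sup>2" by (rule mult_right_mono) simp
    ultimately have "((1 - \<epsilon>) * norm (x - y))\<^sup>2 \<le> (norm (\<pi> (x - y)))\<^sup>2" by (simp add: power_mult_distrib)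
    then have *: "(1 - \<epsilon>) * dist x y \<le> dist (\<pi> x) (\<pi> y)"
      unfolding dist_norm \<pi>diff by (rule power2_le_imp_le) simp
    have "q * dist x y \<le> (1 - \<epsilon>) * dist x y" using \<epsilon>8 by (intro mult_right_mono) (auto simp: q_def)
    with * show "q * dist x y \<le> dist (\<pi> x) (\<pi> y)" by simp
    have "(1 / 2) * dist x y \<le> (1 - \<epsilon>) * dist x y" using \<epsilon>8 by (intro mult_right_mono) auto
    with * show "dist x y \<le> 2 * dist (\<pi> x) (\<pi> y)" by simp
  qed
  \<comment> \<open>\<open>\<Phi>\<close> parametrizes the shell, \<open>\<Psi>\<close> the oblique
    cylinder over the projection with the fixed axis \<open>f x0\<close>.\<close>
  define \<Phi> where "\<Phi> = (\<lambda>(x, t). t *\<^sub>R x :: real^'n)"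
  define \<Psi> where "\<Psi> = (\<lambda>(x, t). \<pi> x + t *\<^sub>R f x0)"
  have fx0e: "f x0 \<bullet> e = h" by (simp add: fe h_def)
  have close: "\<bar>dist (\<Phi> a) (\<Phi> b) - dist (\<Psi> a) (\<Psi> b)\<bar> \<le> \<eta> * dist (\<Psi> a) (\<Psi> b)"
    if ab: "a \<in> piece \<epsilon> (x0, u0) \<times> {1 - \<epsilon>..1}" "b \<in> piece \<epsilon> (x0, u0) \<times> {1 - \<epsilon>..1}" for a b
  proof -
    obtain x s y t where a: "a = (x, s)" and b: "b = (y, t)" by (cases a, cases b)
    have x: "x \<in> piece \<epsilon> (x0, u0)" and y: "y \<in> piece \<epsilon> (x0, u0)" and st: "\<bar>t - 1\<bar> \<le> \<epsilon>"
      using ab by (auto simp: a b)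
    define \<Delta> where "\<Delta> = f (s *\<^sub>R x - t *\<^sub>R y)"
    define \<Delta>' where "\<Delta>' = \<pi> x - \<pi> y + (s - t) *\<^sub>R f x0"
    have D: "dist (\<Phi> a) (\<Phi> b) = norm \<Delta>" "dist (\<Psi> a) (\<Psi> b) = norm \<Delta>'"
      by (simp_all add: \<Phi>_def \<Psi>_def a b \<Delta>_def \<Delta>'_def dist_norm fn algebra_simps)
    \<comment> \<open>Three sources of error: the piece is not flat, its axis is \<open>f x\<close>
      and not \<open>f x0\<close>, and its base is scaled by \<open>t\<close> and not by 1.\<close>
    have "\<Delta> - \<Delta>' = ((x - y) \<bullet> u0) *\<^sub>R e + (s - t) *\<^sub>R f (x - x0) + (t - 1) *\<^sub>R f (x - y)"
      by (simp add: \<Delta>_def \<Delta>'_def \<pi>_def f.diff f.scaleR inner_diff_left algebra_simps)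
    then have "norm (\<Delta> - \<Delta>') \<le> \<bar>(x - y) \<bullet> u0\<bar> + \<bar>s - t\<bar> * norm (x - x0) + \<bar>t - 1\<bar> * norm (x - y)"
      using norm_triangle_ineq[of "((x - y) \<bullet> u0) *\<^sub>R e + (s - t) *\<^sub>R f (x - x0)" "(t - 1) *\<^sub>R f (x - y)"]
        norm_triangle_ineq[of "((x - y) \<bullet> u0) *\<^sub>R e" "(s - t) *\<^sub>R f (x - x0)"]
      by (simp add: ne fn)
    also have "\<dots> \<le> \<epsilon> * norm (x - y) + \<bar>s - t\<bar> * \<epsilon> + \<epsilon> * norm (x - y)"
      using flat[OF x y] st x by (intro add_mono mult_mono) (auto elim: pieceE)
    also have "\<dots> = \<epsilon> * (2 * norm (x - y) + \<bar>s - t\<bar>)" by (simp add: algebra_simps)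
    finally have E: "norm (\<Delta> - \<Delta>') \<le> \<epsilon> * (2 * norm (x - y) + \<bar>s - t\<bar>)" .
    \<comment> \<open>The component along \<open>e\<close> controls \<open>s - t\<close>, because
      the axis has height \<open>h\<close>, at least \<open>inradius\<close>.\<close>
    have "\<Delta>' \<bullet> e = (s - t) * h" by (simp add: \<Delta>'_def inner_add_left inner_diff_left \<pi>e fx0e)
    then have "\<bar>s - t\<bar> * h \<le> norm \<Delta>'"
      using Basis_le_norm[OF e, of \<Delta>'] h by (simp add: abs_mult)
    moreover have "\<bar>s - t\<bar> * inradius \<le> \<bar>s - t\<bar> * h" using hr by (intro mult_left_mono) auto
    ultimately have st': "\<bar>s - t\<bar> \<le> norm \<Delta>' / inradius"
      using inradius by (simp add: pos_le_divide_eq)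
    have "\<pi> x - \<pi> y = \<Delta>' - (s - t) *\<^sub>R f x0" by (simp add: \<Delta>'_def)
    then have "norm (\<pi> x - \<pi> y) \<le> norm \<Delta>' + \<bar>s - t\<bar> * norm x0"
      using norm_triangle_ineq4[of \<Delta>' "(s - t) *\<^sub>R f x0"] by (simp add: fn)
    also have "\<dots> \<le> norm \<Delta>' + norm \<Delta>' / inradius * outradius"
      using st' outradius x0 frontier_subset inradius by (intro add_mono mult_mono) auto
    finally have "norm (x - y) \<le> 2 * (norm \<Delta>' + norm \<Delta>' / inradius * outradius)"
      using \<pi>ge(2)[OF x y] by (simp add: dist_norm)
    then have "2 * norm (x - y) + \<bar>s - t\<bar> \<le> 4 * (norm \<Delta>' + norm \<Delta>' / inradius * outradius) + norm \<Delta>' / inradius"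
      using st' by simp
    also have "\<dots> \<le> distortion * norm \<Delta>'"
    proof -
      have "0 \<le> (1 + outradius) / inradius * norm \<Delta>'" using inradius outradius by simp
      then show ?thesis unfolding distortion_def by (simp add: algebra_simps)
    qed
    finally have "\<epsilon> * (2 * norm (x - y) + \<bar>s - t\<bar>) \<le> \<epsilon> * (distortion * norm \<Delta>')"
      using \<epsilon> by (intro mult_left_mono) auto
    with E have "norm (\<Delta> - \<Delta>') \<le> \<eta> * norm \<Delta>'" by (simp add: \<eta>_def mult_ac)
    moreover have "\<bar>norm \<Delta> - norm \<Delta>'\<bar> \<le> norm (\<Delta> - \<Delta>')" by (rule norm_triangle_ineq3)
    ultimately show ?thesis by (simp add: D)
  qed
  have c1: "q * dist (\<Psi> a) (\<Psi> b) \<le> dist (\<Phi> a) (\<Phi> b)" and c2: "q * dist (\<Phi> a) (\<Phi> b) \<le> dist (\<Psi> a) (\<Psi> b)"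
    if ab: "a \<in> piece \<epsilon> (x0, u0) \<times> {1 - \<epsilon>..1}" "b \<in> piece \<epsilon> (x0, u0) \<times> {1 - \<epsilon>..1}" for a b
  proof -
    define d where "d = dist (\<Psi> a) (\<Psi> b)"
    have c: "\<bar>dist (\<Phi> a) (\<Phi> b) - d\<bar> \<le> \<eta> * d" using close[OF ab] by (simp add: d_def)
    then show "q * dist (\<Psi> a) (\<Psi> b) \<le> dist (\<Phi> a) (\<Phi> b)"
      by (simp add: q_def d_def[symmetric] algebra_simps abs_le_iff)
    have "dist (\<Phi> a) (\<Phi> b) \<le> (1 + \<eta>) * d" using c by (simp add: algebra_simps abs_le_iff)
    \<comment> \<open>As \<open>q * (1 + \<eta>) \<le> 1\<close>, the one factor \<open>q\<close>
      serves both directions.\<close>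
    then have "q * dist (\<Phi> a) (\<Phi> b) \<le> q * ((1 + \<eta>) * d)" using q by (intro mult_left_mono) auto
    also have "\<dots> = d - \<eta>\<^sup>2 * d" by (simp add: q_def power2_eq_square algebra_simps)
    also have "\<dots> \<le> d" by (simp add: d_def)
    finally show "q * dist (\<Phi> a) (\<Phi> b) \<le> dist (\<Psi> a) (\<Psi> b)" by (simp add: d_def)
  qed
  let ?P = "T \<times> {1 - \<epsilon><..1}"
  have P: "?P \<subseteq> piece \<epsilon> (x0, u0) \<times> {1 - \<epsilon>..1}" using T by auto
  have \<pi>cont: "continuous_on A \<pi>" for A
  proof (rule continuous_onI)
    fix x \<delta> assume "0 < (\<delta>::real)"
    then show "\<exists>d>0. \<forall>x'\<in>A. dist x' x < d \<longrightarrow> dist (\<pi> x') (\<pi> x) \<le> \<delta>"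
      using \<pi>le by (meson less_imp_le order_trans)
  qed
  have Tb: "\<pi> ` T \<in> sets borel"
  proof (rule borel_injective_continuous_image[OF compact_piece \<pi>cont _ T])
    show "inj_on \<pi> (piece \<epsilon> (x0, u0))"
    proof (rule inj_onI)
      fix x y assume "x \<in> piece \<epsilon> (x0, u0)" "y \<in> piece \<epsilon> (x0, u0)" "\<pi> x = \<pi> y"
      then show "x = y" using \<pi>ge(2)[of x y] by simp
    qed
  qed
  have Wb: "\<Psi> ` ?P \<in> sets borel"
  proof (rule borel_injective_continuous_image)
    show "compact (piece \<epsilon> (x0, u0) \<times> {1 - \<epsilon>..1})" by (intro compact_Times compact_piece) auto
    show "continuous_on (piece \<epsilon> (x0, u0) \<times> {1 - \<epsilon>..1}) \<Psi>"
      unfolding \<Psi>_def case_prod_beta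
      by (intro continuous_intros continuous_on_compose2[OF \<pi>cont[of UNIV]]) auto
    show "inj_on \<Psi> (piece \<epsilon> (x0, u0) \<times> {1 - \<epsilon>..1})"
    proof (rule inj_onI)
      fix a b assume ab: "a \<in> piece \<epsilon> (x0, u0) \<times> {1 - \<epsilon>..1}" "b \<in> piece \<epsilon> (x0, u0) \<times> {1 - \<epsilon>..1}" "\<Psi> a = \<Psi> b"
      then have "\<Phi> a = \<Phi> b" using c2[OF ab(1,2)] q by (simp add: mult_le_0_iff)
      then show "a = b"
        using ab \<epsilon>8 \<epsilon> normal_frontier_unique_ray[of "fst a" "fst b" "snd a" "snd b"]
        by (auto simp: \<Phi>_def prod_eq_iff elim!: pieceE)
    qed
    show "?P \<in> sets borel" using T by (intro borel_Times) auto
  qed (rule P)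
  have cpt\<pi>: "compact (\<pi> ` piece \<epsilon> (x0, u0))" by (intro compact_continuous_image compact_piece \<pi>cont)
  have \<pi>bd: "bounded (\<pi> ` T)"
    by (rule bounded_subset[OF compact_imp_bounded[OF cpt\<pi>]]) (use T in auto)
  have "Basis - {e} \<subseteq> Basis" by auto
  from span_substd_basis[OF this]
  have "span (Basis - {e}) = {x. \<forall>i\<in>Basis. i \<notin> Basis - {e} \<longrightarrow> x \<bullet> i = 0}" .
  then have "x \<in> span (Basis - {e}) \<longleftrightarrow> x \<bullet> e = 0" for x using e by auto
  then have \<pi>sp: "\<pi> ` T \<subseteq> span (Basis - {e})" using \<pi>e by blast
  have Wimg: "\<Psi> ` ?P = (\<lambda>(z, s). z + s *\<^sub>R f x0) ` (\<pi> ` T \<times> {1 - \<epsilon><..1})"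
  proof -
    have "\<pi> ` T \<times> {1 - \<epsilon><..1} = (\<lambda>z. (\<pi> (fst z), snd z)) ` ?P" by force
    then show ?thesis by (simp add: \<Psi>_def image_image case_prod_beta)
  qed
  have Dimg: "\<Phi> ` ?P = shell \<epsilon> T" by (simp add: \<Phi>_def shell_def)
  have Db: "shell \<epsilon> T \<in> sets borel" using \<epsilon> \<epsilon>8 T TF by (intro shell_borel) auto
  have Dbd: "bounded (shell \<epsilon> T)"
    using \<epsilon> \<epsilon>8 TF frontier_subset by (intro bounded_subset[OF bounded shell_subset]) auto
  have Wbd: "bounded (\<Psi> ` ?P)"
  proof -
    have "compact ((\<lambda>z. \<Psi> z) ` (piece \<epsilon> (x0, u0) \<times> {1 - \<epsilon>..1}))"
      unfolding \<Psi>_def case_prod_beta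
      by (intro compact_continuous_image compact_Times compact_piece continuous_intros
          continuous_on_compose2[OF \<pi>cont[of UNIV]]) auto
    then show ?thesis using P by (intro bounded_subset[OF compact_imp_bounded]) auto
  qed
  have cardJ: "card (Basis - {e}) = ?n - 1" using e by simp
  let ?l = "emeasure lborel"
  define c where "c = ennreal (\<epsilon> * h)"
  have lW: "?l (\<Psi> ` ?P) = c * ?H (\<pi> ` T)"
  proof -
    have "?l (\<Psi> ` ?P) = ennreal ((1 - (1 - \<epsilon>)) * (f x0 \<bullet> e)) * emeasure (coord_lborel (Basis - {e})) (\<pi> ` T)"
      unfolding Wimg using e Tb \<pi>sp h \<epsilon> Wb[unfolded Wimg]
      by (intro emeasure_oblique_cylinder) (auto simp: fx0e)
    also have "emeasure (coord_lborel (Basis - {e})) (\<pi> ` T) = ?H (\<pi> ` T)"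
      unfolding cardJ[symmetric] by (intro hausdorff_measure_eq_coord_lborel[symmetric] Tb \<pi>bd \<pi>sp) auto
    finally show ?thesis by (simp add: fx0e c_def)
  qed
  have q1: "ennreal (q ^ (?n - 1)) * ?H T \<le> ?H (\<pi> ` T)"
    using hausdorff_measure_compare[OF q(1), of T "\<lambda>x. x" \<pi> "?n - 1"] \<pi>ge(1) T by auto
  have q2: "?H (\<pi> ` T) \<le> ?H T"
    using hausdorff_measure_compare[of 1 T \<pi> "\<lambda>x. x" "?n - 1"] \<pi>le by simp
  have q3: "ennreal (q ^ ?n) * ?l (\<Psi> ` ?P) \<le> ?l (shell \<epsilon> T)"
    using hausdorff_measure_compare[OF q(1), of ?P \<Psi> \<Phi> ?n] c1 P
    unfolding Dimg hausdorff_measure_eq_lborel[OF Wb Wbd] hausdorff_measure_eq_lborel[OF Db Dbd] by blast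
  have q4: "ennreal (q ^ ?n) * ?l (shell \<epsilon> T) \<le> ?l (\<Psi> ` ?P)"
    using hausdorff_measure_compare[OF q(1), of ?P \<Phi> \<Psi> ?n] c2 P
    unfolding Dimg hausdorff_measure_eq_lborel[OF Wb Wbd] hausdorff_measure_eq_lborel[OF Db Dbd] by blast
  \<comment> \<open>One factor \<open>q ^ ?n\<close> is for the comparison of volumes, the other
    absorbs the loss \<open>q ^ (?n - 1)\<close> under projection.\<close>
  have Q2: "ennreal (q ^ (2 * ?n)) = ennreal (q ^ ?n) * ennreal (q ^ ?n)"
    using q by (simp add: mult_2 power_add ennreal_mult)
  have Q1: "ennreal (q ^ ?n) \<le> ennreal (q ^ (?n - 1))" using q by (intro ennreal_leI power_decreasing) auto
  have Q0: "ennreal (q ^ ?n) * x \<le> x" for x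
    using mult_right_mono[of "ennreal (q ^ ?n)" 1 x] q by (simp add: power_le_one)
  have "ennreal (q ^ (2 * ?n)) * (c * ?H T) = ennreal (q ^ ?n) * (c * (ennreal (q ^ ?n) * ?H T))"
    unfolding Q2 by (simp only: mult_ac)
  also have "\<dots> \<le> ennreal (q ^ ?n) * (c * ?H (\<pi> ` T))"
    by (intro mult_left_mono order_trans[OF mult_right_mono[OF Q1] q1]) auto
  also have "\<dots> \<le> ?l (shell \<epsilon> T)" using q3 by (simp add: lW)
  finally show "ennreal ((1 - distortion * \<epsilon>) ^ (2 * ?n)) * (ennreal (\<epsilon> * (x0 \<bullet> u0)) * ?H T) \<le> ?l (shell \<epsilon> T)"
    by (simp add: c_def h_def q_def \<eta>_def)
  have "ennreal (q ^ (2 * ?n)) * ?l (shell \<epsilon> T) \<le> ennreal (q ^ ?n) * ?l (shell \<epsilon> T)"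
    using Q0[of "ennreal (q ^ ?n) * ?l (shell \<epsilon> T)"] unfolding Q2 mult.assoc .
  also have "\<dots> \<le> c * ?H (\<pi> ` T)" using q4 by (simp add: lW)
  also have "\<dots> \<le> c * ?H T" by (intro mult_left_mono q2) simp
  finally show "ennreal ((1 - distortion * \<epsilon>) ^ (2 * ?n)) * ?l (shell \<epsilon> T) \<le> ennreal (\<epsilon> * (x0 \<bullet> u0)) * ?H T"
    by (simp add: c_def h_def q_def \<eta>_def)
qed

end

section \<open>The integral of the support function\<close>

context convex_body_zero
begin

lemma bdd_above_inner: "bdd_above ((\<lambda>x. x \<bullet> u) ` K)"
proof (rule bdd_aboveI2)
  fix x assume "x \<in> K"
  then have "norm x * norm u \<le> outradius * norm u" using outradius by (intro mult_right_mono) auto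
  then show "x \<bullet> u \<le> outradius * norm u" using norm_cauchy_schwarz[of x u] by linarith
qed

lemma support_fun_le: "support_fun K u \<le> support_fun K v + outradius * norm (u - v)"
  unfolding support_fun_def[of K u]
proof (rule cSUP_least)
  fix x assume x: "x \<in> K"
  have "x \<bullet> u = x \<bullet> v + x \<bullet> (u - v)" by (simp add: inner_diff_right)
  also have "x \<bullet> v \<le> support_fun K v"
    unfolding support_fun_def by (rule cSUP_upper[OF x bdd_above_inner])
  also have "x \<bullet> (u - v) \<le> norm x * norm (u - v)" by (rule norm_cauchy_schwarz)
  also have "\<dots> \<le> outradius * norm (u - v)" using outradius x by (intro mult_right_mono) auto
  finally show "x \<bullet> u \<le> support_fun K v + outradius * norm (u - v)" by simp
qed (use zero_in in blast)

lemma continuous_on_support_fun: "continuous_on A (support_fun K)"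
proof (rule continuous_onI)
  fix x e assume e: "0 < (e::real)"
  have "dist (support_fun K y) (support_fun K x) \<le> e" if "dist y x < e / outradius" for y
  proof -
    have "outradius * norm (y - x) \<le> e"
      using that outradius(1) by (simp add: dist_norm field_simps)
    then show ?thesis
      using support_fun_le[of y x] support_fun_le[of x y] by (simp add: dist_real_def norm_minus_commute abs_le_iff)
  qed
  then show "\<exists>d>0. \<forall>x'\<in>A. dist x' x < d \<longrightarrow> dist (support_fun K x') (support_fun K x) \<le> e"
    using e outradius(1) by (intro exI[of _ "e / outradius"]) auto
qed

lemma borel_measurable_support_fun [measurable]: "support_fun K \<in> borel_measurable borel"
  by (intro borel_measurable_continuous_onI continuous_on_support_fun)

lemma shell_frontier:
  assumes \<epsilon>: "0 < \<epsilon>" "\<epsilon> < 1"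
  shows "shell \<epsilon> (frontier K) = K - (\<lambda>x. (1 - \<epsilon>) *\<^sub>R x) ` K"
proof (intro equalityI subsetI)
  fix y assume y: "y \<in> shell \<epsilon> (frontier K)"
  then obtain x t where x: "x \<in> frontier K" and t: "y = t *\<^sub>R x" "1 - \<epsilon> < t" "t \<le> 1" by (rule shellE)
  have "y \<noteq> (1 - \<epsilon>) *\<^sub>R z" if z: "z \<in> K" for z
  proof
    assume eq: "y = (1 - \<epsilon>) *\<^sub>R z"
    obtain u where u: "outer_unit_normal K x u" using normal_exists[OF x] by blast
    have pos: "0 < x \<bullet> u" using normal_inner_ge[OF u] inradius by simp
    have "(1 - \<epsilon>) * (z \<bullet> u) = t * (x \<bullet> u)" using t(1) eq by (metis inner_scaleR_left)
    moreover have "(1 - \<epsilon>) * (z \<bullet> u) \<le> (1 - \<epsilon>) * (x \<bullet> u)"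
      using u z \<epsilon> by (auto simp: outer_unit_normal_def)
    ultimately have "t * (x \<bullet> u) \<le> (1 - \<epsilon>) * (x \<bullet> u)" by simp
    then show False using pos t by simp
  qed
  moreover have "y \<in> K" using subsetD[OF shell_subset[OF _ _ frontier_subset] y] \<epsilon> by simp
  ultimately show "y \<in> K - (\<lambda>x. (1 - \<epsilon>) *\<^sub>R x) ` K" by blast
next
  fix y assume y: "y \<in> K - (\<lambda>x. (1 - \<epsilon>) *\<^sub>R x) ` K"
  have "y \<noteq> 0" using y zero_in by (metis Diff_iff image_eqI scaleR_zero_right)
  then obtain d where d: "0 < d" "0 + d *\<^sub>R y \<in> frontier K"
    using ray_to_frontier[OF bounded zero_interior] by metis
  obtain u where u: "outer_unit_normal K (d *\<^sub>R y) u" using normal_exists d by auto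
  have "y \<bullet> u \<le> d * (y \<bullet> u)" using u y by (auto simp: outer_unit_normal_def)
  moreover have "0 < d * (y \<bullet> u)" using normal_inner_ge[OF u] inradius by simp
  ultimately have d1: "1 \<le> d" using d(1) by (simp add: zero_less_mult_iff)
  \<comment> \<open>Otherwise \<open>y\<close> divided by \<open>1 - \<epsilon>\<close> would lie
    between 0 and the frontier point \<open>d *\<^sub>R y\<close>, hence in \<open>K\<close>, and
    \<open>y\<close> in the removed dilate.\<close>
  have "1 - \<epsilon> < 1 / d"
  proof (rule ccontr)
    assume "\<not> 1 - \<epsilon> < 1 / d"
    then have le: "1 / ((1 - \<epsilon>) * d) \<le> 1" using d \<epsilon> by (simp add: field_simps)
    define z where "z = (1 / ((1 - \<epsilon>) * d)) *\<^sub>R (d *\<^sub>R y)"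
    have "z \<in> K"
      using convexD[OF convex zero_in, of "d *\<^sub>R y" "1 - 1 / ((1 - \<epsilon>) * d)" "1 / ((1 - \<epsilon>) * d)"]
        d frontier_subset le \<epsilon> by (auto simp: z_def)
    moreover have "y = (1 - \<epsilon>) *\<^sub>R z" using d \<epsilon> by (simp add: z_def)
    ultimately show False using y by blast
  qed
  then have "(d *\<^sub>R y, 1 / d) \<in> frontier K \<times> {1 - \<epsilon><..1}" using d d1 by simp
  then show "y \<in> shell \<epsilon> (frontier K)"
    unfolding shell_def by (rule rev_image_eqI) (use d in simp)
qed

lemma emeasure_lborel_body: "emeasure lborel K = ennreal (measure lebesgue K)"
proof -
  have "K \<in> sets borel" using closed by (rule borel_closed)
  then have "measure lebesgue K = measure lborel K" by (simp add: measure_completion)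
  moreover have "emeasure lborel K < \<infinity>" using bounded by (rule emeasure_bounded_finite)
  ultimately show ?thesis by (simp add: emeasure_eq_ennreal_measure)
qed

lemma emeasure_shell_frontier:
  assumes \<epsilon>: "0 < \<epsilon>" "\<epsilon> < 1"
  shows "emeasure lborel (shell \<epsilon> (frontier K)) = ennreal ((1 - (1 - \<epsilon>) ^ CARD('n)) * measure lebesgue K)"
proof -
  let ?S = "(\<lambda>x. (1 - \<epsilon>) *\<^sub>R x) ` K"
  have S: "?S \<subseteq> K"
  proof clarify
    fix x assume "x \<in> K"
    then show "(1 - \<epsilon>) *\<^sub>R x \<in> K" using convexD[OF convex zero_in, of x \<epsilon> "1 - \<epsilon>"] \<epsilon> by simp
  qed
  have cS: "compact ?S" by (intro compact_continuous_image continuous_intros compact)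
  then have bS: "?S \<in> sets borel" by (intro borel_closed compact_imp_closed)
  have "emeasure lborel ?S = emeasure lebesgue ?S" using bS by simp
  also have "\<dots> = \<bar>1 - \<epsilon>\<bar> ^ DIM(real^'n) * emeasure lebesgue K"
    using emeasure_lebesgue_affine[of "1 - \<epsilon>" 0 K] by simp
  also have "emeasure lebesgue K = emeasure lborel K" using closed by (simp add: borel_closed)
  finally have eS: "emeasure lborel ?S = ennreal ((1 - \<epsilon>) ^ CARD('n) * measure lebesgue K)"
    using \<epsilon> by (simp add: emeasure_lborel_body ennreal_mult)
  have "emeasure lborel (K - ?S) = emeasure lborel K - emeasure lborel ?S"
    using closed bS S by (intro emeasure_Diff) (auto simp: eS borel_closed)
  also have "\<dots> = ennreal (measure lebesgue K - (1 - \<epsilon>) ^ CARD('n) * measure lebesgue K)"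
    using \<epsilon> by (simp add: eS emeasure_lborel_body ennreal_minus)
  finally show ?thesis by (simp add: shell_frontier[OF \<epsilon>] left_diff_distrib)
qed

lemma finite_piece_cover:
  assumes "0 < \<epsilon>"
  shows "\<exists>(N::nat) g. (\<forall>i<N. g i \<in> normal_graph) \<and> frontier K \<subseteq> (\<Union>i<N. piece \<epsilon> (g i))"
proof -
  obtain k where k: "finite k" "k \<subseteq> normal_graph" "normal_graph \<subseteq> (\<Union>g\<in>k. ball g \<epsilon>)"
    using seq_compact_imp_totally_bounded[OF compact_imp_seq_compact[OF compact_normal_graph], rule_format, OF assms]
    by (elim exE conjE) (rule that)
  obtain g where g: "bij_betw g {0..<card k} k" using ex_bij_betw_nat_finite[OF k(1)] by blast
  have img: "g ` {..<card k} = k" using g by (simp add: bij_betw_def lessThan_atLeast0)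
  have "x \<in> (\<Union>i<card k. piece \<epsilon> (g i))" if x: "x \<in> frontier K" for x
  proof -
    obtain u where "outer_unit_normal K x u" using normal_exists[OF x] by blast
    then have xu: "(x, u) \<in> normal_graph" using x by (simp add: normal_graph_def)
    from subsetD[OF k(3) xu] obtain z where z: "z \<in> k" "(x, u) \<in> ball z \<epsilon>" by (rule UN_E)
    have "z \<in> g ` {..<card k}" using z(1) by (simp only: img)
    then obtain i where "i < card k" "z = g i" by auto
    with z(2) have "i < card k" "(x, u) \<in> ball (g i) \<epsilon>" by simp_all
    then have "x \<in> piece \<epsilon> (g i)" using xu unfolding piece_def by (intro image_eqI[of _ _ "(x, u)"]) auto
    then show ?thesis using \<open>i < card k\<close> by blast
  qed
  moreover have "\<forall>i<card k. g i \<in> normal_graph" using img k(2) by blast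
  ultimately show ?thesis by blast
qed

definition support_integral :: ennreal where
  "support_integral = (\<integral>\<^sup>+u. ennreal (support_fun K u) \<partial>surface_area_measure K)"

text \<open>Change of variables along the Gauss map: the support function in the direction of a
  normal at \<open>x\<close> is attained at \<open>x\<close>.\<close>

lemma support_integral_eq:
  "support_integral = (\<integral>\<^sup>+x. ennreal (x \<bullet> gauss_map x) * indicator regular_points x \<partial>hausdorff_borel (CARD('n) - 1))"
proof -
  have m: "(\<lambda>u. ennreal (support_fun K u)) \<in> borel_measurable (restrict_space borel (sphere 0 1))"
    by (intro measurable_restrict_space1) measurable
  have "support_integral = (\<integral>\<^sup>+x. ennreal (support_fun K (gauss_map x))
      \<partial>restrict_space (hausdorff_borel (CARD('n) - 1)) regular_points)"
    unfolding support_integral_def surface_area_measure_eq_distr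
    by (subst nn_integral_distr[OF measurable_gauss_map_hausdorff]) (use m in simp_all)
  also have "\<dots> = (\<integral>\<^sup>+x. ennreal (support_fun K (gauss_map x)) * indicator regular_points x
      \<partial>hausdorff_borel (CARD('n) - 1))"
    by (rule nn_integral_restrict_space) simp
  also have "\<dots> = (\<integral>\<^sup>+x. ennreal (x \<bullet> gauss_map x) * indicator regular_points x \<partial>hausdorff_borel (CARD('n) - 1))"
    using support_fun_normal[OF _ gauss_map_normal]
    by (intro nn_integral_cong) (auto simp: indicator_def regular_points_def)
  finally show ?thesis .
qed

lemma measurable_support_integrand:
  "(\<lambda>x. ennreal (x \<bullet> gauss_map x) * indicator regular_points x) \<in> borel_measurable (hausdorff_borel s)"
proof -
  have "gauss_map \<in> borel_measurable (restrict_space (hausdorff_borel s) regular_points)"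
    using measurable_gauss_map_hausdorff by (simp add: measurable_restrict_space2_iff)
  moreover have "(\<lambda>x. x) \<in> borel_measurable (restrict_space (hausdorff_borel s) regular_points)"
    by (rule measurable_restrict_space1) simp
  ultimately have "(\<lambda>x. ennreal (x \<bullet> gauss_map x)) \<in> borel_measurable (restrict_space (hausdorff_borel s) regular_points)"
    by (intro measurable_compose[OF _ measurable_ennreal] borel_measurable_inner)
  then show ?thesis
    by (subst (asm) borel_measurable_restrict_space_iff_ennreal) auto
qed

text \<open>On a piece \<open>x \<bullet> u\<close> differs from \<open>x0 \<bullet> u0\<close> by
  at most \<open>(1 + outradius) * \<epsilon>\<close>, which is small relative to the lower bound
  \<open>inradius\<close> of both.\<close>

lemma support_integral_piece:
  assumes g: "(x0, u0) \<in> normal_graph" and \<epsilon>: "0 < \<epsilon>" "distortion * \<epsilon> \<le> 1 / 2"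
    and T: "T \<in> sets borel" "T \<subseteq> piece \<epsilon> (x0, u0)"
  defines "I \<equiv> (\<integral>\<^sup>+x. (ennreal (x \<bullet> gauss_map x) * indicator regular_points x) * indicator T x \<partial>hausdorff_borel (CARD('n) - 1))"
  shows "ennreal (1 - distortion * \<epsilon>) * (ennreal (x0 \<bullet> u0) * hausdorff_measure (CARD('n) - 1) T) \<le> I"
    and "ennreal (1 - distortion * \<epsilon>) * I \<le> ennreal (x0 \<bullet> u0) * hausdorff_measure (CARD('n) - 1) T"
proof -
  let ?H = "hausdorff_measure (CARD('n) - 1)" and ?M = "hausdorff_borel (CARD('n) - 1) :: (real^'n) measure"
  define q where "q = 1 - distortion * \<epsilon>"
  define h where "h = x0 \<bullet> u0"
  have q: "0 < q" using \<epsilon> by (simp add: q_def)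
  have u0: "outer_unit_normal K x0 u0" and x0: "x0 \<in> frontier K" using g by (auto simp: normal_graph_def)
  have h: "inradius \<le> h" unfolding h_def by (rule normal_inner_ge[OF u0])
  have near: "q * h \<le> x \<bullet> gauss_map x \<and> q * (x \<bullet> gauss_map x) \<le> h"
    if x: "x \<in> T" "x \<in> regular_points" for x
  proof -
    obtain u where u: "outer_unit_normal K x u" "norm (x - x0) \<le> \<epsilon>" "norm (u - u0) \<le> \<epsilon>"
      using subsetD[OF T(2) x(1)] by (rule pieceE)
    have gu: "gauss_map x = u" by (rule gauss_map_unique[OF x(2) u(1)])
    have nu: "norm u = 1" using u(1) by (simp add: outer_unit_normal_def)
    have "x \<bullet> u - h = (x - x0) \<bullet> u + x0 \<bullet> (u - u0)"
      by (simp add: h_def inner_diff_left inner_diff_right)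
    then have "\<bar>x \<bullet> u - h\<bar> \<le> \<bar>(x - x0) \<bullet> u\<bar> + \<bar>x0 \<bullet> (u - u0)\<bar>" by simp
    also have "\<dots> \<le> norm (x - x0) * norm u + norm x0 * norm (u - u0)"
      by (intro add_mono Cauchy_Schwarz_ineq2)
    also have "\<dots> \<le> \<epsilon> * 1 + outradius * \<epsilon>"
      using u nu outradius x0 frontier_subset \<epsilon> by (intro add_mono mult_mono) auto
    also have "\<dots> = ((1 + outradius) / inradius * \<epsilon>) * inradius"
      using inradius by (simp add: field_simps)
    also have "\<dots> \<le> (distortion * \<epsilon>) * inradius"
      using \<epsilon> inradius outradius by (intro mult_right_mono) (auto simp: distortion_def)
    finally have *: "\<bar>x \<bullet> u - h\<bar> \<le> (distortion * \<epsilon>) * inradius" .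
    have "inradius \<le> x \<bullet> u" by (rule normal_inner_ge[OF u(1)])
    then have "(distortion * \<epsilon>) * inradius \<le> (distortion * \<epsilon>) * (x \<bullet> u)"
      "(distortion * \<epsilon>) * inradius \<le> (distortion * \<epsilon>) * h"
      using \<epsilon> h distortion_ge by (auto intro!: mult_left_mono)
    with * show ?thesis unfolding gu q_def by (simp add: abs_le_iff algebra_simps)
  qed
  have TR: "T \<inter> regular_points \<in> sets borel" using T(1) by simp
  have "T \<subseteq> frontier K" using T(2) by (auto elim: pieceE)
  then have "T \<subseteq> (T \<inter> regular_points) \<union> singular_points" by (auto simp: regular_points_def)
  then have "?H T \<le> ?H (T \<inter> regular_points) + ?H singular_points"
    by (meson hausdorff_measure_mono hausdorff_measure_Un order_trans)
  then have HT: "?H T = emeasure ?M (T \<inter> regular_points)"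
    using hausdorff_measure_mono[of "T \<inter> regular_points" T] hausdorff_measure_singular_points
    by (simp add: emeasure_hausdorff_borel[OF TR] antisym)
  have "ennreal q * (ennreal h * ?H T) = (\<integral>\<^sup>+x. ennreal (q * h) * indicator (T \<inter> regular_points) x \<partial>?M)"
    unfolding HT using q h inradius TR by (subst nn_integral_cmult_indicator) (auto simp: ennreal_mult mult.assoc)
  also have "\<dots> \<le> I"
    unfolding I_def using near by (intro nn_integral_mono) (auto simp: indicator_def intro: ennreal_leI)
  finally show "ennreal (1 - distortion * \<epsilon>) * (ennreal (x0 \<bullet> u0) * ?H T) \<le> I"
    by (simp add: q_def h_def)
  have "ennreal q * I = (\<integral>\<^sup>+x. ennreal q * ((ennreal (x \<bullet> gauss_map x) * indicator regular_points x) * indicator T x) \<partial>?M)"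
    unfolding I_def using T(1)
    by (intro nn_integral_cmult[symmetric] borel_measurable_times_ennreal measurable_support_integrand) auto
  also have "\<dots> \<le> (\<integral>\<^sup>+x. ennreal h * indicator (T \<inter> regular_points) x \<partial>?M)"
    using near q by (intro nn_integral_mono) (auto simp: indicator_def ennreal_mult'[symmetric] intro: ennreal_leI)
  also have "\<dots> = ennreal h * ?H T"
    unfolding HT using TR by (subst nn_integral_cmult_indicator) auto
  finally show "ennreal (1 - distortion * \<epsilon>) * I \<le> ennreal (x0 \<bullet> u0) * ?H T"
    by (simp add: q_def h_def)
qed

text \<open>Both quantities are compared with the same sum, \<epsilon> times
  \<open>x0 \<bullet> u0\<close> times boundary measure over a finite partition. The shells account
  for \<open>2 * CARD('n)\<close> factors, the integrals for one more.\<close>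

lemma support_integral_shell_bounds:
  assumes \<epsilon>: "0 < \<epsilon>" "distortion * \<epsilon> \<le> 1 / 2"
  defines "Q \<equiv> ennreal ((1 - distortion * \<epsilon>) ^ (2 * CARD('n) + 1))"
    and "V \<equiv> emeasure lborel (shell \<epsilon> (frontier K))"
  shows "Q * (ennreal \<epsilon> * support_integral) \<le> V" and "Q * V \<le> ennreal \<epsilon> * support_integral"
proof -
  let ?n = "CARD('n)" and ?H = "hausdorff_measure (CARD('n) - 1)" and ?M = "hausdorff_borel (CARD('n) - 1) :: (real^'n) measure"
  let ?l = "emeasure lborel"
  define q where "q = 1 - distortion * \<epsilon>"
  have q: "0 < q" using \<epsilon> by (simp add: q_def)
  define q1 where "q1 = ennreal q"
  define q2 where "q2 = ennreal (q ^ (2 * ?n))"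
  have Q: "Q = q1 * q2" using q by (simp add: Q_def q1_def q2_def q_def[symmetric] ennreal_mult)
  have "4 * \<epsilon> \<le> distortion * \<epsilon>" using \<epsilon> by (intro mult_right_mono distortion_ge) simp
  from order_trans[OF this \<epsilon>(2)] have \<epsilon>1: "\<epsilon> < 1" by simp
  obtain N :: nat and g where gN: "\<And>i. i < N \<Longrightarrow> g i \<in> normal_graph" and cov: "frontier K \<subseteq> (\<Union>i<N. piece \<epsilon> (g i))"
    using finite_piece_cover[OF \<epsilon>(1)] by metis
  define T where "T i = disjointed (\<lambda>i. piece \<epsilon> (g i)) i" for i
  have Tb: "T i \<in> sets borel" for i
    unfolding T_def disjointed_def
    by (intro sets.Diff sets.finite_UN borel_closed compact_imp_closed compact_piece) auto
  have Tp: "T i \<subseteq> piece \<epsilon> (g i)" for i unfolding T_def by (rule disjointed_subset)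
  have Tdis: "disjoint_family T" unfolding T_def by (rule disjoint_family_disjointed)
  have pF: "piece \<epsilon> (g i) \<subseteq> frontier K" for i by (auto simp: piece_def normal_graph_def)
  have "(\<Union>i<N. T i) = (\<Union>i<N. piece \<epsilon> (g i))"
    unfolding T_def using finite_UN_disjointed_eq[of "\<lambda>i. piece \<epsilon> (g i)" N] by (simp add: lessThan_atLeast0)
  moreover have "(\<Union>i<N. piece \<epsilon> (g i)) \<subseteq> frontier K" using pF by (rule UN_least)
  ultimately have TU: "(\<Union>i<N. T i) = frontier K" using cov by simp
  define c where "c i = ennreal (fst (g i) \<bullet> snd (g i)) * ?H (T i)" for i
  define J where "J i = (\<integral>\<^sup>+x. (ennreal (x \<bullet> gauss_map x) * indicator regular_points x) * indicator (T i) x \<partial>?M)" for i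
  have pos: "0 \<le> fst (g i) \<bullet> snd (g i)" if "i < N" for i
    using gN[OF that] normal_inner_ge[of "fst (g i)" "snd (g i)"] inradius by (auto simp: normal_graph_def case_prod_beta)
  have J: "q1 * c i \<le> J i" "q1 * J i \<le> c i" if "i < N" for i
    using support_integral_piece[of "fst (g i)" "snd (g i)" \<epsilon> "T i"] gN[OF that] \<epsilon> Tb Tp
    by (simp_all add: q1_def q_def c_def J_def)
  have L: "q2 * (ennreal \<epsilon> * c i) \<le> ?l (shell \<epsilon> (T i))" "q2 * ?l (shell \<epsilon> (T i)) \<le> ennreal \<epsilon> * c i" if "i < N" for i
    using shell_estimate[of "fst (g i)" "snd (g i)" \<epsilon> "T i"] gN[OF that] \<epsilon> Tb Tp pos[OF that]
    by (simp_all add: q2_def q_def c_def ennreal_mult mult.assoc)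
  have V: "V = (\<Sum>i<N. ?l (shell \<epsilon> (T i)))"
  proof -
    have "shell \<epsilon> (frontier K) = (\<Union>i<N. shell \<epsilon> (T i))"
      unfolding TU[symmetric] shell_def by blast
    moreover have "disjoint_family_on (\<lambda>i. shell \<epsilon> (T i)) {..<N}"
      unfolding disjoint_family_on_def
    proof (intro ballI impI)
      fix i j :: nat assume "i \<noteq> j"
      show "shell \<epsilon> (T i) \<inter> shell \<epsilon> (T j) = {}"
      proof (rule equals0I, elim IntE)
        fix y assume "y \<in> shell \<epsilon> (T i)" "y \<in> shell \<epsilon> (T j)"
        then obtain x s x' s' where *: "x \<in> T i" "x' \<in> T j" "y = s *\<^sub>R x" "y = s' *\<^sub>R x'" "1 - \<epsilon> < s" "1 - \<epsilon> < s'"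
          by (metis shellE)
        then have "x = x' \<and> s = s'" using Tp pF \<epsilon>1 by (intro normal_frontier_unique_ray) (auto simp: subset_iff)
        then show False using * Tdis \<open>i \<noteq> j\<close> by (auto simp: disjoint_family_on_def)
      qed
    qed
    moreover have "shell \<epsilon> (T i) \<in> sets borel" for i
      using Tb order_trans[OF Tp pF] \<epsilon> \<epsilon>1 by (intro shell_borel) simp_all
    ultimately show ?thesis unfolding V_def by (subst sum_emeasure) auto
  qed
  have I: "support_integral = (\<Sum>i<N. J i)"
  proof -
    have "support_integral = (\<integral>\<^sup>+x. (\<Sum>i<N. (ennreal (x \<bullet> gauss_map x) * indicator regular_points x) * indicator (T i) x) \<partial>?M)"
      unfolding support_integral_eq
    proof (rule nn_integral_cong)
      fix x
      have "(\<Sum>i<N. indicator (T i) x :: ennreal) = indicator (\<Union>i<N. T i) x"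
        using Tdis by (intro indicator_UN_disjoint[symmetric]) (auto simp: disjoint_family_on_def)
      then have "(\<Sum>i<N. indicator (T i) x :: ennreal) = indicator (frontier K) x" by (simp add: TU)
      then show "ennreal (x \<bullet> gauss_map x) * indicator regular_points x
          = (\<Sum>i<N. (ennreal (x \<bullet> gauss_map x) * indicator regular_points x) * indicator (T i) x)"
        unfolding sum_distrib_left[symmetric] by (auto simp: indicator_def regular_points_def)
    qed
    also have "\<dots> = (\<Sum>i<N. J i)"
      unfolding J_def using Tb
      by (intro nn_integral_sum borel_measurable_times_ennreal measurable_support_integrand) auto
    finally show ?thesis .
  qed
  have "Q * (ennreal \<epsilon> * support_integral) = q2 * (ennreal \<epsilon> * (\<Sum>i<N. q1 * J i))"
    unfolding Q I sum_distrib_left[symmetric] by (simp only: mult_ac)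
  also have "\<dots> \<le> q2 * (ennreal \<epsilon> * (\<Sum>i<N. c i))"
    using J by (intro mult_left_mono sum_mono) auto
  also have "\<dots> = (\<Sum>i<N. q2 * (ennreal \<epsilon> * c i))" by (simp add: sum_distrib_left)
  also have "\<dots> \<le> V" unfolding V using L by (intro sum_mono) auto
  finally show "Q * (ennreal \<epsilon> * support_integral) \<le> V" .
  have "Q * V = q1 * (\<Sum>i<N. q2 * ?l (shell \<epsilon> (T i)))"
    unfolding Q V sum_distrib_left[symmetric] by (simp only: mult_ac)
  also have "\<dots> \<le> q1 * (\<Sum>i<N. ennreal \<epsilon> * c i)"
    using L by (intro mult_left_mono sum_mono) auto
  also have "\<dots> = ennreal \<epsilon> * (\<Sum>i<N. q1 * c i)"
    unfolding sum_distrib_left[symmetric] by (simp only: mult_ac)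
  also have "\<dots> \<le> ennreal \<epsilon> * support_integral"
    unfolding I using J by (intro mult_left_mono sum_mono) auto
  finally show "Q * V \<le> ennreal \<epsilon> * support_integral" .
qed

text \<open>The two-sided bounds are divided by \<epsilon>. As \<epsilon> tends to 0 the factor
  tends to 1, and the quotient of the shell volume to the derivative of
  \<open>1 - (1 - \<epsilon>) ^ CARD('n)\<close> at 0 times the volume of \<open>K\<close>.\<close>

theorem support_integral_volume: "support_integral = ennreal (real CARD('n) * measure lebesgue K)"
proof -
  let ?n = "CARD('n)"
  define v where "v = measure lebesgue K"
  define D where "D = distortion"
  have D4: "4 \<le> D" unfolding D_def by (rule distortion_ge)
  define Q where "Q \<epsilon> = (1 - D * \<epsilon>) ^ (2 * ?n + 1)" for \<epsilon>
  define V where "V \<epsilon> = (1 - (1 - \<epsilon>) ^ ?n) * v" for \<epsilon>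
  have small: "\<epsilon> < 1 \<and> 0 < Q \<epsilon> \<and> 0 \<le> V \<epsilon>" if "0 < \<epsilon>" "D * \<epsilon> \<le> 1 / 2" for \<epsilon>
  proof -
    have "4 * \<epsilon> \<le> D * \<epsilon>" using that D4 by (intro mult_right_mono) auto
    from order_trans[OF this that(2)] have "\<epsilon> < 1" by simp
    moreover have "(1 - \<epsilon>) ^ ?n \<le> 1" using that \<open>\<epsilon> < 1\<close> by (intro power_le_one) auto
    ultimately show ?thesis using that by (auto simp: Q_def V_def v_def)
  qed
  have bnd: "ennreal (Q \<epsilon>) * (ennreal \<epsilon> * support_integral) \<le> ennreal (V \<epsilon>)"
    "ennreal (Q \<epsilon>) * ennreal (V \<epsilon>) \<le> ennreal \<epsilon> * support_integral"
    if \<epsilon>: "0 < \<epsilon>" "D * \<epsilon> \<le> 1 / 2" for \<epsilon>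
    using support_integral_shell_bounds[of \<epsilon>] emeasure_shell_frontier[of \<epsilon>] small[OF \<epsilon>] \<epsilon>
    by (simp_all add: Q_def V_def v_def D_def)
  \<comment> \<open>A single admissible \<epsilon> bounds the integral by a finite shell volume;
    afterwards the limits are taken in the reals.\<close>
  have "support_integral \<noteq> \<infinity>"
  proof
    assume inf: "support_integral = \<infinity>"
    have \<epsilon>: "0 < 1 / (2 * D)" "D * (1 / (2 * D)) \<le> 1 / 2" using D4 by simp_all
    then have "ennreal (1 / (2 * D)) * support_integral = \<infinity>"
      unfolding inf using D4 by (simp add: ennreal_mult_eq_top_iff)
    then have "ennreal (Q (1 / (2 * D))) * \<infinity> \<le> ennreal (V (1 / (2 * D)))"
      using bnd(1)[OF \<epsilon>] by metis
    then show False using small[OF \<epsilon>] by (simp add: ennreal_mult_top top_unique)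
  qed
  then obtain i where i: "support_integral = ennreal i" "0 \<le> i"
    by (cases support_integral) (auto simp: top_ennreal_def)
  have ev: "\<forall>\<^sub>F \<epsilon> in at_right 0. 0 < \<epsilon> \<and> D * \<epsilon> \<le> 1 / 2"
    unfolding eventually_at_right_field using D4 by (intro exI[of _ "1 / (2 * D)"]) (auto simp: field_simps)
  have quot: "((\<lambda>\<epsilon>. V \<epsilon> / \<epsilon>) \<longlongrightarrow> real ?n * v) (at_right 0)"
  proof -
    have "((\<lambda>\<epsilon>. (1 - (1 - \<epsilon>) ^ ?n) * v) has_real_derivative real ?n * v) (at 0)"
      by (auto intro!: derivative_eq_intros)
    then have "((\<lambda>\<epsilon>. V \<epsilon> / \<epsilon>) \<longlongrightarrow> real ?n * v) (at 0)"
      unfolding has_field_derivative_iff V_def by simp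
    then show ?thesis by (rule tendsto_mono[rotated]) (simp add: at_le)
  qed
  have Qlim: "(Q \<longlongrightarrow> 1) (at_right 0)"
  proof -
    have "(Q \<longlongrightarrow> (1 - D * 0) ^ (2 * ?n + 1)) (at_right 0)"
      unfolding Q_def by (intro tendsto_intros)
    then show ?thesis by simp
  qed
  have "i = real ?n * v"
  proof (rule antisym)
    have "((\<lambda>\<epsilon>. Q \<epsilon> * i) \<longlongrightarrow> 1 * i) (at_right 0)" by (intro tendsto_intros Qlim)
    moreover have "\<forall>\<^sub>F \<epsilon> in at_right 0. Q \<epsilon> * i \<le> V \<epsilon> / \<epsilon>"
      using ev
    proof eventually_elim
      fix \<epsilon> assume \<epsilon>: "0 < \<epsilon> \<and> D * \<epsilon> \<le> 1 / 2"
      then have "ennreal (Q \<epsilon> * (\<epsilon> * i)) \<le> ennreal (V \<epsilon>)"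
        using bnd(1)[of \<epsilon>] small[of \<epsilon>] i by (simp add: ennreal_mult)
      then have "Q \<epsilon> * (\<epsilon> * i) \<le> V \<epsilon>" using small[of \<epsilon>] \<epsilon> by (simp add: ennreal_le_iff)
      then show "Q \<epsilon> * i \<le> V \<epsilon> / \<epsilon>" using \<epsilon> by (simp add: field_simps)
    qed
    ultimately show "i \<le> real ?n * v" using tendsto_le[OF _ quot] by force
    have "((\<lambda>\<epsilon>. Q \<epsilon> * (V \<epsilon> / \<epsilon>)) \<longlongrightarrow> 1 * (real ?n * v)) (at_right 0)" by (intro tendsto_mult Qlim quot)
    moreover have "\<forall>\<^sub>F \<epsilon> in at_right 0. Q \<epsilon> * (V \<epsilon> / \<epsilon>) \<le> i"
      using ev
    proof eventually_elim
      fix \<epsilon> assume \<epsilon>: "0 < \<epsilon> \<and> D * \<epsilon> \<le> 1 / 2"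
      then have "ennreal (Q \<epsilon> * V \<epsilon>) \<le> ennreal (\<epsilon> * i)"
        using bnd(2)[of \<epsilon>] small[of \<epsilon>] i by (simp add: ennreal_mult)
      then have "Q \<epsilon> * V \<epsilon> \<le> \<epsilon> * i" using i \<epsilon> by (simp add: ennreal_le_iff)
      then show "Q \<epsilon> * (V \<epsilon> / \<epsilon>) \<le> i" using \<epsilon> by (simp add: field_simps)
    qed
    ultimately show "real ?n * v \<le> i" by (intro tendsto_upperbound) auto
  qed
  then show ?thesis by (simp add: i v_def)
qed

end

section \<open>Power means and the geominimal functionals\<close>

text \<open>With \<open>t = exp s\<close> the two sides are the integrals of
  \<open>exp (q * x)\<close> and \<open>exp (p * x)\<close> over \<open>x\<close> from 0 to
  \<open>s\<close>, whence the sign analysis of \<open>G\<close>. This one pointwise inequality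
  covers every sign pattern of the exponents.\<close>

lemma powr_secant_mono:
  fixes t p q :: real
  assumes t: "0 < t" and pq: "q < p" "p \<noteq> 0" "q \<noteq> 0"
  shows "(t powr q - 1) / q \<le> (t powr p - 1) / p"
proof -
  define G where "G s = (exp (p * s) - 1) / p - (exp (q * s) - 1) / q" for s
  have G': "(G has_real_derivative exp (p * s) - exp (q * s)) (at s)" for s
    unfolding G_def using pq by (auto intro!: derivative_eq_intros)
  have "0 \<le> G s" for s
  proof (cases "0 \<le> s")
    case True
    have "G 0 \<le> G s"
    proof (rule DERIV_nonneg_imp_nondecreasing[OF True])
      fix x :: real assume "0 \<le> x"
      then have "q * x \<le> p * x" using pq by (intro mult_right_mono) auto
      then show "\<exists>y. DERIV G x :> y \<and> 0 \<le> y" using G'[of x] by (intro exI conjI) auto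
    qed
    then show ?thesis by (simp add: G_def)
  next
    case False
    then have "s \<le> 0" by simp
    have "G 0 \<le> G s"
    proof (rule DERIV_nonpos_imp_nonincreasing[OF \<open>s \<le> 0\<close>])
      fix x :: real assume "x \<le> 0"
      then have "p * x \<le> q * x" using pq by (intro mult_right_mono_neg) auto
      then show "\<exists>y. DERIV G x :> y \<and> y \<le> 0" using G'[of x] by (intro exI conjI) auto
    qed
    then show ?thesis by (simp add: G_def)
  qed
  from this[of "ln t"] show ?thesis using t by (simp add: G_def powr_def mult.commute)
qed

text \<open>Once \<open>f\<close> is divided by its mean \<open>m\<close> of exponent
  \<open>q\<close>, the left side of the secant inequality has integral 0 against \<open>h\<close>.
  The right side then has nonnegative integral, which bounds the mean of exponent \<open>p\<close>
  from below.\<close>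

lemma power_mean_mono:
  fixes f h :: "'a \<Rightarrow> real"
  assumes pq: "q < p" "p \<noteq> 0" "q \<noteq> 0"
    and f: "\<And>x. x \<in> space M \<Longrightarrow> 0 < f x" and h: "\<And>x. x \<in> space M \<Longrightarrow> 0 \<le> h x"
    and int: "integrable M h" "integrable M (\<lambda>x. f x powr p * h x)" "integrable M (\<lambda>x. f x powr q * h x)"
    and pos: "0 < (\<integral>x. h x \<partial>M)" "0 < (\<integral>x. f x powr q * h x \<partial>M)" "0 < (\<integral>x. f x powr p * h x \<partial>M)"
  shows "((\<integral>x. f x powr q * h x \<partial>M) / (\<integral>x. h x \<partial>M)) powr (1 / q)
    \<le> ((\<integral>x. f x powr p * h x \<partial>M) / (\<integral>x. h x \<partial>M)) powr (1 / p)"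
proof -
  define W where "W = (\<integral>x. h x \<partial>M)"
  define P where "P = (\<integral>x. f x powr p * h x \<partial>M)"
  define Q where "Q = (\<integral>x. f x powr q * h x \<partial>M)"
  define m where "m = (Q / W) powr (1 / q)"
  have WPQ: "0 < W" "0 < P" "0 < Q" using pos by (simp_all add: W_def P_def Q_def)
  then have m: "0 < m" by (simp add: m_def)
  have mq: "m powr q = Q / W" using pq WPQ by (simp add: m_def powr_powr)
  have scale: "(f x / m) powr c * h x = (f x powr c * h x) / m powr c" if "x \<in> space M" for x c
    using f[OF that] m by (simp add: powr_divide)
  have "((Q / m powr q) - W) / q \<le> ((P / m powr p) - W) / p"
  proof -
    have eq: "(\<integral>x. ((f x powr c * h x) / m powr c - h x) / c \<partial>M) = ((\<integral>x. f x powr c * h x \<partial>M) / m powr c - W) / c"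
      if "integrable M (\<lambda>x. f x powr c * h x)" for c
      using that int(1) by (simp add: W_def)
    have "(\<integral>x. ((f x powr q * h x) / m powr q - h x) / q \<partial>M) \<le> (\<integral>x. ((f x powr p * h x) / m powr p - h x) / p \<partial>M)"
    proof (rule integral_mono)
      fix x assume x: "x \<in> space M"
      have "((f x / m) powr q - 1) / q * h x \<le> ((f x / m) powr p - 1) / p * h x"
        using f[OF x] m h[OF x] pq by (intro mult_right_mono powr_secant_mono) auto
      then show "((f x powr q * h x) / m powr q - h x) / q \<le> ((f x powr p * h x) / m powr p - h x) / p"
        using scale[OF x, of p] scale[OF x, of q] by (simp add: left_diff_distrib)
    qed (use int in \<open>auto intro!: Bochner_Integration.integrable_diff\<close>)
    then show ?thesis unfolding eq[OF int(2)] eq[OF int(3)] P_def Q_def .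
  qed
  then have le: "0 \<le> (P / m powr p - W) / p" using mq WPQ by simp
  have mp: "0 < m powr p" using m by simp
  have "m \<le> (P / W) powr (1 / p)"
  \<comment> \<open>For \<open>p < 0\<close> clearing the denominator reverses the inequality, and
    taking the power \<open>1 / p\<close> reverses it back.\<close>
  proof (cases "0 < p")
    case True
    then have "W \<le> P / m powr p" using le by (simp add: zero_le_divide_iff)
    then have "m powr p \<le> P / W" using WPQ mp by (simp add: pos_le_divide_eq mult.commute)
    then have "(m powr p) powr (1 / p) \<le> (P / W) powr (1 / p)" using True by (intro powr_mono2) auto
    then show ?thesis using True m by (simp add: powr_powr)
  next
    case False
    then have p: "p < 0" using pq by simp
    then have "P / m powr p \<le> W" using le by (simp add: zero_le_divide_iff)
    then have "P / W \<le> m powr p" using WPQ mp by (simp add: pos_divide_le_eq mult.commute)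
    then have "(m powr p) powr (1 / p) \<le> (P / W) powr (1 / p)" using p WPQ by (intro powr_mono2') auto
    then show ?thesis using p m by (simp add: powr_powr)
  qed
  then show ?thesis by (simp add: m_def P_def Q_def W_def)
qed

section \<open>Infima, suprema and real powers on the extended half-line\<close>

lemma INF_order_iso:
  fixes f :: "'a::complete_lattice \<Rightarrow> 'b::complete_lattice"
  assumes "mono f" "mono g" and fg: "\<And>x. f (g x) = x" and gf: "\<And>x. g (f x) = x"
  shows "f (INF i\<in>I. x i) = (INF i\<in>I. f (x i))"
proof (rule antisym)
  show "f (INF i\<in>I. x i) \<le> (INF i\<in>I. f (x i))"
    by (intro INF_greatest monoD[OF \<open>mono f\<close>] INF_lower)
  have "g (INF i\<in>I. f (x i)) \<le> (INF i\<in>I. x i)"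
  proof (rule INF_greatest)
    fix i assume "i \<in> I"
    then have "g (INF i\<in>I. f (x i)) \<le> g (f (x i))" by (intro monoD[OF \<open>mono g\<close>] INF_lower)
    then show "g (INF i\<in>I. f (x i)) \<le> x i" by (simp add: gf)
  qed
  from monoD[OF \<open>mono f\<close> this] show "(INF i\<in>I. f (x i)) \<le> f (INF i\<in>I. x i)" by (simp add: fg)
qed

lemma SUP_order_iso:
  fixes f :: "'a::complete_lattice \<Rightarrow> 'b::complete_lattice"
  assumes "mono f" "mono g" and fg: "\<And>x. f (g x) = x" and gf: "\<And>x. g (f x) = x"
  shows "f (SUP i\<in>I. x i) = (SUP i\<in>I. f (x i))"
proof (rule antisym)
  show "(SUP i\<in>I. f (x i)) \<le> f (SUP i\<in>I. x i)"
    by (intro SUP_least monoD[OF \<open>mono f\<close>] SUP_upper)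
  have "(SUP i\<in>I. x i) \<le> g (SUP i\<in>I. f (x i))"
  proof (rule SUP_least)
    fix i assume "i \<in> I"
    then have "g (f (x i)) \<le> g (SUP i\<in>I. f (x i))" by (intro monoD[OF \<open>mono g\<close>] SUP_upper)
    then show "x i \<le> g (SUP i\<in>I. f (x i))" by (simp add: gf)
  qed
  from monoD[OF \<open>mono f\<close> this] show "f (SUP i\<in>I. x i) \<le> (SUP i\<in>I. f (x i))" by (simp add: fg)
qed

lemma ennreal_inverse_antimono:
  assumes "x \<le> y" shows "inverse y \<le> inverse (x::ennreal)"
proof (cases "x = 0")
  case False
  then show ?thesis
    using assms by (cases x; cases y) (auto simp: top_unique inverse_ennreal intro!: ennreal_leI le_imp_inverse_le)
qed simp

lemma ennreal_inverse_inverse: "inverse (inverse x) = (x::ennreal)"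
proof (cases x)
  case (real r)
  then show ?thesis by (cases "r = 0") (simp_all add: inverse_ennreal)
qed simp

lemma inverse_SUP_ennreal: "inverse (SUP i\<in>I. x i) = (INF i\<in>I. inverse (x i :: ennreal))"
proof (rule antisym)
  show "inverse (SUP i\<in>I. x i) \<le> (INF i\<in>I. inverse (x i))"
    by (intro INF_greatest ennreal_inverse_antimono SUP_upper)
  have "(SUP i\<in>I. x i) \<le> inverse (INF i\<in>I. inverse (x i))"
  proof (rule SUP_least)
    fix i assume "i \<in> I"
    then have "inverse (inverse (x i)) \<le> inverse (INF i\<in>I. inverse (x i))"
      by (intro ennreal_inverse_antimono INF_lower)
    then show "x i \<le> inverse (INF i\<in>I. inverse (x i))"
      by (simp only: ennreal_inverse_inverse)
  qed
  from ennreal_inverse_antimono[OF this] show "(INF i\<in>I. inverse (x i)) \<le> inverse (SUP i\<in>I. x i)"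
    by (simp only: ennreal_inverse_inverse)
qed

lemma ennreal_powr_ennreal: "0 \<le> x \<Longrightarrow> ennreal_powr (ennreal x) a = ennreal (x powr a)"
  by (simp add: ennreal_powr_def)

lemma mono_ennreal_powr:
  assumes "0 < a" shows "mono (\<lambda>x. ennreal_powr x a)"
proof (rule monoI)
  fix x y :: ennreal assume "x \<le> y"
  then show "ennreal_powr x a \<le> ennreal_powr y a"
    using assms by (cases x; cases y) (auto simp: ennreal_powr_def top_unique intro!: ennreal_leI powr_mono2)
qed

lemma ennreal_powr_inverse_exponent:
  assumes "0 < a" "b * a = 1"
  shows "ennreal_powr (ennreal_powr x b) a = x"
proof -
  have "0 < b" using assms by (metis less_asym' not_one_less_zero zero_less_mult_pos2 zero_less_one)
  then show ?thesis using assms by (cases x) (auto simp: ennreal_powr_def powr_powr)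
qed

lemma ennreal_powr_INF:
  assumes "0 < a" shows "ennreal_powr (INF i\<in>I. x i) a = (INF i\<in>I. ennreal_powr (x i) a)"
  using assms
  by (intro INF_order_iso[where g = "\<lambda>x. ennreal_powr x (1 / a)"] mono_ennreal_powr ennreal_powr_inverse_exponent) auto

lemma ennreal_powr_SUP:
  assumes "0 < a" shows "ennreal_powr (SUP i\<in>I. x i) a = (SUP i\<in>I. ennreal_powr (x i) a)"
  using assms
  by (intro SUP_order_iso[where g = "\<lambda>x. ennreal_powr x (1 / a)"] mono_ennreal_powr ennreal_powr_inverse_exponent) auto

text \<open>At base 0 the identity would fail, because \<open>0 powr a\<close> is 0 whereas
  \<open>inverse 0\<close> is infinite.\<close>

lemma ennreal_powr_neg:
  assumes "0 < x" "a < 0" shows "ennreal_powr x a = inverse (ennreal_powr x (- a))"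
  using assms
  by (cases x) (auto simp: ennreal_powr_def powr_minus inverse_ennreal)

lemma divide_INF_ennreal:
  assumes "0 < c" shows "(INF i\<in>I. x i) / ennreal c = (INF i\<in>I. x i / ennreal c)"
proof (rule INF_order_iso[where g = "\<lambda>x. x * ennreal c"])
  show "mono (\<lambda>x. x / ennreal c)" by (intro monoI divide_right_mono_ennreal)
  show "mono (\<lambda>x. x * ennreal c)" by (intro monoI mult_right_mono) auto
  show "x * ennreal c / ennreal c = x" "x / ennreal c * ennreal c = x" for x
    using assms by (simp_all add: ennreal_mult_divide_eq ennreal_divide_times)
qed

lemma convex_bodies0_iff: "Q \<in> convex_bodies0 \<longleftrightarrow> convex_body_zero Q"
  using interior_subset by (auto simp: convex_bodies0_def convex_body_def convex_body_zero_def)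

section \<open>Mixed volumes and the normalized functionals\<close>

context convex_body_zero
begin

lemma support_fun_bounds:
  assumes "norm u = 1"
  shows "inradius \<le> support_fun K u" "support_fun K u \<le> outradius"
proof -
  have "inradius *\<^sub>R u \<in> K" using inradius assms by (intro subsetD[OF inradius(2)]) auto
  then have "(inradius *\<^sub>R u) \<bullet> u \<le> support_fun K u"
    unfolding support_fun_def by (rule cSUP_upper[OF _ bdd_above_inner])
  then show "inradius \<le> support_fun K u" using assms by (simp add: dot_square_norm)
  show "support_fun K u \<le> outradius"
    unfolding support_fun_def
  proof (rule cSUP_least)
    fix x assume "x \<in> K"
    then show "x \<bullet> u \<le> outradius" using norm_cauchy_schwarz[of x u] outradius(2)[of x] assms by simp
  qed (use zero_in in blast)
qed

lemma volume_pos: "0 < measure lebesgue K"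
proof -
  have "0 < measure lebesgue (cball (0::real^'n) inradius)" using content_cball_pos[OF inradius(1)] by (simp add: measure_completion)
  also have "\<dots> \<le> measure lebesgue K"
    using inradius(2) compact by (intro measure_mono_fmeasurable) (auto intro: lmeasurable_compact)
  finally show ?thesis .
qed

text \<open>Balls inside and around \<open>K\<close> become balls around and inside the polar body.
  The outer one matters too, since \<open>measure\<close> is 0 on sets of infinite volume.\<close>

lemma polar_volume_pos: "0 < measure lebesgue (polar_body K)"
proof -
  have "polar_body K = (\<Inter>x\<in>K. {y. x \<bullet> y \<le> 1})" by (auto simp: polar_body_def)
  also have "closed \<dots>" by (intro closed_INT ballI closed_Collect_le continuous_intros)
  finally have cl: "closed (polar_body K)" .
  have "polar_body K \<subseteq> cball 0 (1 / inradius)"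
  proof
    fix y assume y: "y \<in> polar_body K"
    show "y \<in> cball 0 (1 / inradius)"
    proof (cases "y = 0")
      case False
      have "(inradius / norm y) *\<^sub>R y \<in> K" using inradius False by (intro subsetD[OF inradius(2)]) auto
      then have "((inradius / norm y) *\<^sub>R y) \<bullet> y \<le> 1" using y by (auto simp: polar_body_def)
      then have "inradius * norm y \<le> 1" using False by (simp add: dot_square_norm power2_eq_square)
      then show ?thesis using inradius by (simp add: field_simps)
    qed (use inradius in simp)
  qed
  then have "compact (polar_body K)" using cl by (meson bounded_cball bounded_subset compact_eq_bounded_closed)
  then have lm: "polar_body K \<in> lmeasurable" by (rule lmeasurable_compact)
  have "cball 0 (1 / outradius) \<subseteq> polar_body K"
  proof
    fix y :: "real^'n" assume "y \<in> cball 0 (1 / outradius)"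
    then have y: "norm y \<le> 1 / outradius" by simp
    have "x \<bullet> y \<le> 1" if "x \<in> K" for x
    proof -
      have "x \<bullet> y \<le> norm x * norm y" by (rule norm_cauchy_schwarz)
      also have "\<dots> \<le> outradius * (1 / outradius)" using y outradius that by (intro mult_mono) auto
      finally show ?thesis using outradius(1) by simp
    qed
    then show "y \<in> polar_body K" by (simp add: polar_body_def)
  qed
  then have "measure lebesgue (cball (0::real^'n) (1 / outradius)) \<le> measure lebesgue (polar_body K)"
    using lm by (intro measure_mono_fmeasurable) auto
  moreover have "0 < measure lebesgue (cball (0::real^'n) (1 / outradius))"
    using content_cball_pos[of "1 / outradius"] outradius(1) by (simp add: measure_completion)
  ultimately show ?thesis by (rule less_le_trans[rotated])
qed

lemma space_surface_area_measure: "space (surface_area_measure K) = sphere 0 1"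
  and sets_surface_area_measure: "sets (surface_area_measure K) = sets (restrict_space borel (sphere 0 1))"
  by (simp_all add: surface_area_measure_eq_distr space_restrict_space)

lemma measurable_surface_area_measure: "f \<in> borel_measurable borel \<Longrightarrow> f \<in> borel_measurable (surface_area_measure K)"
  by (subst measurable_cong_sets[OF sets_surface_area_measure refl]) (rule measurable_restrict_space1)

text \<open>The support function is at least \<open>inradius\<close> on the sphere, so the volume
  identity bounds the total mass.\<close>

lemma finite_surface_area_measure: "finite_measure (surface_area_measure K)"
proof
  let ?S = "surface_area_measure K"
  have "ennreal inradius * emeasure ?S (space ?S) = (\<integral>\<^sup>+u. ennreal inradius \<partial>?S)" by simp
  also have "\<dots> \<le> support_integral"
    unfolding support_integral_def
    by (intro nn_integral_mono ennreal_leI support_fun_bounds) (simp add: space_surface_area_measure)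
  also have "\<dots> < \<infinity>" by (simp add: support_integral_volume)
  finally show "emeasure ?S (space ?S) \<noteq> \<infinity>"
    using inradius by (auto simp: ennreal_mult_eq_top_iff)
qed

lemma integral_support_fun:
  "integrable (surface_area_measure K) (support_fun K)"
  "(\<integral>u. support_fun K u \<partial>surface_area_measure K) = real CARD('n) * measure lebesgue K"
proof -
  let ?S = "surface_area_measure K"
  interpret S: finite_measure ?S by (rule finite_surface_area_measure)
  have m: "support_fun K \<in> borel_measurable ?S"
    by (intro measurable_surface_area_measure) measurable
  have nn: "0 \<le> support_fun K u" if "u \<in> space ?S" for u
    using support_fun_bounds(1)[of u] inradius that by (simp add: space_surface_area_measure)
  show "integrable ?S (support_fun K)"
    using support_fun_bounds(2) nn
    by (intro S.integrable_const_bound[where B = outradius] AE_I2 m) (simp add: space_surface_area_measure)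
  have "(\<integral>u. support_fun K u \<partial>?S) = enn2real support_integral"
    unfolding support_integral_def using nn by (intro integral_eq_nn_integral m AE_I2)
  then show "(\<integral>u. support_fun K u \<partial>?S) = real CARD('n) * measure lebesgue K"
    by (simp add: support_integral_volume)
qed

text \<open>The ratio of the support functions lies between positive constants on the sphere, so its
  powers are integrable for every \<open>p\<close>. Without integrability the Bochner integral would
  take the value 0.\<close>

lemma Lp_mixed_volume_weighted:
  assumes "convex_body_zero Q"
  shows "integrable (surface_area_measure K) (\<lambda>u. (support_fun Q u / support_fun K u) powr p * support_fun K u)"
    and "Lp_mixed_volume p K Q = (\<integral>u. (support_fun Q u / support_fun K u) powr p * support_fun K u \<partial>surface_area_measure K) / real CARD('n)"
    and "0 < Lp_mixed_volume p K Q"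
proof -
  interpret Q: convex_body_zero Q by (rule assms)
  let ?S = "surface_area_measure K"
  interpret S: finite_measure ?S by (rule finite_surface_area_measure)
  let ?f = "\<lambda>u. support_fun Q u / support_fun K u"
  define a where "a = Q.inradius / outradius"
  define b where "b = Q.outradius / inradius"
  have ab: "0 < a" "0 < b" using inradius outradius Q.inradius Q.outradius by (simp_all add: a_def b_def)
  have pos: "0 < support_fun K u" "0 < support_fun Q u" if "u \<in> space ?S" for u
    using that support_fun_bounds(1)[of u] Q.support_fun_bounds(1)[of u] inradius Q.inradius
    by (auto simp: space_surface_area_measure)
  have fb: "a \<le> ?f u" "?f u \<le> b" if "u \<in> space ?S" for u
    using that support_fun_bounds[of u] Q.support_fun_bounds[of u] inradius Q.inradius pos[OF that]
    unfolding a_def b_def by (auto simp: space_surface_area_measure intro!: frac_le)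
  \<comment> \<open>Minimum and maximum, because for negative \<open>p\<close> the power decreases
    in its base.\<close>
  define c where "c = min (a powr p) (b powr p)"
  define d where "d = max (a powr p) (b powr p)"
  have c: "0 < c" using ab by (simp add: c_def)
  have cd: "c \<le> ?f u powr p" "?f u powr p \<le> d" if "u \<in> space ?S" for u
    using fb[OF that] ab
    by (cases "0 \<le> p"; auto simp: c_def d_def min_le_iff_disj le_max_iff_disj intro: powr_mono2 powr_mono2')+
  have m: "(\<lambda>u. ?f u powr p * support_fun K u) \<in> borel_measurable ?S"
    by (intro measurable_surface_area_measure) measurable
  show int: "integrable ?S (\<lambda>u. ?f u powr p * support_fun K u)"
  proof (rule S.integrable_const_bound[where B = "d * outradius", OF _ m], rule AE_I2)
    fix u assume u: "u \<in> space ?S"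
    have "?f u powr p * support_fun K u \<le> d * outradius"
      using cd[OF u] c pos[OF u] support_fun_bounds(2)[of u] u
      by (intro mult_mono) (auto simp: space_surface_area_measure)
    then show "norm (?f u powr p * support_fun K u) \<le> d * outradius" using pos[OF u] by simp
  qed
  show V: "Lp_mixed_volume p K Q = (\<integral>u. ?f u powr p * support_fun K u \<partial>?S) / real CARD('n)"
    unfolding Lp_mixed_volume_def
  proof (simp, rule Bochner_Integration.integral_cong[OF refl])
    fix u assume "u \<in> space ?S"
    from pos[OF this] show "support_fun Q u powr p * support_fun K u powr (1 - p) = ?f u powr p * support_fun K u"
      by (simp add: powr_divide powr_diff)
  qed
  have "0 < c * (\<integral>u. support_fun K u \<partial>?S)"
    using c volume_pos by (simp add: integral_support_fun)
  also have "\<dots> = (\<integral>u. c * support_fun K u \<partial>?S)" by simp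
  also have "\<dots> \<le> (\<integral>u. ?f u powr p * support_fun K u \<partial>?S)"
    using integral_support_fun(1) int cd(1) pos
    by (intro integral_mono mult_right_mono) (auto intro: less_imp_le)
  finally show "0 < Lp_mixed_volume p K Q" by (simp add: V)
qed

definition normalized_functional :: "real \<Rightarrow> (real^'n) set \<Rightarrow> real" where
  "normalized_functional p Q =
     (Lp_mixed_volume p K Q / measure lebesgue K) powr (real CARD('n) / p)
       * (measure lebesgue (polar_body Q) / measure lebesgue K)"

lemma normalized_functional_pos: "convex_body_zero Q \<Longrightarrow> 0 < normalized_functional p Q"
  using Lp_mixed_volume_weighted(3)[of Q p] volume_pos convex_body_zero.polar_volume_pos[of Q]
  unfolding normalized_functional_def by (intro mult_pos_pos divide_pos_pos) simp_all

lemma normalized_functional_mono: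
  assumes Q: "convex_body_zero Q" and pq: "q < p" "p \<noteq> 0" "q \<noteq> 0"
  shows "normalized_functional q Q \<le> normalized_functional p Q"
proof -
  interpret Q: convex_body_zero Q by (rule Q)
  let ?S = "surface_area_measure K" and ?n = "real CARD('n)"
  let ?f = "\<lambda>u. support_fun Q u / support_fun K u"
  have pos: "0 < support_fun K u" "0 < support_fun Q u" if "u \<in> space ?S" for u
    using that support_fun_bounds(1)[of u] Q.support_fun_bounds(1)[of u] inradius Q.inradius
    by (auto simp: space_surface_area_measure)
  have I: "(\<integral>u. ?f u powr c * support_fun K u \<partial>?S) = ?n * Lp_mixed_volume c K Q" for c
    by (simp add: Lp_mixed_volume_weighted(2)[OF Q])
  have "(Lp_mixed_volume q K Q / measure lebesgue K) powr (1 / q) \<le> (Lp_mixed_volume p K Q / measure lebesgue K) powr (1 / p)"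
    using power_mean_mono[OF pq, of ?S ?f "support_fun K"] pos Lp_mixed_volume_weighted(1,3)[OF Q] volume_pos
      integral_support_fun
    by (simp add: I less_imp_le)
  then have "((Lp_mixed_volume q K Q / measure lebesgue K) powr (1 / q)) powr ?n
      \<le> ((Lp_mixed_volume p K Q / measure lebesgue K) powr (1 / p)) powr ?n"
    by (intro powr_mono2) auto
  then show ?thesis
    unfolding normalized_functional_def powr_powr
    by (intro mult_right_mono) (auto simp: measure_nonneg)
qed

text \<open>The exponents of the mixed volume and of the polar volume add up to 1, so the divisor
  |K| can be distributed over the two powers.\<close>

lemma geominimal_functional_normalized:
  assumes Q: "convex_body_zero Q" and p: "p \<noteq> 0" "real CARD('n) + p \<noteq> 0"
  shows "geominimal_functional p K Q / (real CARD('n) * measure lebesgue K)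
    = normalized_functional p Q powr (p / (real CARD('n) + p))"
proof -
  interpret Q: convex_body_zero Q by (rule Q)
  let ?n = "real CARD('n)"
  define v where "v = measure lebesgue K"
  define w where "w = Lp_mixed_volume p K Q"
  define y where "y = measure lebesgue (polar_body Q)"
  have pos: "0 < v" "0 < w" "0 < y"
    using volume_pos Lp_mixed_volume_weighted(3)[OF Q] Q.polar_volume_pos by (simp_all add: v_def w_def y_def)
  have e: "?n / p * (p / (?n + p)) = ?n / (?n + p)" using p by simp
  have "normalized_functional p Q powr (p / (?n + p)) = (w / v) powr (?n / (?n + p)) * (y / v) powr (p / (?n + p))"
    unfolding normalized_functional_def w_def[symmetric] v_def[symmetric] y_def[symmetric]
    using pos p(1) by (subst powr_mult) (simp_all add: powr_powr e)
  also have "\<dots> = w powr (?n / (?n + p)) * y powr (p / (?n + p)) / (v powr (?n / (?n + p)) * v powr (p / (?n + p)))"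
    using pos by (simp add: powr_divide)
  also have "v powr (?n / (?n + p)) * v powr (p / (?n + p)) = v powr (?n / (?n + p) + p / (?n + p))"
    by (simp add: powr_add)
  also have "?n / (?n + p) + p / (?n + p) = 1" using p by (simp add: add_divide_distrib[symmetric])
  finally show ?thesis
    using pos by (simp add: geominimal_functional_def w_def v_def y_def)
qed

text \<open>The exponent \<open>(n + p) / p\<close>, with \<open>n\<close> the dimension, is
  positive for \<open>p > 0\<close> and for \<open>p < - n\<close>, so the infimum and the supremum
  of the definition persist there. For \<open>- n < p < 0\<close> it is negative and turns the
  supremum into an infimum.\<close>

lemma Lp_geominimal_power:
  assumes p: "p \<noteq> 0" "p \<noteq> - real CARD('n)"
  defines "E \<equiv> ennreal_powr (Lp_geominimal p K / ennreal (real CARD('n) * measure lebesgue K)) ((real CARD('n) + p) / p)"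
  shows "- real CARD('n) < p \<Longrightarrow> E = (INF Q\<in>convex_bodies0. ennreal (normalized_functional p Q))"
    and "p < - real CARD('n) \<Longrightarrow> E = (SUP Q\<in>convex_bodies0. ennreal (normalized_functional p Q))"
proof -
  let ?n = "real CARD('n)"
  define a where "a = (?n + p) / p"
  have np: "?n + p \<noteq> 0" using p(2) by linarith
  have nv: "0 < ?n * measure lebesgue K" using volume_pos by simp
  define X where "X Q = normalized_functional p Q powr (p / (?n + p))" for Q
  have fX: "ennreal (geominimal_functional p K Q) / ennreal (?n * measure lebesgue K) = ennreal (X Q)"
    if "Q \<in> convex_bodies0" for Q
  proof -
    have "0 \<le> geominimal_functional p K Q" by (simp add: geominimal_functional_def)
    then show ?thesis
      using geominimal_functional_normalized[OF _ p(1) np, of Q] that nv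
      by (simp add: divide_ennreal X_def convex_bodies0_iff)
  qed
  have X0: "0 < X Q" if "Q \<in> convex_bodies0" for Q
    using normalized_functional_pos[of Q p] that unfolding X_def convex_bodies0_iff by simp
  have Xa: "X Q powr a = normalized_functional p Q" if "Q \<in> convex_bodies0" for Q
    using normalized_functional_pos[of Q p] that p(1) np by (simp add: X_def a_def powr_powr convex_bodies0_iff)
  have Ga: "ennreal_powr (ennreal (X Q)) a = ennreal (normalized_functional p Q)" if "Q \<in> convex_bodies0" for Q
    using Xa[OF that] X0[OF that] by (simp add: ennreal_powr_ennreal)
  have inf: "Lp_geominimal p K / ennreal (?n * measure lebesgue K) = (INF Q\<in>convex_bodies0. ennreal (X Q))" if "0 < p"
    using that fX nv by (simp add: Lp_geominimal_def divide_INF_ennreal)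
  have sup: "Lp_geominimal p K / ennreal (?n * measure lebesgue K) = (SUP Q\<in>convex_bodies0. ennreal (X Q))" if "p < 0"
    using that fX by (simp add: Lp_geominimal_def SUP_divide_ennreal)
  have "K \<in> convex_bodies0" by (simp add: convex_bodies0_iff convex_body_zero_axioms)
  show "E = (INF Q\<in>convex_bodies0. ennreal (normalized_functional p Q))" if gt: "- ?n < p"
  proof (cases "0 < p")
    case True
    then have "0 < a" by (simp add: a_def)
    then show ?thesis
      unfolding E_def inf[OF True] a_def[symmetric] using Ga by (simp add: ennreal_powr_INF)
  next
    case False
    then have p0: "p < 0" using p by simp
    then have a0: "a < 0" using gt by (simp add: a_def divide_pos_neg)
    \<comment> \<open>The candidate \<open>Q = K\<close> makes the supremum positive, which excludes
      base 0 under the negative exponent.\<close>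
    have "0 < ennreal (X K)" using X0 \<open>K \<in> convex_bodies0\<close> by simp
    also have "\<dots> \<le> (SUP Q\<in>convex_bodies0. ennreal (X Q))" using \<open>K \<in> convex_bodies0\<close> by (rule SUP_upper)
    finally have "E = inverse (SUP Q\<in>convex_bodies0. ennreal_powr (ennreal (X Q)) (- a))"
      unfolding E_def sup[OF p0] a_def[symmetric] using a0 by (simp add: ennreal_powr_neg ennreal_powr_SUP)
    also have "\<dots> = (INF Q\<in>convex_bodies0. inverse (ennreal_powr (ennreal (X Q)) (- a)))"
      by (rule inverse_SUP_ennreal)
    also have "\<dots> = (INF Q\<in>convex_bodies0. ennreal (normalized_functional p Q))"
      using Ga X0 a0 by (intro INF_cong refl) (simp add: ennreal_powr_neg[symmetric])
    finally show ?thesis .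
  qed
  show "E = (SUP Q\<in>convex_bodies0. ennreal (normalized_functional p Q))" if lt: "p < - ?n"
  proof -
    have p0: "p < 0" using lt of_nat_0_le_iff[of "CARD('n)"] by linarith
    then have "0 < a" using lt by (simp add: a_def divide_neg_neg)
    then show ?thesis
      unfolding E_def sup[OF p0] a_def[symmetric] using Ga by (simp add: ennreal_powr_SUP)
  qed
qed

end

theorem theorem5p2:
  fixes K :: "(real^'n) set" and p q :: real
  assumes "convex_body K" and "0 \<in> interior K"
    and "p \<noteq> 0" and "q \<noteq> 0"
  shows "((- real CARD('n) < q \<and> q < p) \<or> (q < p \<and> p < - real CARD('n)) \<longrightarrow>
            ennreal_powr (Lp_geominimal q K / ennreal (real CARD('n) * measure lebesgue K))
              ((real CARD('n) + q) / q)
            \<le> ennreal_powr (Lp_geominimal p K / ennreal (real CARD('n) * measure lebesgue K))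
                ((real CARD('n) + p) / p))
       \<and> (q < - real CARD('n) \<and> - real CARD('n) < p \<longrightarrow>
            ennreal_powr (Lp_geominimal q K / ennreal (real CARD('n) * measure lebesgue K))
              ((real CARD('n) + q) / q)
            \<ge> ennreal_powr (Lp_geominimal p K / ennreal (real CARD('n) * measure lebesgue K))
                ((real CARD('n) + p) / p))"
proof -
  interpret convex_body_zero K
    using assms(1,2) by unfold_locales (auto simp: convex_body_def)
  let ?n = "real CARD('n)"
  let ?E = "\<lambda>p. ennreal_powr (Lp_geominimal p K / ennreal (?n * measure lebesgue K)) ((?n + p) / p)"
  let ?F = "\<lambda>p Q. ennreal (normalized_functional p Q)"
  have mono: "?F q Q \<le> ?F p Q" if "q < p" "Q \<in> convex_bodies0" for Q
    using that assms(3,4) by (intro ennreal_leI normalized_functional_mono) (auto simp: convex_bodies0_iff)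
  note E = Lp_geominimal_power
  have "?E q \<le> ?E p" if "- ?n < q" "q < p"
  proof -
    have "(INF Q\<in>convex_bodies0. ?F q Q) \<le> (INF Q\<in>convex_bodies0. ?F p Q)"
      using that mono by (intro INF_mono) blast
    then show ?thesis using that assms(3,4) by (simp add: E(1))
  qed
  moreover have "?E q \<le> ?E p" if "q < p" "p < - ?n"
  proof -
    have "(SUP Q\<in>convex_bodies0. ?F q Q) \<le> (SUP Q\<in>convex_bodies0. ?F p Q)"
      using that mono by (intro SUP_mono) blast
    then show ?thesis using that assms(3,4) by (simp add: E(2))
  qed
  moreover have "?E p \<le> ?E q" if "q < - ?n" "- ?n < p"
  proof -
    have K: "K \<in> convex_bodies0" by (simp add: convex_bodies0_iff convex_body_zero_axioms)
    have "Lp_mixed_volume c K K = measure lebesgue K" if "c \<noteq> 0" for c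
    proof -
      have "(\<integral>u. (support_fun K u / support_fun K u) powr c * support_fun K u \<partial>surface_area_measure K)
          = (\<integral>u. support_fun K u \<partial>surface_area_measure K)"
        by (rule Bochner_Integration.integral_cong) auto
      then show ?thesis
        by (simp add: Lp_mixed_volume_weighted(2)[OF convex_body_zero_axioms] integral_support_fun)
    qed
    then have eq: "normalized_functional p K = normalized_functional q K"
      using assms(3,4) by (simp add: normalized_functional_def)
    \<comment> \<open>The power is an infimum for \<open>p\<close> and a supremum for
      \<open>q\<close>; the common value at \<open>K\<close> lies between them.\<close>
    have "(INF Q\<in>convex_bodies0. ?F p Q) \<le> ?F p K" using K by (rule INF_lower)
    also have "?F p K \<le> (SUP Q\<in>convex_bodies0. ?F q Q)" unfolding eq using K by (rule SUP_upper)
    finally show ?thesis using that assms(3,4) by (simp add: E)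
  qed
  ultimately show ?thesis by blast
qed

end
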